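(* Let $(\mathcal{B},\mathcal{A},e,i,l)$ be a cleft extension of abelian categories, with associated endofunctor $F:\mathcal{B}\to\mathcal{B}$. If $F$ is perfect and nilpotent, then the cleft extension $(\mathcal{B},\mathcal{A},e,i,l)$ is compatible.
   Context: Gorenstein notions. For an abelian category $\mathcal{C}$, $\mathrm{Proj}\,\mathcal{C}$ is the full subcategory of projective objects. A complete $\mathcal{C}$-projective resolution is an exact complex $P^\bullet=\cdots\to P^{-1}\to P^0\to P^1\to\cdots$ with all $P^i\in\mathrm{Proj}\,\mathcal{C}$ such that $\mathrm{Hom}_{\mathcal{C}}(P^\bullet,Q)$ is exact for every $Q\in\mathrm{Proj}\,\mathcal{C}$. Cleft extensions. A cleft extension $(\mathcal{B},\mathcal{A},e,i,l)$ of an abelian category $\mathcal{B}$ is an abelian category $\mathcal{A}$ together with functors $i:\mathcal{B}\to\mathcal{A}$, $e:\mathcal{A}\to\mathcal{B}$, $l:\mathcal{B}\to\mathcal{A}$ such that $e$ is faithful exact, $l$ is left adjoint to $e$, and there is a natural isomorphism $ei\cong\mathrm{Id}_{\mathcal{B}}$. It is known that then $i$ is fully faithful and exact and has a left adjoint $q:\mathcal{A}\to\mathcal{B}$, and $ql\cong\mathrm{Id}_{\mathcal{B}}$. Let $G:\mathcal{A}\to\mathcal{A}$ be the kernel of the counit $le\to\mathrm{Id}_{\mathcal{A}}$ (an epimorphism), so $0\to G\to le\to\mathrm{Id}_{\mathcal{A}}\to0$ is exact, and put $F=eGi:\mathcal{B}\to\mathcal{B}$; there is a split short exact sequence $0\to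 F\to el\to\mathrm{Id}_{\mathcal{B}}\to0$. $F^j$ is the $j$-fold composite; $F$ is nilpotent if $F^s=0$ for some $s$. $\mathbb{L}_i$ denotes the $i$-th left derived functor; the categories are assumed to have enough projectives. $\mathrm{pd}_{\mathcal{B}}$ denotes projective dimension. Perfect. $F:\mathcal{B}\to\mathcal{B}$ is perfect if: (1) $\mathbb{L}_iF^j(F(P))=0$ for all $i,j>0$ and $P\in\mathrm{Proj}\,\mathcal{B}$; (2) there is some $n\ge0$ such that $\mathbb{L}_iF^j=0$ for all $i,j>0$ with $i+j\ge n+1$; (3) $\mathrm{pd}_{\mathcal{B}}F(P)<\infty$ for every $P\in\mathrm{Proj}\,\mathcal{B}$. Compatible. The cleft extension is compatible if both of the following hold. (C1) For any complete $\mathcal{B}$-projective resolution $P^\bullet$ and any $P'\in\mathrm{Proj}\,\mathcal{B}$, the complexes $F(P^\bullet)$ and $\mathrm{Hom}_{\mathcal{B}}(P^\bullet,F(P'))$ are acyclic. (C2) At least one of the following holds: (i) for any complete $\mathcal{A}$-projective resolution $Q^\bullet$ and any $P\in\mathrm{Proj}\,\mathcal{B}$, the complexes $q(Q^\bullet)$ and $\mathrm{Hom}_{\mathcal{A}}(Q^\bullet,i(P))$ are acyclic; (ii) $F$ is nilpotent, $\mathbb{L}_iF^j(F(P))=0$ for all $i,j>0$ and $P\in\mathrm{Proj}\,\mathcal{B}$, and for any complete $\mathcal{A}$-projective resolution $Q^\bullet$, any $P\in\mathrm{Proj}\,\mathcal{B}$ and any $j>0$, the complexes $F^j(eQ^\bullet)$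 and $\mathrm{Hom}_{\mathcal{A}}(Q^\bullet,lF^j(P))$ are acyclic. *)

theory Defs
  imports "HOL-Algebra.Coset" "HOL-Library.Extended_Nat"
begin

section \<open>Abelian categories\<close>

text \<open>Categories are carried by a set of objects and a set of arrows, as in HOL-Algebra; all
  predicates are relative to these carriers. \<open>g \<cdot> f\<close> is composition in the usual order,
  and \<open>Zero X Y\<close> is the zero arrow from \<open>X\<close> to \<open>Y\<close>.\<close>

record ('o, 'm) abcat =
  Obj :: "'o set"
  Arr :: "'m set"
  Dom :: "'m \<Rightarrow> 'o"
  Cod :: "'m \<Rightarrow> 'o"
  Ident :: "'o \<Rightarrow> 'm"
  Comp :: "'m \<Rightarrow> 'm \<Rightarrow> 'm" (infixl "\<cdot>\<index>" 70)
  Add :: "'m \<Rightarrow> 'm \<Rightarrow> 'm"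
  Zero :: "'o \<Rightarrow> 'o \<Rightarrow> 'm"

definition Hom :: "('o, 'm) abcat \<Rightarrow> 'o \<Rightarrow> 'o \<Rightarrow> 'm set" where
  "Hom C X Y = {f \<in> Arr C. Dom C f = X \<and> Cod C f = Y}"

definition hom_group :: "('o, 'm) abcat \<Rightarrow> 'o \<Rightarrow> 'o \<Rightarrow> 'm monoid" where
  "hom_group C X Y = \<lparr>carrier = Hom C X Y, mult = Add C, one = Zero C X Y\<rparr>"

locale category =
  fixes C :: "('o, 'm) abcat" (structure)
  assumes Dom_in_Obj: "f \<in> Arr C \<Longrightarrow> Dom C f \<in> Obj C"
    and Cod_in_Obj: "f \<in> Arr C \<Longrightarrow> Cod C f \<in> Obj C"
    and Ident_in_Hom: "X \<in> Obj C \<Longrightarrow> Ident C X \<in> Hom C X X"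
    and Comp_in_Hom: "f \<in> Hom C X Y \<Longrightarrow> g \<in> Hom C Y Z \<Longrightarrow> g \<cdot> f \<in> Hom C X Z"
    and Comp_assoc: "f \<in> Hom C W X \<Longrightarrow> g \<in> Hom C X Y \<Longrightarrow> h \<in> Hom C Y Z
        \<Longrightarrow> (h \<cdot> g) \<cdot> f = h \<cdot> (g \<cdot> f)"
    and Comp_Ident_right: "f \<in> Hom C X Y \<Longrightarrow> f \<cdot> Ident C X = f"
    and Comp_Ident_left: "f \<in> Hom C X Y \<Longrightarrow> Ident C Y \<cdot> f = f"

locale preadditive_category = category +
  assumes hom_comm_group: "X \<in> Obj C \<Longrightarrow> Y \<in> Obj C \<Longrightarrow> comm_group (hom_group C X Y)"
    and Comp_Add_right: "f \<in> Hom C X Y \<Longrightarrow> f' \<in> Hom C X Y \<Longrightarrow> g \<in> Hom C Y Z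
        \<Longrightarrow> g \<cdot> Add C f f' = Add C (g \<cdot> f) (g \<cdot> f')"
    and Comp_Add_left: "f \<in> Hom C X Y \<Longrightarrow> g \<in> Hom C Y Z \<Longrightarrow> g' \<in> Hom C Y Z
        \<Longrightarrow> Add C g g' \<cdot> f = Add C (g \<cdot> f) (g' \<cdot> f)"

definition mono_arr :: "('o, 'm) abcat \<Rightarrow> 'm \<Rightarrow> bool" where
  "mono_arr C f \<longleftrightarrow> f \<in> Arr C \<and>
    (\<forall>W \<in> Obj C. \<forall>u \<in> Hom C W (Dom C f). \<forall>v \<in> Hom C W (Dom C f).
       f \<cdot>\<^bsub>C\<^esub> u = f \<cdot>\<^bsub>C\<^esub> v \<longrightarrow> u = v)"

definition epi_arr :: "('o, 'm) abcat \<Rightarrow> 'm \<Rightarrow> bool" where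
  "epi_arr C f \<longleftrightarrow> f \<in> Arr C \<and>
    (\<forall>Z \<in> Obj C. \<forall>u \<in> Hom C (Cod C f) Z. \<forall>v \<in> Hom C (Cod C f) Z.
       u \<cdot>\<^bsub>C\<^esub> f = v \<cdot>\<^bsub>C\<^esub> f \<longrightarrow> u = v)"

definition iso_arr :: "('o, 'm) abcat \<Rightarrow> 'm \<Rightarrow> bool" where
  "iso_arr C f \<longleftrightarrow> f \<in> Arr C \<and>
    (\<exists>g \<in> Hom C (Cod C f) (Dom C f).
       g \<cdot>\<^bsub>C\<^esub> f = Ident C (Dom C f) \<and> f \<cdot>\<^bsub>C\<^esub> g = Ident C (Cod C f))"

definition is_kernel :: "('o, 'm) abcat \<Rightarrow> 'm \<Rightarrow> 'm \<Rightarrow> bool" where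
  "is_kernel C f k \<longleftrightarrow> f \<in> Arr C \<and> k \<in> Arr C \<and> Cod C k = Dom C f \<and>
    f \<cdot>\<^bsub>C\<^esub> k = Zero C (Dom C k) (Cod C f) \<and>
    (\<forall>W \<in> Obj C. \<forall>h \<in> Hom C W (Dom C f). f \<cdot>\<^bsub>C\<^esub> h = Zero C W (Cod C f) \<longrightarrow>
       (\<exists>!u. u \<in> Hom C W (Dom C k) \<and> k \<cdot>\<^bsub>C\<^esub> u = h))"

definition is_cokernel :: "('o, 'm) abcat \<Rightarrow> 'm \<Rightarrow> 'm \<Rightarrow> bool" where
  "is_cokernel C f c \<longleftrightarrow> f \<in> Arr C \<and> c \<in> Arr C \<and> Dom C c = Cod C f \<and>
    c \<cdot>\<^bsub>C\<^esub> f = Zero C (Dom C f) (Cod C c) \<and>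
    (\<forall>Z \<in> Obj C. \<forall>h \<in> Hom C (Cod C f) Z. h \<cdot>\<^bsub>C\<^esub> f = Zero C (Dom C f) Z \<longrightarrow>
       (\<exists>!u. u \<in> Hom C (Cod C c) Z \<and> u \<cdot>\<^bsub>C\<^esub> c = h))"

definition zero_object :: "('o, 'm) abcat \<Rightarrow> 'o \<Rightarrow> bool" where
  "zero_object C Z \<longleftrightarrow> Z \<in> Obj C \<and>
    (\<forall>X \<in> Obj C. (\<exists>!f. f \<in> Hom C X Z) \<and> (\<exists>!f. f \<in> Hom C Z X))"

definition is_biproduct ::
    "('o, 'm) abcat \<Rightarrow> 'o \<Rightarrow> 'o \<Rightarrow> 'o \<Rightarrow> 'm \<Rightarrow> 'm \<Rightarrow> 'm \<Rightarrow> 'm \<Rightarrow> bool" where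
  "is_biproduct C X Y S j1 j2 p1 p2 \<longleftrightarrow>
    j1 \<in> Hom C X S \<and> j2 \<in> Hom C Y S \<and> p1 \<in> Hom C S X \<and> p2 \<in> Hom C S Y \<and>
    p1 \<cdot>\<^bsub>C\<^esub> j1 = Ident C X \<and> p2 \<cdot>\<^bsub>C\<^esub> j2 = Ident C Y \<and>
    p1 \<cdot>\<^bsub>C\<^esub> j2 = Zero C Y X \<and> p2 \<cdot>\<^bsub>C\<^esub> j1 = Zero C X Y \<and>
    Add C (j1 \<cdot>\<^bsub>C\<^esub> p1) (j2 \<cdot>\<^bsub>C\<^esub> p2) = Ident C S"

locale abelian_category = preadditive_category +
  assumes zero_object_exists: "\<exists>Z. zero_object C Z"
    and biproduct_exists: "X \<in> Obj C \<Longrightarrow> Y \<in> Obj C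
        \<Longrightarrow> \<exists>S j1 j2 p1 p2. is_biproduct C X Y S j1 j2 p1 p2"
    and kernel_exists: "f \<in> Arr C \<Longrightarrow> \<exists>k. is_kernel C f k"
    and cokernel_exists: "f \<in> Arr C \<Longrightarrow> \<exists>c. is_cokernel C f c"
    and mono_is_kernel: "mono_arr C f \<Longrightarrow> \<exists>g. is_kernel C g f"
    and epi_is_cokernel: "epi_arr C f \<Longrightarrow> \<exists>g. is_cokernel C g f"


section \<open>Exactness and homology\<close>

text \<open>The image of \<open>f\<close> is the kernel of its cokernel; exactness says that it is also the
  kernel of \<open>g\<close>.\<close>

definition exact_at :: "('o, 'm) abcat \<Rightarrow> 'm \<Rightarrow> 'm \<Rightarrow> bool" where
  "exact_at C f g \<longleftrightarrow> (\<exists>c m. is_cokernel C f c \<and> is_kernel C c m \<and> is_kernel C g m)"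

definition short_exact :: "('o, 'm) abcat \<Rightarrow> 'm \<Rightarrow> 'm \<Rightarrow> bool" where
  "short_exact C f g \<longleftrightarrow> is_kernel C g f \<and> is_cokernel C f g"

text \<open>For \<open>g \<cdot> f = 0\<close>: the cokernel of the arrow \<open>u\<close> induced by \<open>f\<close> into the kernel of \<open>g\<close>.\<close>

definition homology :: "('o, 'm) abcat \<Rightarrow> 'm \<Rightarrow> 'm \<Rightarrow> 'o" where
  "homology C f g = (SOME H. \<exists>k u c. is_kernel C g k \<and> u \<in> Hom C (Dom C f) (Dom C k) \<and>
     k \<cdot>\<^bsub>C\<^esub> u = f \<and> is_cokernel C u c \<and> H = Cod C c)"

record ('o, 'm) cochain =
  cobj :: "int \<Rightarrow> 'o"
  cdiff :: "int \<Rightarrow> 'm"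

definition is_complex :: "('o, 'm) abcat \<Rightarrow> ('o, 'm) cochain \<Rightarrow> bool" where
  "is_complex C P \<longleftrightarrow> (\<forall>n. cobj P n \<in> Obj C \<and> cdiff P n \<in> Hom C (cobj P n) (cobj P (n + 1)) \<and>
     cdiff P (n + 1) \<cdot>\<^bsub>C\<^esub> cdiff P n = Zero C (cobj P n) (cobj P (n + 2)))"

definition acyclic_complex :: "('o, 'm) abcat \<Rightarrow> ('o, 'm) cochain \<Rightarrow> bool" where
  "acyclic_complex C P \<longleftrightarrow> is_complex C P \<and> (\<forall>n. exact_at C (cdiff P (n - 1)) (cdiff P n))"

text \<open>Exactness of the complex of abelian groups \<open>Hom(P, Y)\<close>, i.e. of
  \<open>Hom(P\<^sup>n\<^sup>+\<^sup>1, Y) \<rightarrow> Hom(P\<^sup>n, Y) \<rightarrow> Hom(P\<^sup>n\<^sup>-\<^sup>1, Y)\<close> for all \<open>n\<close>.\<close>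

definition hom_acyclic :: "('o, 'm) abcat \<Rightarrow> ('o, 'm) cochain \<Rightarrow> 'o \<Rightarrow> bool" where
  "hom_acyclic C P Y \<longleftrightarrow> (\<forall>n.
     (\<lambda>g. g \<cdot>\<^bsub>C\<^esub> cdiff P n) ` carrier (hom_group C (cobj P (n + 1)) Y) =
     kernel (hom_group C (cobj P n) Y) (hom_group C (cobj P (n - 1)) Y)
       (\<lambda>g. g \<cdot>\<^bsub>C\<^esub> cdiff P (n - 1)))"


section \<open>Projective objects and resolutions\<close>

definition projective :: "('o, 'm) abcat \<Rightarrow> 'o \<Rightarrow> bool" where
  "projective C P \<longleftrightarrow> P \<in> Obj C \<and>
    (\<forall>p f. epi_arr C p \<and> f \<in> Hom C P (Cod C p) \<longrightarrow>
       (\<exists>g \<in> Hom C P (Dom C p). p \<cdot>\<^bsub>C\<^esub> g = f))"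

definition enough_projectives :: "('o, 'm) abcat \<Rightarrow> bool" where
  "enough_projectives C \<longleftrightarrow>
    (\<forall>X \<in> Obj C. \<exists>P. projective C P \<and> (\<exists>p \<in> Hom C P X. epi_arr C p))"

definition complete_projective_resolution ::
    "('o, 'm) abcat \<Rightarrow> ('o, 'm) cochain \<Rightarrow> bool" where
  "complete_projective_resolution C P \<longleftrightarrow> acyclic_complex C P \<and>
    (\<forall>n. projective C (cobj P n)) \<and> (\<forall>Q. projective C Q \<longrightarrow> hom_acyclic C P Q)"

text \<open>A resolution \<open>\<cdots> \<rightarrow> P\<^sub>1 \<rightarrow> P\<^sub>0 \<rightarrow> X \<rightarrow> 0\<close> with \<open>rdiff R n : P\<^sub>n\<^sub>+\<^sub>1 \<rightarrow> P\<^sub>n\<close>.\<close>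

record ('o, 'm) resolution =
  rterm :: "nat \<Rightarrow> 'o"
  rdiff :: "nat \<Rightarrow> 'm"
  raug :: 'm

definition projective_resolution ::
    "('o, 'm) abcat \<Rightarrow> 'o \<Rightarrow> ('o, 'm) resolution \<Rightarrow> bool" where
  "projective_resolution C X R \<longleftrightarrow>
    (\<forall>n. projective C (rterm R n) \<and> rdiff R n \<in> Hom C (rterm R (Suc n)) (rterm R n)) \<and>
    raug R \<in> Hom C (rterm R 0) X \<and> epi_arr C (raug R) \<and>
    exact_at C (rdiff R 0) (raug R) \<and>
    (\<forall>n. exact_at C (rdiff R (Suc n)) (rdiff R n))"

definition proj_dim :: "('o, 'm) abcat \<Rightarrow> 'o \<Rightarrow> enat" where
  "proj_dim C X = Inf {enat n | n. \<exists>R. projective_resolution C X R \<and>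
     (\<forall>k > n. zero_object C (rterm R k))}"


section \<open>Functors, natural transformations, adjunctions\<close>

record ('o, 'm, 'p, 'n) ftor =
  fobj :: "'o \<Rightarrow> 'p"
  fmap :: "'m \<Rightarrow> 'n"

definition is_functor ::
    "('o, 'm) abcat \<Rightarrow> ('p, 'n) abcat \<Rightarrow> ('o, 'm, 'p, 'n) ftor \<Rightarrow> bool" where
  "is_functor C D T \<longleftrightarrow>
    (\<forall>X \<in> Obj C. fobj T X \<in> Obj D \<and> fmap T (Ident C X) = Ident D (fobj T X)) \<and>
    (\<forall>X \<in> Obj C. \<forall>Y \<in> Obj C. \<forall>f \<in> Hom C X Y. fmap T f \<in> Hom D (fobj T X) (fobj T Y)) \<and>
    (\<forall>X \<in> Obj C. \<forall>Y \<in> Obj C. \<forall>Z \<in> Obj C. \<forall>f \<in> Hom C X Y. \<forall>g \<in> Hom C Y Z.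
       fmap T (g \<cdot>\<^bsub>C\<^esub> f) = fmap T g \<cdot>\<^bsub>D\<^esub> fmap T f)"

definition id_ftor :: "('o, 'm, 'o, 'm) ftor" where
  "id_ftor = \<lparr>fobj = (\<lambda>X. X), fmap = (\<lambda>f. f)\<rparr>"

definition comp_ftor ::
    "('p, 'n, 'q, 'k) ftor \<Rightarrow> ('o, 'm, 'p, 'n) ftor \<Rightarrow> ('o, 'm, 'q, 'k) ftor"
    (infixr "\<circ>\<^sub>F" 75) where
  "S \<circ>\<^sub>F T = \<lparr>fobj = (\<lambda>X. fobj S (fobj T X)), fmap = (\<lambda>f. fmap S (fmap T f))\<rparr>"

primrec pow_ftor :: "('o, 'm, 'o, 'm) ftor \<Rightarrow> nat \<Rightarrow> ('o, 'm, 'o, 'm) ftor" where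
  "pow_ftor T 0 = id_ftor"
| "pow_ftor T (Suc j) = T \<circ>\<^sub>F pow_ftor T j"

definition additive_functor ::
    "('o, 'm) abcat \<Rightarrow> ('p, 'n) abcat \<Rightarrow> ('o, 'm, 'p, 'n) ftor \<Rightarrow> bool" where
  "additive_functor C D T \<longleftrightarrow> is_functor C D T \<and>
    (\<forall>X \<in> Obj C. \<forall>Y \<in> Obj C. \<forall>f \<in> Hom C X Y. \<forall>g \<in> Hom C X Y.
       fmap T (Add C f g) = Add D (fmap T f) (fmap T g))"

definition exact_functor ::
    "('o, 'm) abcat \<Rightarrow> ('p, 'n) abcat \<Rightarrow> ('o, 'm, 'p, 'n) ftor \<Rightarrow> bool" where
  "exact_functor C D T \<longleftrightarrow> additive_functor C D T \<and>
    (\<forall>f g. short_exact C f g \<longrightarrow> short_exact D (fmap T f) (fmap T g))"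

definition faithful_functor ::
    "('o, 'm) abcat \<Rightarrow> ('p, 'n) abcat \<Rightarrow> ('o, 'm, 'p, 'n) ftor \<Rightarrow> bool" where
  "faithful_functor C D T \<longleftrightarrow> is_functor C D T \<and>
    (\<forall>X \<in> Obj C. \<forall>Y \<in> Obj C. inj_on (fmap T) (Hom C X Y))"

definition natural_trans ::
    "('o, 'm) abcat \<Rightarrow> ('p, 'n) abcat \<Rightarrow> ('o, 'm, 'p, 'n) ftor \<Rightarrow> ('o, 'm, 'p, 'n) ftor
     \<Rightarrow> ('o \<Rightarrow> 'n) \<Rightarrow> bool" where
  "natural_trans C D S T \<tau> \<longleftrightarrow>
    (\<forall>X \<in> Obj C. \<tau> X \<in> Hom D (fobj S X) (fobj T X)) \<and>
    (\<forall>X \<in> Obj C. \<forall>Y \<in> Obj C. \<forall>f \<in> Hom C X Y.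
       \<tau> Y \<cdot>\<^bsub>D\<^esub> fmap S f = fmap T f \<cdot>\<^bsub>D\<^esub> \<tau> X)"

definition naturally_isomorphic ::
    "('o, 'm) abcat \<Rightarrow> ('p, 'n) abcat \<Rightarrow> ('o, 'm, 'p, 'n) ftor \<Rightarrow> ('o, 'm, 'p, 'n) ftor
     \<Rightarrow> bool" where
  "naturally_isomorphic C D S T \<longleftrightarrow>
    (\<exists>\<tau>. natural_trans C D S T \<tau> \<and> (\<forall>X \<in> Obj C. iso_arr D (\<tau> X)))"

text \<open>\<open>L : C \<rightarrow> D\<close> is left adjoint to \<open>R : D \<rightarrow> C\<close>, with unit \<open>\<eta>\<close> and counit \<open>\<epsilon>\<close>.\<close>

definition adjunction ::
    "('o, 'm) abcat \<Rightarrow> ('p, 'n) abcat \<Rightarrow> ('o, 'm, 'p, 'n) ftor \<Rightarrow> ('p, 'n, 'o, 'm) ftor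
     \<Rightarrow> ('o \<Rightarrow> 'm) \<Rightarrow> ('p \<Rightarrow> 'n) \<Rightarrow> bool" where
  "adjunction C D L R \<eta> \<epsilon> \<longleftrightarrow> is_functor C D L \<and> is_functor D C R \<and>
    natural_trans C C id_ftor (R \<circ>\<^sub>F L) \<eta> \<and>
    natural_trans D D (L \<circ>\<^sub>F R) id_ftor \<epsilon> \<and>
    (\<forall>X \<in> Obj C. \<epsilon> (fobj L X) \<cdot>\<^bsub>D\<^esub> fmap L (\<eta> X) = Ident D (fobj L X)) \<and>
    (\<forall>Y \<in> Obj D. fmap R (\<epsilon> Y) \<cdot>\<^bsub>C\<^esub> \<eta> (fobj R Y) = Ident C (fobj R Y))"

definition map_complex ::
    "('o, 'm, 'p, 'n) ftor \<Rightarrow> ('o, 'm) cochain \<Rightarrow> ('p, 'n) cochain" where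
  "map_complex T P = \<lparr>cobj = (\<lambda>n. fobj T (cobj P n)), cdiff = (\<lambda>n. fmap T (cdiff P n))\<rparr>"

text \<open>The value of the \<open>n\<close>-th left derived functor at an object \<open>X\<close>: the \<open>n\<close>-th homology of
  \<open>T(P\<^sub>\<bullet>)\<close> for a chosen projective resolution \<open>P\<^sub>\<bullet>\<close> of \<open>X\<close>. In degree \<open>0\<close> the outgoing
  differential is the zero arrow to a zero object.\<close>

definition left_derived ::
    "('o, 'm) abcat \<Rightarrow> ('p, 'n) abcat \<Rightarrow> ('o, 'm, 'p, 'n) ftor \<Rightarrow> nat \<Rightarrow> 'o \<Rightarrow> 'p" where
  "left_derived C D T n X =
    (let R = (SOME R. projective_resolution C X R)
     in homology D (fmap T (rdiff R n))
          (case n of 0 \<Rightarrow> Zero D (fobj T (rterm R 0)) (SOME Z. zero_object D Z)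
           | Suc m \<Rightarrow> fmap T (rdiff R m)))"


section \<open>Cleft extensions\<close>

definition cleft_extension ::
    "('p, 'n) abcat \<Rightarrow> ('o, 'm) abcat \<Rightarrow> ('o, 'm, 'p, 'n) ftor \<Rightarrow> ('p, 'n, 'o, 'm) ftor
     \<Rightarrow> ('p, 'n, 'o, 'm) ftor \<Rightarrow> ('p \<Rightarrow> 'n) \<Rightarrow> ('o \<Rightarrow> 'm) \<Rightarrow> bool" where
  "cleft_extension B A e i l \<eta> \<epsilon> \<longleftrightarrow> abelian_category B \<and> abelian_category A \<and>
    is_functor B A i \<and> faithful_functor A B e \<and> exact_functor A B e \<and>
    adjunction B A l e \<eta> \<epsilon> \<and> naturally_isomorphic B B (e \<circ>\<^sub>F i) id_ftor"

text \<open>\<open>G\<close>, together with the natural transformation \<open>\<kappa>\<close>, is a kernel of the natural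
  transformation \<open>\<tau> : S \<rightarrow> T\<close>; it is determined up to a unique natural isomorphism.\<close>

definition kernel_functor ::
    "('o, 'm) abcat \<Rightarrow> ('p, 'n) abcat \<Rightarrow> ('o, 'm, 'p, 'n) ftor \<Rightarrow> ('o \<Rightarrow> 'n)
     \<Rightarrow> ('o, 'm, 'p, 'n) ftor \<Rightarrow> ('o \<Rightarrow> 'n) \<Rightarrow> bool" where
  "kernel_functor C D S \<tau> G \<kappa> \<longleftrightarrow> is_functor C D G \<and> natural_trans C D G S \<kappa> \<and>
    (\<forall>X \<in> Obj C. is_kernel D (\<tau> X) (\<kappa> X))"

definition nilpotent_functor :: "('o, 'm) abcat \<Rightarrow> ('o, 'm, 'o, 'm) ftor \<Rightarrow> bool" where
  "nilpotent_functor B F \<longleftrightarrow> (\<exists>s. \<forall>X \<in> Obj B. zero_object B (fobj (pow_ftor F s) X))"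

definition perfect_functor :: "('o, 'm) abcat \<Rightarrow> ('o, 'm, 'o, 'm) ftor \<Rightarrow> bool" where
  "perfect_functor B F \<longleftrightarrow>
    (\<forall>i>0. \<forall>j>0. \<forall>P. projective B P \<longrightarrow>
       zero_object B (left_derived B B (pow_ftor F j) i (fobj F P))) \<and>
    (\<exists>n. \<forall>i>0. \<forall>j>0. i + j \<ge> n + 1 \<longrightarrow>
       (\<forall>X \<in> Obj B. zero_object B (left_derived B B (pow_ftor F j) i X))) \<and>
    (\<forall>P. projective B P \<longrightarrow> proj_dim B (fobj F P) < \<infinity>)"

text \<open>In \<open>compatible_C2_i\<close> the functor \<open>q\<close> is the left adjoint of \<open>i\<close>, which is unique up to
  natural isomorphism.\<close>

definition compatible_C1 :: "('p, 'n) abcat \<Rightarrow> ('p, 'n, 'p, 'n) ftor \<Rightarrow> bool" where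
  "compatible_C1 B F \<longleftrightarrow>
    (\<forall>P P'. complete_projective_resolution B P \<and> projective B P' \<longrightarrow>
       acyclic_complex B (map_complex F P) \<and> hom_acyclic B P (fobj F P'))"

definition compatible_C2_i ::
    "('p, 'n) abcat \<Rightarrow> ('o, 'm) abcat \<Rightarrow> ('p, 'n, 'o, 'm) ftor \<Rightarrow> bool" where
  "compatible_C2_i B A i \<longleftrightarrow> (\<exists>q \<eta> \<epsilon>. adjunction A B q i \<eta> \<epsilon> \<and>
    (\<forall>Q P. complete_projective_resolution A Q \<and> projective B P \<longrightarrow>
       acyclic_complex B (map_complex q Q) \<and> hom_acyclic A Q (fobj i P)))"

definition compatible_C2_ii ::
    "('p, 'n) abcat \<Rightarrow> ('o, 'm) abcat \<Rightarrow> ('o, 'm, 'p, 'n) ftor \<Rightarrow> ('p, 'n, 'o, 'm) ftor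
     \<Rightarrow> ('p, 'n, 'p, 'n) ftor \<Rightarrow> bool" where
  "compatible_C2_ii B A e l F \<longleftrightarrow> nilpotent_functor B F \<and>
    (\<forall>i>0. \<forall>j>0. \<forall>P. projective B P \<longrightarrow>
       zero_object B (left_derived B B (pow_ftor F j) i (fobj F P))) \<and>
    (\<forall>Q P. \<forall>j>0. complete_projective_resolution A Q \<and> projective B P \<longrightarrow>
       acyclic_complex B (map_complex (pow_ftor F j \<circ>\<^sub>F e) Q) \<and>
       hom_acyclic A Q (fobj (l \<circ>\<^sub>F pow_ftor F j) P))"

definition compatible_cleft ::
    "('p, 'n) abcat \<Rightarrow> ('o, 'm) abcat \<Rightarrow> ('o, 'm, 'p, 'n) ftor \<Rightarrow> ('p, 'n, 'o, 'm) ftor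
     \<Rightarrow> ('p, 'n, 'o, 'm) ftor \<Rightarrow> ('p, 'n, 'p, 'n) ftor \<Rightarrow> bool" where
  "compatible_cleft B A e i l F \<longleftrightarrow>
    compatible_C1 B F \<and> (compatible_C2_i B A i \<or> compatible_C2_ii B A e l F)"

end

theory Submission imports Defs
begin

text \<open>
  The compatibility conditions ask that \<open>F\<close>, its powers and some Hom functors keep certain complexes
  acyclic. For the powers of \<open>F\<close> this holds because the terms of the complex are acyclic for the functor
  and the derived functors vanish in high degrees; for the Hom functors, because their second argument
  has a finite resolution by projective objects. Perfectness supplies all three.

  Let \<open>T\<close> be right exact with \<open>L\<^sub>n T = 0\<close> for all large \<open>n\<close>, and let \<open>E\<close> be an acyclic complex, unbounded
  on both sides, whose terms have \<open>L\<^sub>n T = 0\<close> for all \<open>n > 0\<close>. The short exact sequences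
  \<open>0 \<rightarrow> Z\<^sub>k \<rightarrow> E\<^sub>k \<rightarrow> Z\<^sub>k\<^sub>+\<^sub>1 \<rightarrow> 0\<close> of cocycles identify \<open>L\<^sub>1 T(Z\<^sub>k)\<close> with \<open>L\<^sub>n T\<close> of a later cocycle object,
  which is zero. So \<open>T\<close> keeps these sequences exact, and \<open>T(E)\<close> is acyclic
  (\<open>acyclic_map_complex\<close>). With \<open>T = F\<close> and \<open>E\<close> a complete projective resolution over \<open>B\<close> this is the
  first half of \<open>compatible_C1\<close>. With \<open>T = F\<^sup>j\<close> and \<open>E = e Q\<close> it is the first half of \<open>compatible_C2_ii\<close>: a
  projective object of \<open>A\<close> is a retract of some \<open>l P\<close> with \<open>P\<close> projective, and \<open>e l P\<close> is an extension of \<open>P\<close> by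
  \<open>F P\<close>, so perfectness makes \<open>e Q\<close> termwise \<open>F\<^sup>j\<close>-acyclic (\<open>derived_Fp_e_projective\<close>).

  For the Hom complexes, let \<open>Q\<close> be a complete projective resolution. The objects \<open>Y\<close> for which
  \<open>Hom(Q, Y)\<close> is acyclic include the projective ones and are closed under cokernels of monomorphisms
  (\<open>hom_acyclic_quotient\<close>). Hence they include all objects of finite projective dimension, in
  particular \<open>F P'\<close> for every projective \<open>P'\<close>; this is the second half of \<open>compatible_C1\<close>. Applying
  \<open>l F\<^sup>j\<close> to a finite projective
  resolution of \<open>F P\<close> gives an exact sequence that ends in \<open>l F\<^sup>j\<^sup>+\<^sup>1 P\<close>, because \<open>F P\<close> is acyclic for
  \<open>F\<^sup>j\<close> and \<open>F\<^sup>j\<^sup>+\<^sup>1\<close> and because \<open>l\<close> preserves every monomorphism that \<open>F\<close> preserves (\<open>l_mono\<close>). Induction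
  on \<open>j\<close>, which starts from the projective objects \<open>l P\<close>, then gives the second half of
  \<open>compatible_C2_ii\<close> (\<open>hom_acyclic_l_Fp\<close>).

  Derived functors enter only through the vanishing of their values. The predicate
  \<open>derived_vanishes\<close> expresses it by short exact sequences alone, and dimension shifting
  is then proved from pullbacks, without comparing resolutions or connecting arrows. One lemma,
  \<open>derived_vanishes_of_left_derived\<close>, links it to the homology of a chosen resolution.
\<close>

section \<open>Arrows, zero arrows and differences\<close>

lemma HomD:
  assumes "f \<in> Hom C X Y"
  shows "f \<in> Arr C" and "Dom C f = X" and "Cod C f = Y"
  using assms by (auto simp: Hom_def)

context category
begin

lemma Arr_Hom: "f \<in> Arr C \<Longrightarrow> f \<in> Hom C (Dom C f) (Cod C f)"
  by (simp add: Hom_def)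

lemma Hom_Obj:
  assumes "f \<in> Hom C X Y"
  shows "X \<in> Obj C" and "Y \<in> Obj C"
  using assms Dom_in_Obj Cod_in_Obj by (auto simp: Hom_def)

lemma mono_arrD:
  "mono_arr C f \<Longrightarrow> f \<in> Hom C X Y \<Longrightarrow> u \<in> Hom C W X \<Longrightarrow> v \<in> Hom C W X
    \<Longrightarrow> f \<cdot> u = f \<cdot> v \<Longrightarrow> u = v"
  unfolding mono_arr_def using Hom_Obj HomD by metis

lemma epi_arrD:
  "epi_arr C f \<Longrightarrow> f \<in> Hom C X Y \<Longrightarrow> u \<in> Hom C Y Z \<Longrightarrow> v \<in> Hom C Y Z
    \<Longrightarrow> u \<cdot> f = v \<cdot> f \<Longrightarrow> u = v"
  unfolding epi_arr_def using Hom_Obj HomD by metis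

lemma mono_arrI:
  assumes "f \<in> Hom C X Y"
    and "\<And>W u v. u \<in> Hom C W X \<Longrightarrow> v \<in> Hom C W X \<Longrightarrow> f \<cdot> u = f \<cdot> v \<Longrightarrow> u = v"
  shows "mono_arr C f"
  unfolding mono_arr_def using assms HomD[OF assms(1)] by blast

lemma epi_arrI:
  assumes "f \<in> Hom C X Y"
    and "\<And>Z u v. u \<in> Hom C Y Z \<Longrightarrow> v \<in> Hom C Y Z \<Longrightarrow> u \<cdot> f = v \<cdot> f \<Longrightarrow> u = v"
  shows "epi_arr C f"
  unfolding epi_arr_def using assms HomD[OF assms(1)] by blast

lemma mono_arr_Comp:
  assumes f: "f \<in> Hom C X Y" "mono_arr C f" and g: "g \<in> Hom C Y Z" "mono_arr C g"
  shows "mono_arr C (g \<cdot> f)"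
proof (rule mono_arrI[OF Comp_in_Hom[OF f(1) g(1)]])
  fix W u v assume uv: "u \<in> Hom C W X" "v \<in> Hom C W X" "(g \<cdot> f) \<cdot> u = (g \<cdot> f) \<cdot> v"
  then have "g \<cdot> (f \<cdot> u) = g \<cdot> (f \<cdot> v)"
    using Comp_assoc[OF uv(1) f(1) g(1)] Comp_assoc[OF uv(2) f(1) g(1)] by simp
  then show "u = v"
    using mono_arrD[OF g(2,1)] mono_arrD[OF f(2,1)] uv f Comp_in_Hom by metis
qed

lemma epi_arr_Comp:
  assumes f: "f \<in> Hom C X Y" "epi_arr C f" and g: "g \<in> Hom C Y Z" "epi_arr C g"
  shows "epi_arr C (g \<cdot> f)"
proof (rule epi_arrI[OF Comp_in_Hom[OF f(1) g(1)]])
  fix W u v assume uv: "u \<in> Hom C Z W" "v \<in> Hom C Z W" "u \<cdot> (g \<cdot> f) = v \<cdot> (g \<cdot> f)"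
  then have "(u \<cdot> g) \<cdot> f = (v \<cdot> g) \<cdot> f"
    using Comp_assoc[OF f(1) g(1) uv(1)] Comp_assoc[OF f(1) g(1) uv(2)] by simp
  then show "u = v"
    using epi_arrD[OF g(2,1)] epi_arrD[OF f(2,1)] uv g Comp_in_Hom by metis
qed

lemma mono_arr_of_Comp:
  assumes "f \<in> Hom C X Y" "g \<in> Hom C Y Z" "mono_arr C (g \<cdot> f)"
  shows "mono_arr C f"
proof (rule mono_arrI[OF assms(1)])
  fix W u v assume uv: "u \<in> Hom C W X" "v \<in> Hom C W X" "f \<cdot> u = f \<cdot> v"
  then have "(g \<cdot> f) \<cdot> u = (g \<cdot> f) \<cdot> v"
    using Comp_assoc[OF uv(1) assms(1,2)] Comp_assoc[OF uv(2) assms(1,2)] by simp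
  then show "u = v"
    using mono_arrD[OF assms(3) Comp_in_Hom[OF assms(1,2)]] uv by metis
qed

lemma epi_arr_of_Comp:
  assumes "f \<in> Hom C X Y" "g \<in> Hom C Y Z" "epi_arr C (g \<cdot> f)"
  shows "epi_arr C g"
proof (rule epi_arrI[OF assms(2)])
  fix W u v assume uv: "u \<in> Hom C Z W" "v \<in> Hom C Z W" "u \<cdot> g = v \<cdot> g"
  then have "u \<cdot> (g \<cdot> f) = v \<cdot> (g \<cdot> f)"
    using Comp_assoc[OF assms(1,2) uv(1)] Comp_assoc[OF assms(1,2) uv(2)] by simp
  then show "u = v"
    using epi_arrD[OF assms(3) Comp_in_Hom[OF assms(1,2)]] uv by metis
qed

lemma mono_arr_of_retraction:
  assumes "f \<in> Hom C X Y" "g \<in> Hom C Y X" "g \<cdot> f = Ident C X"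
  shows "mono_arr C f"
proof (rule mono_arr_of_Comp[OF assms(1,2)])
  show "mono_arr C (g \<cdot> f)"
    unfolding assms(3)
    by (rule mono_arrI[OF Ident_in_Hom[OF Hom_Obj(1)[OF assms(1)]]]) (metis Comp_Ident_left)
qed

lemma epi_arr_of_section:
  assumes "f \<in> Hom C X Y" "g \<in> Hom C Y X" "g \<cdot> f = Ident C X"
  shows "epi_arr C g"
proof (rule epi_arr_of_Comp[OF assms(1,2)])
  show "epi_arr C (g \<cdot> f)"
    unfolding assms(3)
    by (rule epi_arrI[OF Ident_in_Hom[OF Hom_Obj(1)[OF assms(1)]]]) (metis Comp_Ident_right)
qed

lemma projective_lift:
  assumes "projective C P" "epi_arr C p" "p \<in> Hom C X Y" "f \<in> Hom C P Y"
  obtains g where "g \<in> Hom C P X" "p \<cdot> g = f"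
  using assms unfolding projective_def by (metis HomD(2,3))

lemma projective_Obj: "projective C P \<Longrightarrow> P \<in> Obj C"
  by (simp add: projective_def)

lemma projective_section:
  assumes "projective C P" "epi_arr C p" "p \<in> Hom C X P"
  obtains s where "s \<in> Hom C P X" "p \<cdot> s = Ident C P"
  using projective_lift[OF assms Ident_in_Hom[OF projective_Obj[OF assms(1)]]] by metis

lemma projective_retract:
  assumes P: "projective C P" and s: "s \<in> Hom C X P" and r: "r \<in> Hom C P X"
    and rs: "r \<cdot> s = Ident C X"
  shows "projective C X"
  unfolding projective_def
proof (intro conjI allI impI)
  show "X \<in> Obj C" using Hom_Obj[OF s] by simp
  fix p f assume pf: "epi_arr C p \<and> f \<in> Hom C X (Cod C p)"
  then have p: "p \<in> Hom C (Dom C p) (Cod C p)"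
    by (auto simp: epi_arr_def intro: Arr_Hom)
  obtain g where g: "g \<in> Hom C P (Dom C p)" "p \<cdot> g = f \<cdot> r"
    using projective_lift[OF P _ p] Comp_in_Hom[OF r] pf by metis
  have "p \<cdot> (g \<cdot> s) = f \<cdot> (r \<cdot> s)"
    using Comp_assoc[OF s g(1) p] Comp_assoc[OF s r] g(2) pf by metis
  then have "p \<cdot> (g \<cdot> s) = f"
    using rs Comp_Ident_right pf by metis
  then show "\<exists>g \<in> Hom C X (Dom C p). p \<cdot> g = f"
    using Comp_in_Hom[OF s g(1)] by blast
qed

end

context preadditive_category
begin

lemma Zero_in_Hom:
  assumes "X \<in> Obj C" "Y \<in> Obj C"
  shows "Zero C X Y \<in> Hom C X Y"
proof -
  interpret H: comm_group "hom_group C X Y" by (rule hom_comm_group[OF assms])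
  show ?thesis using H.one_closed by (simp add: hom_group_def)
qed

lemma Add_in_Hom:
  assumes "f \<in> Hom C X Y" "g \<in> Hom C X Y"
  shows "Add C f g \<in> Hom C X Y"
proof -
  interpret H: comm_group "hom_group C X Y" by (rule hom_comm_group[OF Hom_Obj[OF assms(1)]])
  show ?thesis using H.m_closed[of f g] assms by (simp add: hom_group_def)
qed

lemma Add_Zero_left:
  assumes "f \<in> Hom C X Y"
  shows "Add C (Zero C X Y) f = f"
proof -
  interpret H: comm_group "hom_group C X Y" by (rule hom_comm_group[OF Hom_Obj[OF assms]])
  show ?thesis using H.l_one[of f] assms by (simp add: hom_group_def)
qed

lemma Add_Zero_right:
  assumes "f \<in> Hom C X Y"
  shows "Add C f (Zero C X Y) = f"
proof -
  interpret H: comm_group "hom_group C X Y" by (rule hom_comm_group[OF Hom_Obj[OF assms]])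
  show ?thesis using H.r_one[of f] assms by (simp add: hom_group_def)
qed

lemma Add_right_cancel:
  assumes "f \<in> Hom C X Y" "g \<in> Hom C X Y" "h \<in> Hom C X Y" "Add C f h = Add C g h"
  shows "f = g"
proof -
  interpret H: comm_group "hom_group C X Y"
    using hom_comm_group Hom_Obj[OF assms(1)] by blast
  show ?thesis
    using H.right_cancel[of h f g] assms by (simp add: hom_group_def)
qed

text \<open>Differences are used only through this equation, so no notation for negatives is introduced.\<close>

lemma difference_exists:
  assumes "f \<in> Hom C X Y" "g \<in> Hom C X Y"
  obtains d where "d \<in> Hom C X Y" "Add C d g = f"
proof -
  interpret H: comm_group "hom_group C X Y"
    using hom_comm_group Hom_Obj[OF assms(1)] by blast
  let ?m = "inv\<^bsub>hom_group C X Y\<^esub> g"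
  have g: "g \<in> carrier (hom_group C X Y)" and f: "f \<in> carrier (hom_group C X Y)"
    using assms by (auto simp: hom_group_def)
  have "(f \<otimes>\<^bsub>hom_group C X Y\<^esub> ?m) \<otimes>\<^bsub>hom_group C X Y\<^esub> g = f"
    using f g by (simp add: H.m_assoc)
  moreover have "f \<otimes>\<^bsub>hom_group C X Y\<^esub> ?m \<in> carrier (hom_group C X Y)"
    using f g by simp
  ultimately show ?thesis
    using that[of "f \<otimes>\<^bsub>hom_group C X Y\<^esub> ?m"] by (simp add: hom_group_def)
qed

lemma Comp_Zero_right:
  assumes "X \<in> Obj C" "g \<in> Hom C Y Z"
  shows "g \<cdot> Zero C X Y = Zero C X Z"
proof -
  have z: "Zero C X Y \<in> Hom C X Y" "Zero C X Z \<in> Hom C X Z"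
    using Zero_in_Hom assms Hom_Obj by auto
  have "Add C (g \<cdot> Zero C X Y) (g \<cdot> Zero C X Y) = g \<cdot> Zero C X Y"
    using Comp_Add_right[OF z(1) z(1) assms(2)] Add_Zero_left[OF z(1)] by simp
  then show ?thesis
    using Add_right_cancel Add_Zero_left Comp_in_Hom[OF z(1) assms(2)] z(2) by metis
qed

lemma Comp_Zero_left:
  assumes "Z \<in> Obj C" "f \<in> Hom C X Y"
  shows "Zero C Y Z \<cdot> f = Zero C X Z"
proof -
  have z: "Zero C Y Z \<in> Hom C Y Z" "Zero C X Z \<in> Hom C X Z"
    using Zero_in_Hom assms Hom_Obj by auto
  have "Add C (Zero C Y Z \<cdot> f) (Zero C Y Z \<cdot> f) = Zero C Y Z \<cdot> f"
    using Comp_Add_left[OF assms(2) z(1) z(1)] Add_Zero_left[OF z(1)] by simp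
  then show ?thesis
    using Add_right_cancel Add_Zero_left Comp_in_Hom[OF assms(2) z(1)] z(2) by metis
qed

lemma mono_arr_zeroI:
  assumes f: "f \<in> Hom C X Y"
    and z: "\<And>W u. u \<in> Hom C W X \<Longrightarrow> f \<cdot> u = Zero C W Y \<Longrightarrow> u = Zero C W X"
  shows "mono_arr C f"
proof (rule mono_arrI[OF f])
  fix W u v assume uv: "u \<in> Hom C W X" "v \<in> Hom C W X" "f \<cdot> u = f \<cdot> v"
  obtain d where d: "d \<in> Hom C W X" "Add C d v = u"
    using difference_exists[OF uv(1,2)] .
  have "Add C (f \<cdot> d) (f \<cdot> v) = Add C (Zero C W Y) (f \<cdot> v)"
    using Comp_Add_right[OF d(1) uv(2) f] d(2) uv Add_Zero_left[OF Comp_in_Hom[OF uv(2) f]] by simp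
  then have "f \<cdot> d = Zero C W Y"
    using Add_right_cancel Comp_in_Hom f d(1) uv Zero_in_Hom Hom_Obj by metis
  then show "u = v"
    using z[OF d(1)] d(2) Add_Zero_left[OF uv(2)] by simp
qed

lemma epi_arr_zeroI:
  assumes f: "f \<in> Hom C X Y"
    and z: "\<And>Z u. u \<in> Hom C Y Z \<Longrightarrow> u \<cdot> f = Zero C X Z \<Longrightarrow> u = Zero C Y Z"
  shows "epi_arr C f"
proof (rule epi_arrI[OF f])
  fix Z u v assume uv: "u \<in> Hom C Y Z" "v \<in> Hom C Y Z" "u \<cdot> f = v \<cdot> f"
  obtain d where d: "d \<in> Hom C Y Z" "Add C d v = u"
    using difference_exists[OF uv(1,2)] .
  have "Add C (d \<cdot> f) (v \<cdot> f) = Add C (Zero C X Z) (v \<cdot> f)"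
    using Comp_Add_left[OF f d(1) uv(2)] d(2) uv Add_Zero_left[OF Comp_in_Hom[OF f uv(2)]] by simp
  then have "d \<cdot> f = Zero C X Z"
    using Add_right_cancel Comp_in_Hom f d(1) uv Zero_in_Hom Hom_Obj by metis
  then show "u = v"
    using z[OF d(1)] d(2) Add_Zero_left[OF uv(2)] by simp
qed

lemma mono_arr_zeroD:
  assumes "mono_arr C f" "f \<in> Hom C X Y" "u \<in> Hom C W X" "f \<cdot> u = Zero C W Y"
  shows "u = Zero C W X"
proof (rule mono_arrD[OF assms(1-3)])
  show "Zero C W X \<in> Hom C W X" using Zero_in_Hom Hom_Obj[OF assms(3)] by simp
  show "f \<cdot> u = f \<cdot> Zero C W X"
    using assms(4) Comp_Zero_right[OF Hom_Obj(1)[OF assms(3)] assms(2)] by simp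
qed

lemma epi_arr_zeroD:
  assumes "epi_arr C f" "f \<in> Hom C X Y" "u \<in> Hom C Y Z" "u \<cdot> f = Zero C X Z"
  shows "u = Zero C Y Z"
proof (rule epi_arrD[OF assms(1-3)])
  show "Zero C Y Z \<in> Hom C Y Z" using Zero_in_Hom Hom_Obj[OF assms(3)] by simp
  show "u \<cdot> f = Zero C Y Z \<cdot> f"
    using assms(4) Comp_Zero_left[OF Hom_Obj(2)[OF assms(3)] assms(2)] by simp
qed

end

section \<open>Kernels, short exact sequences and pullbacks\<close>

context preadditive_category
begin

lemma is_kernelD:
  assumes "is_kernel C f k" "f \<in> Hom C X Y"
  shows "k \<in> Hom C (Dom C k) X" and "f \<cdot> k = Zero C (Dom C k) Y"
  using assms by (auto simp: is_kernel_def Hom_def)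

lemma is_kernel_factor:
  assumes "is_kernel C f k" "f \<in> Hom C X Y" "h \<in> Hom C W X" "f \<cdot> h = Zero C W Y"
  obtains u where "u \<in> Hom C W (Dom C k)" "k \<cdot> u = h"
  using assms Hom_Obj[OF assms(3)] unfolding is_kernel_def by (metis HomD(2,3))

lemma is_kernel_mono:
  assumes k: "is_kernel C f k"
  shows "mono_arr C k"
proof -
  have f: "f \<in> Hom C (Dom C f) (Cod C f)" using k by (auto simp: is_kernel_def intro: Arr_Hom)
  note k' = is_kernelD[OF k f]
  show ?thesis
  proof (rule mono_arr_zeroI[OF k'(1)])
    fix W u assume u: "u \<in> Hom C W (Dom C k)" "k \<cdot> u = Zero C W (Dom C f)"
    have W: "W \<in> Obj C" and K: "Dom C k \<in> Obj C" using Hom_Obj[OF u(1)] by auto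
    have z: "Zero C W (Dom C k) \<in> Hom C W (Dom C k)" "k \<cdot> Zero C W (Dom C k) = Zero C W (Dom C f)"
      using Zero_in_Hom[OF W K] Comp_Zero_right[OF W k'(1)] by auto
    have "f \<cdot> Zero C W (Dom C f) = Zero C W (Cod C f)"
      using Comp_Zero_right[OF W f] .
    then have "\<exists>!u. u \<in> Hom C W (Dom C k) \<and> k \<cdot> u = Zero C W (Dom C f)"
      using k W Zero_in_Hom[OF W Hom_Obj(1)[OF f]] unfolding is_kernel_def by blast
    then show "u = Zero C W (Dom C k)" using u z by blast
  qed
qed

lemma is_kernelI:
  assumes f: "f \<in> Hom C X Y" and k: "k \<in> Hom C K X" and "mono_arr C k" "f \<cdot> k = Zero C K Y"
    and ex: "\<And>W h. h \<in> Hom C W X \<Longrightarrow> f \<cdot> h = Zero C W Y \<Longrightarrow> \<exists>u \<in> Hom C W K. k \<cdot> u = h"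
  shows "is_kernel C f k"
proof -
  have "\<exists>!u. u \<in> Hom C W K \<and> k \<cdot> u = h" if "h \<in> Hom C W X" "f \<cdot> h = Zero C W Y" for W h
    using ex[OF that] mono_arrD[OF assms(3) k] by metis
  then show ?thesis
    unfolding is_kernel_def using HomD[OF f] HomD[OF k] assms(4) by auto
qed

lemma is_cokernelD:
  assumes "is_cokernel C f c" "f \<in> Hom C X Y"
  shows "c \<in> Hom C Y (Cod C c)" and "c \<cdot> f = Zero C X (Cod C c)"
  using assms by (auto simp: is_cokernel_def Hom_def)

lemma is_cokernel_factor:
  assumes "is_cokernel C f c" "f \<in> Hom C X Y" "h \<in> Hom C Y Z" "h \<cdot> f = Zero C X Z"
  obtains u where "u \<in> Hom C (Cod C c) Z" "u \<cdot> c = h"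
  using assms Hom_Obj[OF assms(3)] unfolding is_cokernel_def by (metis HomD(2,3))

lemma is_cokernel_epi:
  assumes c: "is_cokernel C f c"
  shows "epi_arr C c"
proof -
  have f: "f \<in> Hom C (Dom C f) (Cod C f)" using c by (auto simp: is_cokernel_def intro: Arr_Hom)
  note c' = is_cokernelD[OF c f]
  show ?thesis
  proof (rule epi_arr_zeroI[OF c'(1)])
    fix Z u assume u: "u \<in> Hom C (Cod C c) Z" "u \<cdot> c = Zero C (Cod C f) Z"
    have Z: "Z \<in> Obj C" and K: "Cod C c \<in> Obj C" using Hom_Obj[OF u(1)] by auto
    have z: "Zero C (Cod C c) Z \<in> Hom C (Cod C c) Z" "Zero C (Cod C c) Z \<cdot> c = Zero C (Cod C f) Z"
      using Zero_in_Hom[OF K Z] Comp_Zero_left[OF Z c'(1)] by auto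
    have "Zero C (Cod C f) Z \<cdot> f = Zero C (Dom C f) Z"
      using Comp_Zero_left[OF Z f] .
    then have "\<exists>!u. u \<in> Hom C (Cod C c) Z \<and> u \<cdot> c = Zero C (Cod C f) Z"
      using c Z Zero_in_Hom[OF Hom_Obj(2)[OF f] Z] unfolding is_cokernel_def by blast
    then show "u = Zero C (Cod C c) Z" using u z by blast
  qed
qed

lemma is_cokernelI:
  assumes f: "f \<in> Hom C X Y" and c: "c \<in> Hom C Y Q" and "epi_arr C c" "c \<cdot> f = Zero C X Q"
    and ex: "\<And>Z h. h \<in> Hom C Y Z \<Longrightarrow> h \<cdot> f = Zero C X Z \<Longrightarrow> \<exists>u \<in> Hom C Q Z. u \<cdot> c = h"
  shows "is_cokernel C f c"
proof -
  have "\<exists>!u. u \<in> Hom C Q Z \<and> u \<cdot> c = h" if "h \<in> Hom C Y Z" "h \<cdot> f = Zero C X Z" for Z h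
    using ex[OF that] epi_arrD[OF assms(3) c] by metis
  then show ?thesis
    unfolding is_cokernel_def using HomD[OF f] HomD[OF c] assms(4) by auto
qed

lemma is_cokernel_precomp_epi:
  assumes c: "is_cokernel C f c" and f: "f \<in> Hom C X Y" and p: "p \<in> Hom C W X" "epi_arr C p"
  shows "is_cokernel C (f \<cdot> p) c"
proof (rule is_cokernelI[OF Comp_in_Hom[OF p(1) f] is_cokernelD(1)[OF c f] is_cokernel_epi[OF c]])
  note c' = is_cokernelD[OF c f]
  show "c \<cdot> (f \<cdot> p) = Zero C W (Cod C c)"
    using Comp_assoc[OF p(1) f c'(1)] c'(2) Comp_Zero_left[OF _ p(1)] Hom_Obj[OF c'(1)] by simp
  fix Z h assume h: "h \<in> Hom C Y Z" "h \<cdot> (f \<cdot> p) = Zero C W Z"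
  have "(h \<cdot> f) \<cdot> p = Zero C W Z"
    using Comp_assoc[OF p(1) f h(1)] h(2) by simp
  then have "h \<cdot> f = Zero C X Z"
    using epi_arr_zeroD[OF p(2,1) Comp_in_Hom[OF f h(1)]] by simp
  then show "\<exists>u \<in> Hom C (Cod C c) Z. u \<cdot> c = h"
    using is_cokernel_factor[OF c f h(1)] by metis
qed

lemma is_kernel_postcomp_mono:
  assumes k: "is_kernel C f k" and f: "f \<in> Hom C X Y" and j: "j \<in> Hom C Y Z" "mono_arr C j"
  shows "is_kernel C (j \<cdot> f) k"
proof (rule is_kernelI[OF Comp_in_Hom[OF f j(1)] is_kernelD(1)[OF k f] is_kernel_mono[OF k]])
  note k' = is_kernelD[OF k f]
  show "(j \<cdot> f) \<cdot> k = Zero C (Dom C k) Z"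
    using Comp_assoc[OF k'(1) f j(1)] k'(2) Comp_Zero_right[OF _ j(1)] Hom_Obj[OF k'(1)] by simp
  fix W h assume h: "h \<in> Hom C W X" "(j \<cdot> f) \<cdot> h = Zero C W Z"
  have "j \<cdot> (f \<cdot> h) = Zero C W Z"
    using Comp_assoc[OF h(1) f j(1)] h(2) by simp
  then have "f \<cdot> h = Zero C W Y"
    using mono_arr_zeroD[OF j(2,1) Comp_in_Hom[OF h(1) f]] by simp
  then show "\<exists>u \<in> Hom C W (Dom C k). k \<cdot> u = h"
    using is_kernel_factor[OF k f h(1)] by metis
qed

lemma is_cokernel_of_precomp_epi:
  assumes c: "is_cokernel C (f \<cdot> p) c" and f: "f \<in> Hom C X Y" and p: "p \<in> Hom C W X" "epi_arr C p"
  shows "is_cokernel C f c"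
proof (rule is_cokernelI[OF f is_cokernelD(1)[OF c Comp_in_Hom[OF p(1) f]] is_cokernel_epi[OF c]])
  note fp = Comp_in_Hom[OF p(1) f]
  note c' = is_cokernelD[OF c fp]
  show "c \<cdot> f = Zero C X (Cod C c)"
    using epi_arr_zeroD[OF p(2,1) Comp_in_Hom[OF f c'(1)]] Comp_assoc[OF p(1) f c'(1)] c'(2)
    by simp
  fix Z h assume h: "h \<in> Hom C Y Z" "h \<cdot> f = Zero C X Z"
  have "h \<cdot> (f \<cdot> p) = Zero C W Z"
    using Comp_assoc[OF p(1) f h(1)] h(2) Comp_Zero_left[OF _ p(1)] Hom_Obj[OF h(1)] by simp
  then show "\<exists>u \<in> Hom C (Cod C c) Z. u \<cdot> c = h"
    using is_cokernel_factor[OF c fp h(1)] by metis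
qed

lemma is_kernel_of_postcomp_mono:
  assumes k: "is_kernel C (j \<cdot> f) k" and f: "f \<in> Hom C X Y" and j: "j \<in> Hom C Y Z" "mono_arr C j"
  shows "is_kernel C f k"
proof (rule is_kernelI[OF f is_kernelD(1)[OF k Comp_in_Hom[OF f j(1)]] is_kernel_mono[OF k]])
  note jf = Comp_in_Hom[OF f j(1)]
  note k' = is_kernelD[OF k jf]
  show "f \<cdot> k = Zero C (Dom C k) Y"
    using mono_arr_zeroD[OF j(2,1) Comp_in_Hom[OF k'(1) f]] Comp_assoc[OF k'(1) f j(1)] k'(2)
    by simp
  fix W h assume h: "h \<in> Hom C W X" "f \<cdot> h = Zero C W Y"
  have "(j \<cdot> f) \<cdot> h = Zero C W Z"
    using Comp_assoc[OF h(1) f j(1)] h(2) Comp_Zero_right[OF _ j(1)] Hom_Obj[OF h(1)] by simp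
  then show "\<exists>u \<in> Hom C W (Dom C k). k \<cdot> u = h"
    using is_kernel_factor[OF k jf h(1)] by metis
qed

lemma short_exact_Hom:
  assumes "short_exact C f g"
  shows "f \<in> Hom C (Dom C f) (Dom C g)" and "g \<in> Hom C (Dom C g) (Cod C g)"
    and "g \<cdot> f = Zero C (Dom C f) (Cod C g)"
    and "mono_arr C f" and "epi_arr C g"
proof -
  have k: "is_kernel C g f" and c: "is_cokernel C f g" using assms by (auto simp: short_exact_def)
  show "f \<in> Hom C (Dom C f) (Dom C g)" "g \<in> Hom C (Dom C g) (Cod C g)"
    "g \<cdot> f = Zero C (Dom C f) (Cod C g)"
    using k by (auto simp: is_kernel_def Hom_def)
  show "mono_arr C f" "epi_arr C g" using is_kernel_mono[OF k] is_cokernel_epi[OF c] .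
qed

lemma short_exact_factor:
  assumes "short_exact C f g" "g \<in> Hom C X Y" "h \<in> Hom C W X" "g \<cdot> h = Zero C W Y"
  obtains u where "u \<in> Hom C W (Dom C f)" "f \<cdot> u = h"
  using assms is_kernel_factor unfolding short_exact_def by metis

end

context abelian_category
begin

text \<open>Every epimorphism is the cokernel of some arrow, and that arrow factors through the kernel \<open>k\<close>;
  so arrows that kill \<open>k\<close> also kill it.\<close>

lemma short_exact_of_epi:
  assumes g: "epi_arr C g" and k: "is_kernel C g k"
  shows "short_exact C k g"
proof -
  have gH: "g \<in> Hom C (Dom C g) (Cod C g)" using g by (auto simp: epi_arr_def intro: Arr_Hom)
  note k' = is_kernelD[OF k gH]
  obtain f where f: "is_cokernel C f g" using epi_is_cokernel[OF g] by blast
  then have fH: "f \<in> Hom C (Dom C f) (Dom C g)" by (auto simp: is_cokernel_def Hom_def)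
  obtain u where u: "u \<in> Hom C (Dom C f) (Dom C k)" "k \<cdot> u = f"
    using is_kernel_factor[OF k gH fH] is_cokernelD(2)[OF f fH] by auto
  have "is_cokernel C k g"
  proof (rule is_cokernelI[OF k'(1) gH g k'(2)])
    fix Z h assume h: "h \<in> Hom C (Dom C g) Z" "h \<cdot> k = Zero C (Dom C k) Z"
    have "h \<cdot> f = Zero C (Dom C f) Z"
      using Comp_assoc[OF u(1) k'(1) h(1)] h(2) u(2) Comp_Zero_left[OF Hom_Obj(2)[OF h(1)] u(1)]
      by simp
    then show "\<exists>u \<in> Hom C (Cod C g) Z. u \<cdot> g = h"
      using is_cokernel_factor[OF f fH h(1)] by metis
  qed
  then show ?thesis using k by (simp add: short_exact_def)
qed

lemma short_exact_of_mono:
  assumes f: "mono_arr C f" and c: "is_cokernel C f c"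
  shows "short_exact C f c"
proof -
  have fH: "f \<in> Hom C (Dom C f) (Cod C f)" using f by (auto simp: mono_arr_def intro: Arr_Hom)
  note c' = is_cokernelD[OF c fH]
  obtain g where g: "is_kernel C g f" using mono_is_kernel[OF f] by blast
  then have gH: "g \<in> Hom C (Cod C f) (Cod C g)" by (auto simp: is_kernel_def Hom_def)
  obtain u where u: "u \<in> Hom C (Cod C c) (Cod C g)" "u \<cdot> c = g"
    using is_cokernel_factor[OF c fH gH] is_kernelD(2)[OF g gH] by auto
  have "is_kernel C c f"
  proof (rule is_kernelI[OF c'(1) fH f c'(2)])
    fix W h assume h: "h \<in> Hom C W (Cod C f)" "c \<cdot> h = Zero C W (Cod C c)"
    have "g \<cdot> h = Zero C W (Cod C g)"
      using Comp_assoc[OF h(1) c'(1) u(1)] h(2) u(2) Comp_Zero_right[OF Hom_Obj(1)[OF h(1)] u(1)]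
      by simp
    then show "\<exists>u \<in> Hom C W (Dom C f). f \<cdot> u = h"
      using is_kernel_factor[OF g gH h(1)] by metis
  qed
  then show ?thesis using c by (simp add: short_exact_def)
qed

lemma epi_short_exact:
  assumes "epi_arr C g"
  obtains k where "short_exact C k g"
  using assms kernel_exists short_exact_of_epi unfolding epi_arr_def by metis

end

text \<open>Existence and uniqueness of the mediating arrow are separate clauses, because most
  applications use only one of them.\<close>

definition is_pullback ::
    "('o, 'm) abcat \<Rightarrow> 'm \<Rightarrow> 'm \<Rightarrow> 'o \<Rightarrow> 'm \<Rightarrow> 'm \<Rightarrow> bool" where
  "is_pullback C f g E a b \<longleftrightarrow>
    a \<in> Hom C E (Dom C f) \<and> b \<in> Hom C E (Dom C g) \<and> f \<cdot>\<^bsub>C\<^esub> a = g \<cdot>\<^bsub>C\<^esub> b \<and>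
    (\<forall>W. \<forall>u \<in> Hom C W (Dom C f). \<forall>v \<in> Hom C W (Dom C g). f \<cdot>\<^bsub>C\<^esub> u = g \<cdot>\<^bsub>C\<^esub> v \<longrightarrow>
       (\<exists>w \<in> Hom C W E. a \<cdot>\<^bsub>C\<^esub> w = u \<and> b \<cdot>\<^bsub>C\<^esub> w = v)) \<and>
    (\<forall>W. \<forall>w \<in> Hom C W E. \<forall>w' \<in> Hom C W E.
       a \<cdot>\<^bsub>C\<^esub> w = a \<cdot>\<^bsub>C\<^esub> w' \<and> b \<cdot>\<^bsub>C\<^esub> w = b \<cdot>\<^bsub>C\<^esub> w' \<longrightarrow> w = w')"

lemma is_pullback_sym: "is_pullback C f g E a b \<Longrightarrow> is_pullback C g f E b a"
  unfolding is_pullback_def by metis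

lemma is_pullbackD:
  assumes "is_pullback C f g E a b" "f \<in> Hom C X Z" "g \<in> Hom C Y Z"
  shows "a \<in> Hom C E X" and "b \<in> Hom C E Y" and "f \<cdot>\<^bsub>C\<^esub> a = g \<cdot>\<^bsub>C\<^esub> b"
  using assms HomD(2)[OF assms(2)] HomD(2)[OF assms(3)] by (auto simp: is_pullback_def)

lemma is_pullback_lift:
  assumes "is_pullback C f g E a b" "f \<in> Hom C X Z" "g \<in> Hom C Y Z"
    "u \<in> Hom C W X" "v \<in> Hom C W Y" "f \<cdot>\<^bsub>C\<^esub> u = g \<cdot>\<^bsub>C\<^esub> v"
  obtains w where "w \<in> Hom C W E" "a \<cdot>\<^bsub>C\<^esub> w = u" "b \<cdot>\<^bsub>C\<^esub> w = v"
proof -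
  have "\<forall>W. \<forall>u \<in> Hom C W X. \<forall>v \<in> Hom C W Y. f \<cdot>\<^bsub>C\<^esub> u = g \<cdot>\<^bsub>C\<^esub> v \<longrightarrow>
       (\<exists>w \<in> Hom C W E. a \<cdot>\<^bsub>C\<^esub> w = u \<and> b \<cdot>\<^bsub>C\<^esub> w = v)"
    using assms(1) unfolding is_pullback_def HomD(2)[OF assms(2)] HomD(2)[OF assms(3)] by blast
  then show ?thesis using assms(4-6) that by blast
qed

lemma is_pullback_eqI:
  assumes "is_pullback C f g E a b" "w \<in> Hom C W E" "w' \<in> Hom C W E"
    "a \<cdot>\<^bsub>C\<^esub> w = a \<cdot>\<^bsub>C\<^esub> w'" "b \<cdot>\<^bsub>C\<^esub> w = b \<cdot>\<^bsub>C\<^esub> w'"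
  shows "w = w'"
  using assms unfolding is_pullback_def by blast

context abelian_category
begin

text \<open>The pullback is the kernel of the difference of the two arrows out of the biproduct. If \<open>f\<close> is epi,
  then so is the difference, hence it is the cokernel of that kernel, and this is what makes \<open>b\<close>
  right cancellable.\<close>

lemma pullback_with_epi:
  assumes f: "f \<in> Hom C X Z" and g: "g \<in> Hom C Y Z"
  obtains E a b where "is_pullback C f g E a b" "epi_arr C f \<longrightarrow> epi_arr C b"
proof -
  have X: "X \<in> Obj C" and Y: "Y \<in> Obj C" and Z: "Z \<in> Obj C" using Hom_Obj f g by auto
  obtain S j1 j2 p1 p2 where S: "is_biproduct C X Y S j1 j2 p1 p2"
    using biproduct_exists[OF X Y] by blast
  have j1: "j1 \<in> Hom C X S" and j2: "j2 \<in> Hom C Y S"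
    and p1: "p1 \<in> Hom C S X" and p2: "p2 \<in> Hom C S Y"
    and p1j1: "p1 \<cdot> j1 = Ident C X" and p2j2: "p2 \<cdot> j2 = Ident C Y"
    and p1j2: "p1 \<cdot> j2 = Zero C Y X" and p2j1: "p2 \<cdot> j1 = Zero C X Y"
    and sum: "Add C (j1 \<cdot> p1) (j2 \<cdot> p2) = Ident C S"
    using S by (auto simp: is_biproduct_def)
  note fp1 = Comp_in_Hom[OF p1 f] and gp2 = Comp_in_Hom[OF p2 g]
  obtain d where d: "d \<in> Hom C S Z" "Add C d (g \<cdot> p2) = f \<cdot> p1"
    using difference_exists[OF fp1 gp2] .
  \<comment> \<open>\<open>d\<close> is the difference \<open>f p1 - g p2\<close>, and its kernel is the pullback\<close>
  have d_comp: "Add C (d \<cdot> u) (g \<cdot> (p2 \<cdot> u)) = f \<cdot> (p1 \<cdot> u)" if u: "u \<in> Hom C W S" for W u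
    using Comp_Add_left[OF u d(1) gp2] d(2) Comp_assoc[OF u p1 f] Comp_assoc[OF u p2 g] by simp
  have d_zero: "d \<cdot> u = Zero C W Z \<longleftrightarrow> f \<cdot> (p1 \<cdot> u) = g \<cdot> (p2 \<cdot> u)"
    if u: "u \<in> Hom C W S" for W u
  proof -
    note gu = Comp_in_Hom[OF Comp_in_Hom[OF u p2] g]
    have z: "Zero C W Z \<in> Hom C W Z" using Zero_in_Hom[OF _ Z] Hom_Obj[OF u] by simp
    show ?thesis
      using d_comp[OF u] Add_Zero_left[OF gu] Add_right_cancel[OF Comp_in_Hom[OF u d(1)] z gu]
      by auto
  qed
  obtain k where k: "is_kernel C d k" using kernel_exists HomD(1)[OF d(1)] by blast
  define E where "E = Dom C k"
  have kH: "k \<in> Hom C E S" and dk: "d \<cdot> k = Zero C E Z"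
    using is_kernelD[OF k d(1)] by (auto simp: E_def)
  let ?a = "p1 \<cdot> k" and ?b = "p2 \<cdot> k"
  note a = Comp_in_Hom[OF kH p1] and b = Comp_in_Hom[OF kH p2]
  have lift: "\<exists>w \<in> Hom C W E. ?a \<cdot> w = u \<and> ?b \<cdot> w = v"
    if u: "u \<in> Hom C W X" and v: "v \<in> Hom C W Y" and uv: "f \<cdot> u = g \<cdot> v" for W u v
  proof -
    have W: "W \<in> Obj C" using Hom_Obj[OF u] by simp
    note ju = Comp_in_Hom[OF u j1] and jv = Comp_in_Hom[OF v j2]
    let ?w = "Add C (j1 \<cdot> u) (j2 \<cdot> v)"
    have w: "?w \<in> Hom C W S" using Add_in_Hom[OF ju jv] .
    have "p1 \<cdot> (j1 \<cdot> u) = u" "p1 \<cdot> (j2 \<cdot> v) = Zero C W X"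
      "p2 \<cdot> (j2 \<cdot> v) = v" "p2 \<cdot> (j1 \<cdot> u) = Zero C W Y"
      using Comp_assoc[OF u j1 p1] Comp_assoc[OF v j2 p1] Comp_assoc[OF v j2 p2]
        Comp_assoc[OF u j1 p2] p1j1 p2j2 p1j2 p2j1 Comp_Ident_left[OF u] Comp_Ident_left[OF v]
        Comp_Zero_left[OF X v] Comp_Zero_left[OF Y u] by auto
    then have p1w: "p1 \<cdot> ?w = u" and p2w: "p2 \<cdot> ?w = v"
      using Comp_Add_right[OF ju jv p1] Comp_Add_right[OF ju jv p2]
        Add_Zero_right[OF u] Add_Zero_left[OF v] by auto
    have "d \<cdot> ?w = Zero C W Z" using d_zero[OF w] p1w p2w uv by simp
    then obtain t where t: "t \<in> Hom C W E" "k \<cdot> t = ?w"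
      using is_kernel_factor[OF k d(1) w] E_def by metis
    have "?a \<cdot> t = u" "?b \<cdot> t = v"
      using Comp_assoc[OF t(1) kH p1] Comp_assoc[OF t(1) kH p2] t(2) p1w p2w by auto
    then show ?thesis using t(1) by blast
  qed
  have uniq: "w = w'"
    if w: "w \<in> Hom C W E" "w' \<in> Hom C W E" and eq: "?a \<cdot> w = ?a \<cdot> w'" "?b \<cdot> w = ?b \<cdot> w'"
    for W w w'
  proof -
    have split: "Add C (j1 \<cdot> (p1 \<cdot> x)) (j2 \<cdot> (p2 \<cdot> x)) = x" if x: "x \<in> Hom C W S" for x
      using Comp_Add_left[OF x Comp_in_Hom[OF p1 j1] Comp_in_Hom[OF p2 j2]] sum
        Comp_assoc[OF x p1 j1] Comp_assoc[OF x p2 j2] Comp_Ident_left[OF x] by simp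
    have "p1 \<cdot> (k \<cdot> w) = p1 \<cdot> (k \<cdot> w')" "p2 \<cdot> (k \<cdot> w) = p2 \<cdot> (k \<cdot> w')"
      using eq unfolding Comp_assoc[OF w(1) kH p1] Comp_assoc[OF w(2) kH p1]
        Comp_assoc[OF w(1) kH p2] Comp_assoc[OF w(2) kH p2] .
    then have "k \<cdot> w = k \<cdot> w'"
      using split[OF Comp_in_Hom[OF w(1) kH]] split[OF Comp_in_Hom[OF w(2) kH]] by metis
    then show ?thesis using mono_arrD[OF is_kernel_mono[OF k] kH w] by simp
  qed
  have pb: "is_pullback C f g E ?a ?b"
    unfolding is_pullback_def HomD(2)[OF f] HomD(2)[OF g]
    using a b d_zero[OF kH] dk lift uniq by blast
  have "epi_arr C ?b" if epi: "epi_arr C f"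
  proof -
    have dj1: "d \<cdot> j1 = f"
      using d_comp[OF j1] p2j1 p1j1 Comp_Zero_right[OF X g] Comp_Ident_right[OF f]
        Add_Zero_right[OF Comp_in_Hom[OF j1 d(1)]] by simp
    then have "epi_arr C d" using epi_arr_of_Comp[OF j1 d(1)] epi by simp
    then have cok: "is_cokernel C k d" using short_exact_of_epi[OF _ k] by (simp add: short_exact_def)
    have codd: "Cod C d = Z" using HomD[OF d(1)] by simp
    show ?thesis
    proof (rule epi_arr_zeroI[OF b])
      fix V u assume u: "u \<in> Hom C Y V" "u \<cdot> ?b = Zero C E V"
      note up2 = Comp_in_Hom[OF p2 u(1)]
      have "(u \<cdot> p2) \<cdot> k = Zero C E V" using Comp_assoc[OF kH p2 u(1)] u(2) by simp
      then obtain t where t: "t \<in> Hom C Z V" "t \<cdot> d = u \<cdot> p2"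
        using is_cokernel_factor[OF cok kH up2] codd by metis
      have "t \<cdot> f = u \<cdot> (p2 \<cdot> j1)"
        using Comp_assoc[OF j1 d(1) t(1)] dj1 t(2) Comp_assoc[OF j1 p2 u(1)] by simp
      then have "t \<cdot> f = Zero C X V" using p2j1 Comp_Zero_right[OF X u(1)] by simp
      then have "t = Zero C Z V" using epi_arr_zeroD[OF epi f t(1)] by simp
      then have "u \<cdot> p2 = Zero C S V"
        using t(2) Comp_Zero_left[OF _ d(1)] Hom_Obj[OF u(1)] by simp
      then have "u \<cdot> (p2 \<cdot> j2) = Zero C Y V"
        using Comp_assoc[OF j2 p2 u(1)] Comp_Zero_left[OF _ j2] Hom_Obj[OF u(1)] by simp
      then show "u = Zero C Y V" using p2j2 Comp_Ident_right[OF u(1)] by simp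
    qed
  qed
  then show ?thesis using that[OF pb] by blast
qed

lemma pullback_exists:
  assumes "f \<in> Hom C X Z" "g \<in> Hom C Y Z"
  obtains E a b where "is_pullback C f g E a b"
  using pullback_with_epi[OF assms] by metis

lemma is_pullback_epi:
  assumes pb: "is_pullback C f g E a b" and f: "f \<in> Hom C X Z" "epi_arr C f"
    and g: "g \<in> Hom C Y Z"
  shows "epi_arr C b"
proof -
  obtain E' a' b' where pb': "is_pullback C f g E' a' b'" and epi: "epi_arr C b'"
    using pullback_with_epi[OF f(1) g] f(2) by metis
  note D = is_pullbackD[OF pb' f(1) g]
  obtain w where w: "w \<in> Hom C E' E" "b \<cdot> w = b'"
    using is_pullback_lift[OF pb f(1) g D] by metis
  show ?thesis
    using epi_arr_of_Comp[OF w(1) is_pullbackD(2)[OF pb f(1) g]] w(2) epi by simp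
qed

lemma is_pullback_mono:
  assumes pb: "is_pullback C f g E a b" and f: "f \<in> Hom C X Z" "mono_arr C f"
    and g: "g \<in> Hom C Y Z"
  shows "mono_arr C b"
proof (rule mono_arrI)
  note D = is_pullbackD[OF pb f(1) g]
  show b: "b \<in> Hom C E Y" using D(2) .
  fix W u v assume uv: "u \<in> Hom C W E" "v \<in> Hom C W E" "b \<cdot> u = b \<cdot> v"
  have "f \<cdot> (a \<cdot> u) = f \<cdot> (a \<cdot> v)"
    using Comp_assoc[OF uv(1) D(1) f(1)] Comp_assoc[OF uv(2) D(1) f(1)] D(3)
      Comp_assoc[OF uv(1) b g] Comp_assoc[OF uv(2) b g] uv(3) by simp
  then have "a \<cdot> u = a \<cdot> v"
    using mono_arrD[OF f(2,1) Comp_in_Hom[OF uv(1) D(1)] Comp_in_Hom[OF uv(2) D(1)]] by simp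
  then show "u = v" using is_pullback_eqI[OF pb uv(1,2)] uv(3) by simp
qed

lemma is_pullback_kernel:
  assumes pb: "is_pullback C f g E a b" and f: "f \<in> Hom C X Z" and g: "g \<in> Hom C Y Z"
    and k: "is_kernel C f k"
  obtains k' where "k' \<in> Hom C (Dom C k) E" "is_kernel C b k'" "a \<cdot> k' = k"
proof -
  note D = is_pullbackD[OF pb f g] and k1 = is_kernelD[OF k f]
  have K: "Dom C k \<in> Obj C" and Y: "Y \<in> Obj C" using Hom_Obj k1(1) g by auto
  obtain k' where k': "k' \<in> Hom C (Dom C k) E" "a \<cdot> k' = k" "b \<cdot> k' = Zero C (Dom C k) Y"
    using is_pullback_lift[OF pb f g k1(1) Zero_in_Hom[OF K Y]] k1(2) Comp_Zero_right[OF K g]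
    by metis
  have "is_kernel C b k'"
  proof (rule is_kernelI[OF D(2) k'(1) _ k'(3)])
    show "mono_arr C k'"
      using mono_arr_of_Comp[OF k'(1) D(1)] k'(2) is_kernel_mono[OF k] by simp
    fix W h assume h: "h \<in> Hom C W E" "b \<cdot> h = Zero C W Y"
    have W: "W \<in> Obj C" using Hom_Obj[OF h(1)] by simp
    have "f \<cdot> (a \<cdot> h) = Zero C W Z"
      using Comp_assoc[OF h(1) D(1) f] D(3) Comp_assoc[OF h(1) D(2) g] h(2)
        Comp_Zero_right[OF W g] by simp
    then obtain t where t: "t \<in> Hom C W (Dom C k)" "k \<cdot> t = a \<cdot> h"
      using is_kernel_factor[OF k f Comp_in_Hom[OF h(1) D(1)]] by metis
    have "a \<cdot> (k' \<cdot> t) = a \<cdot> h" "b \<cdot> (k' \<cdot> t) = b \<cdot> h"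
      using Comp_assoc[OF t(1) k'(1) D(1)] Comp_assoc[OF t(1) k'(1) D(2)] k'(2,3) t(2) h(2)
        Comp_Zero_left[OF Y t(1)] by auto
    then show "\<exists>t \<in> Hom C W (Dom C k). k' \<cdot> t = h"
      using is_pullback_eqI[OF pb Comp_in_Hom[OF t(1) k'(1)] h(1)] t(1) by blast
  qed
  then show ?thesis using that k' by blast
qed

lemma pullback_short_exact:
  assumes se: "short_exact C k f" and f: "f \<in> Hom C X Z" and g: "g \<in> Hom C Y Z"
    and pb: "is_pullback C f g E a b"
  obtains k' where "k' \<in> Hom C (Dom C k) E" "short_exact C k' b" "a \<cdot> k' = k"
proof -
  have k: "is_kernel C f k" using se by (simp add: short_exact_def)
  obtain k' where k': "k' \<in> Hom C (Dom C k) E" "is_kernel C b k'" "a \<cdot> k' = k"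
    using is_pullback_kernel[OF pb f g k] .
  then show ?thesis
    using that short_exact_of_epi is_pullback_epi[OF pb f short_exact_Hom(5)[OF se] g] by blast
qed

text \<open>For \<open>0 \<rightarrow> X \<rightarrow> Y \<rightarrow> Z \<rightarrow> 0\<close> and an epimorphism \<open>g : E \<rightarrow> Y\<close> with kernel \<open>K\<close>, the kernel \<open>N\<close>
  of \<open>E \<rightarrow> Z\<close> is the preimage of \<open>X\<close>, and so an extension of \<open>X\<close> by \<open>K\<close>.\<close>

lemma short_exact_preimage:
  assumes ab: "short_exact C a b" and a: "a \<in> Hom C X Y" and b: "b \<in> Hom C Y Z"
    and kg: "short_exact C k g" and k: "k \<in> Hom C K E" and g: "g \<in> Hom C E Y"
  obtains N n h k' where "n \<in> Hom C N E" "short_exact C n (b \<cdot> g)"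
    "h \<in> Hom C N X" "k' \<in> Hom C K N" "short_exact C k' h" "n \<cdot> k' = k"
proof -
  obtain N n h where pb: "is_pullback C g a N n h" using pullback_exists[OF g a] .
  note D = is_pullbackD[OF pb g a]
  obtain k' where k': "k' \<in> Hom C K N" "short_exact C k' h" "n \<cdot> k' = k"
    using pullback_short_exact[OF kg g a pb] HomD(2)[OF k] by metis
  have zero: "b \<cdot> a = Zero C X Z" using short_exact_Hom(3)[OF ab] HomD[OF a] HomD[OF b] by simp
  have "is_kernel C (b \<cdot> g) n"
  proof (rule is_kernelI[OF Comp_in_Hom[OF g b] D(1)])
    show "mono_arr C n"
      using is_pullback_mono[OF is_pullback_sym[OF pb] a short_exact_Hom(4)[OF ab] g] .
    show "(b \<cdot> g) \<cdot> n = Zero C N Z"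
      using Comp_assoc[OF D(1) g b] D(3) Comp_assoc[OF D(2) a b] zero
        Comp_Zero_left[OF _ D(2)] Hom_Obj[OF b] by simp
    fix W w assume w: "w \<in> Hom C W E" "(b \<cdot> g) \<cdot> w = Zero C W Z"
    have "b \<cdot> (g \<cdot> w) = Zero C W Z" using Comp_assoc[OF w(1) g b] w(2) by simp
    then obtain v where v: "v \<in> Hom C W X" "a \<cdot> v = g \<cdot> w"
      using short_exact_factor[OF ab b Comp_in_Hom[OF w(1) g]] HomD(2)[OF a] by metis
    show "\<exists>u \<in> Hom C W N. n \<cdot> u = w"
      using is_pullback_lift[OF pb g a w(1) v(1)] v(2) by metis
  qed
  moreover have "epi_arr C (b \<cdot> g)"
    using epi_arr_Comp[OF g short_exact_Hom(5)[OF kg] b short_exact_Hom(5)[OF ab]] .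
  ultimately show ?thesis using that D k' short_exact_of_epi by blast
qed

text \<open>The epi part is the cokernel of the kernel of \<open>f\<close>. The induced arrow \<open>m\<close> is mono, because an arrow
  that \<open>m\<close> kills becomes, after pulling back along the epi part, an arrow that \<open>f\<close> kills.\<close>

lemma image_factorization:
  assumes f: "f \<in> Hom C X Y"
  obtains I p m where "p \<in> Hom C X I" "epi_arr C p" "m \<in> Hom C I Y" "mono_arr C m" "f = m \<cdot> p"
proof -
  obtain k where k: "is_kernel C f k" using kernel_exists HomD(1)[OF f] by blast
  note k1 = is_kernelD[OF k f]
  obtain p where p: "is_cokernel C k p" using cokernel_exists HomD(1)[OF k1(1)] by blast
  note p1 = is_cokernelD[OF p k1(1)] and pe = is_cokernel_epi[OF p]
  define I where "I = Cod C p"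
  have pH: "p \<in> Hom C X I" using p1(1) I_def by simp
  have Io: "I \<in> Obj C" using Hom_Obj[OF pH] by simp
  obtain m where m: "m \<in> Hom C I Y" "m \<cdot> p = f"
    using is_cokernel_factor[OF p k1(1) f k1(2)] I_def by metis
  have "mono_arr C m"
  proof (rule mono_arr_zeroI[OF m(1)])
    fix W w assume w: "w \<in> Hom C W I" "m \<cdot> w = Zero C W Y"
    obtain V a q where pb: "is_pullback C p w V a q" using pullback_exists[OF pH w(1)] .
    note D = is_pullbackD[OF pb pH w(1)]
    have qe: "epi_arr C q" using is_pullback_epi[OF pb pH pe w(1)] .
    have "f \<cdot> a = Zero C V Y"
      using m(2) Comp_assoc[OF D(1) pH m(1)] D(3) Comp_assoc[OF D(2) w(1) m(1)] w(2)
        Comp_Zero_left[OF _ D(2)] Hom_Obj[OF f] by simp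
    then obtain t where t: "t \<in> Hom C V (Dom C k)" "k \<cdot> t = a"
      using is_kernel_factor[OF k f D(1)] by metis
    have "w \<cdot> q = Zero C V I"
      using D(3) t(2) Comp_assoc[OF t(1) k1(1) pH] p1(2) I_def Comp_Zero_left[OF Io t(1)] by simp
    then show "w = Zero C W I" using epi_arr_zeroD[OF qe D(2) w(1)] by simp
  qed
  then show ?thesis using that pH pe m by blast
qed

text \<open>Elements of \<open>Y\<close> that die in the cokernel of \<open>f : X \<rightarrow> Y\<close> come from \<open>X\<close>, after passing to an
  epimorphic cover of their domain. This replaces diagram chases with elements.\<close>

lemma cokernel_chase:
  assumes c: "is_cokernel C f c" and f: "f \<in> Hom C X Y" and v: "v \<in> Hom C W Y"
    and cv: "c \<cdot> v = Zero C W (Cod C c)"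
  obtains V q w where "q \<in> Hom C V W" "epi_arr C q" "w \<in> Hom C V X" "f \<cdot> w = v \<cdot> q"
proof -
  obtain I p m where p: "p \<in> Hom C X I" "epi_arr C p" and m: "m \<in> Hom C I Y" "mono_arr C m"
    and fmp: "f = m \<cdot> p"
    using image_factorization[OF f] .
  note c1 = is_cokernelD[OF c f]
  have "is_cokernel C m c"
    using is_cokernel_of_precomp_epi[OF _ m(1) p] c fmp by simp
  then have "short_exact C m c" using short_exact_of_mono[OF m(2)] by blast
  then obtain t where t: "t \<in> Hom C W I" "m \<cdot> t = v"
    using short_exact_factor[OF _ c1(1) v cv] HomD(2)[OF m(1)] by metis
  obtain V a q where pb: "is_pullback C p t V a q" using pullback_exists[OF p(1) t(1)] .
  note D = is_pullbackD[OF pb p(1) t(1)]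
  have "f \<cdot> a = v \<cdot> q"
    using fmp Comp_assoc[OF D(1) p(1) m(1)] D(3) Comp_assoc[OF D(2) t(1) m(1)] t(2) by simp
  then show ?thesis
    using that[OF D(2) is_pullback_epi[OF pb p t(1)] D(1)] by simp
qed

lemma short_exact_split:
  assumes kg: "short_exact C k g" and k: "k \<in> Hom C K E" and g: "g \<in> Hom C E X"
    and s: "s \<in> Hom C X E" and gs: "g \<cdot> s = Ident C X"
  obtains r where "r \<in> Hom C E K" "r \<cdot> k = Ident C K" "r \<cdot> s = Zero C X K"
    "Add C (k \<cdot> r) (s \<cdot> g) = Ident C E"
proof -
  have X: "X \<in> Obj C" and E: "E \<in> Obj C" and K: "K \<in> Obj C" using Hom_Obj k g by auto
  have gk: "g \<cdot> k = Zero C K X" using short_exact_Hom(3)[OF kg] HomD[OF k] HomD[OF g] by simp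
  have mk: "mono_arr C k" using short_exact_Hom(4)[OF kg] .
  note sg = Comp_in_Hom[OF g s]
  obtain d where d: "d \<in> Hom C E E" "Add C d (s \<cdot> g) = Ident C E"
    using difference_exists[OF Ident_in_Hom[OF E] sg] .
  have d_comp: "Add C (d \<cdot> u) (s \<cdot> (g \<cdot> u)) = u" if u: "u \<in> Hom C W E" for W u
    using Comp_Add_left[OF u d(1) sg] d(2) Comp_Ident_left[OF u] Comp_assoc[OF u g s] by simp
  have "Add C (g \<cdot> d) g = g"
    using Comp_Add_right[OF d(1) sg g] d(2) Comp_Ident_right[OF g] Comp_assoc[OF g s g] gs
      Comp_Ident_left[OF g] by simp
  then have "g \<cdot> d = Zero C E X"
    using Add_right_cancel[OF Comp_in_Hom[OF d(1) g] Zero_in_Hom[OF E X] g] Add_Zero_left[OF g]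
    by simp
  then obtain r where r: "r \<in> Hom C E K" "k \<cdot> r = d"
    using short_exact_factor[OF kg g d(1)] HomD(2)[OF k] by metis
  have "d \<cdot> k = k"
    using d_comp[OF k] gk Comp_Zero_right[OF K s] Add_Zero_right[OF Comp_in_Hom[OF k d(1)]] by simp
  then have "k \<cdot> (r \<cdot> k) = k \<cdot> Ident C K"
    using Comp_assoc[OF k r(1) k] r(2) Comp_Ident_right[OF k] by simp
  then have rk: "r \<cdot> k = Ident C K"
    using mono_arrD[OF mk k Comp_in_Hom[OF k r(1)] Ident_in_Hom[OF K]] by simp
  have "Add C (d \<cdot> s) s = s"
    using d_comp[OF s] gs Comp_Ident_right[OF s] by simp
  then have "d \<cdot> s = Zero C X E"
    using Add_right_cancel[OF Comp_in_Hom[OF s d(1)] Zero_in_Hom[OF X E] s] Add_Zero_left[OF s]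
    by simp
  then have "k \<cdot> (r \<cdot> s) = Zero C X E"
    using Comp_assoc[OF s r(1) k] r(2) by simp
  then have rs: "r \<cdot> s = Zero C X K"
    using mono_arr_zeroD[OF mk k Comp_in_Hom[OF s r(1)]] by simp
  show ?thesis using that[OF r(1) rk rs] r(2) d(2) by simp
qed

lemma projective_short_exact_split:
  assumes "projective C P" "short_exact C k g" "k \<in> Hom C K E" "g \<in> Hom C E P"
  obtains r where "r \<in> Hom C E K" "r \<cdot> k = Ident C K"
proof -
  obtain s where s: "s \<in> Hom C P E" "g \<cdot> s = Ident C P"
    using projective_section[OF assms(1) short_exact_Hom(5)[OF assms(2)] assms(4)] .
  show ?thesis using short_exact_split[OF assms(2-4) s] that by metis
qed

text \<open>Composing with an epimorphism does not change the cokernel of \<open>a\<close>, and composing with a monomorphism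
  does not change the kernel of \<open>b\<close>.\<close>

lemma exact_at_splice:
  assumes ab: "short_exact C a b" and a: "a \<in> Hom C X Y" and b: "b \<in> Hom C Y Z"
    and p: "p \<in> Hom C W X" "epi_arr C p" and j: "j \<in> Hom C Z V" "mono_arr C j"
  shows "exact_at C (a \<cdot> p) (j \<cdot> b)"
  unfolding exact_at_def
  using is_cokernel_precomp_epi[OF _ a p] is_kernel_postcomp_mono[OF _ b j] ab
  unfolding short_exact_def by metis

lemma mono_arr_Ident: "X \<in> Obj C \<Longrightarrow> mono_arr C (Ident C X)"
  using mono_arr_of_retraction Ident_in_Hom Comp_Ident_left by metis

lemma exact_at_zero:
  assumes ex: "exact_at C f g" and f: "f \<in> Hom C X Y" and g: "g \<in> Hom C Y Z"
  shows "g \<cdot> f = Zero C X Z"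
proof -
  obtain c m where c: "is_cokernel C f c" and m: "is_kernel C c m" "is_kernel C g m"
    using ex by (auto simp: exact_at_def)
  note c1 = is_cokernelD[OF c f]
  obtain u where u: "u \<in> Hom C X (Dom C m)" "m \<cdot> u = f"
    using is_kernel_factor[OF m(1) c1(1) f c1(2)] .
  note m1 = is_kernelD[OF m(2) g]
  show ?thesis
    using Comp_assoc[OF u(1) m1(1) g] u(2) m1(2) Comp_Zero_left[OF _ u(1)] Hom_Obj[OF g] by simp
qed

lemma exact_at_cover:
  assumes ex: "exact_at C f g" and f: "f \<in> Hom C X Y" and g: "g \<in> Hom C Y Z"
    and k: "is_kernel C g k"
  obtains p where "p \<in> Hom C X (Dom C k)" "epi_arr C p" "k \<cdot> p = f"
proof -
  obtain c m where c: "is_cokernel C f c" and m: "is_kernel C c m" "is_kernel C g m"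
    using ex by (auto simp: exact_at_def)
  note c1 = is_cokernelD[OF c f] and k1 = is_kernelD[OF k g]
  obtain p where p: "p \<in> Hom C X (Dom C k)" "k \<cdot> p = f"
    using is_kernel_factor[OF k g f exact_at_zero[OF ex f g]] .
  obtain t where t: "t \<in> Hom C (Dom C k) (Dom C m)" "m \<cdot> t = k"
    using is_kernel_factor[OF m(2) g k1] .
  note m1 = is_kernelD[OF m(1) c1(1)]
  have "c \<cdot> k = Zero C (Dom C k) (Cod C c)"
    using Comp_assoc[OF t(1) m1(1) c1(1)] t(2) m1(2) Comp_Zero_left[OF _ t(1)] Hom_Obj[OF c1(1)]
    by simp
  then obtain V q w where q: "q \<in> Hom C V (Dom C k)" "epi_arr C q"
    and w: "w \<in> Hom C V X" "f \<cdot> w = k \<cdot> q"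
    using cokernel_chase[OF c f k1(1)] by blast
  have "k \<cdot> (p \<cdot> w) = k \<cdot> q" using Comp_assoc[OF w(1) p(1) k1(1)] p(2) w(2) by simp
  then have "p \<cdot> w = q"
    using mono_arrD[OF is_kernel_mono[OF k] k1(1) Comp_in_Hom[OF w(1) p(1)] q(1)] by simp
  then have "epi_arr C p" using epi_arr_of_Comp[OF w(1) p(1)] q(2) by simp
  then show ?thesis using that p by blast
qed

end

section \<open>Vanishing of derived functors without resolutions\<close>

text \<open>Right exactness; it includes the preservation of zero arrows.\<close>

definition preserves_cokernels ::
    "('o, 'm) abcat \<Rightarrow> ('p, 'n) abcat \<Rightarrow> ('o, 'm, 'p, 'n) ftor \<Rightarrow> bool" where
  "preserves_cokernels C D T \<longleftrightarrow> is_functor C D T \<and>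
    (\<forall>f c. is_cokernel C f c \<longrightarrow> is_cokernel D (fmap T f) (fmap T c))"

text \<open>For right exact \<open>T\<close> this says that \<open>L\<^sub>n\<^sub>+\<^sub>1 T(X) = 0\<close>. In degree one all short exact sequences that
  end in \<open>X\<close> are tested, which makes extensions easy; in higher degrees \<open>X\<close> is replaced by all of its
  syzygies, and independence of the choice is proved below.\<close>

primrec derived_vanishes ::
    "('o, 'm) abcat \<Rightarrow> ('p, 'n) abcat \<Rightarrow> ('o, 'm, 'p, 'n) ftor \<Rightarrow> nat \<Rightarrow> 'o \<Rightarrow> bool" where
  "derived_vanishes C D T 0 X \<longleftrightarrow>
    (\<forall>k g. short_exact C k g \<and> Cod C g = X \<longrightarrow> mono_arr D (fmap T k))"
| "derived_vanishes C D T (Suc n) X \<longleftrightarrow>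
    (\<forall>k g. short_exact C k g \<and> Cod C g = X \<and> projective C (Dom C g) \<longrightarrow>
       derived_vanishes C D T n (Dom C k))"

lemma derived_vanishes_0D:
  "derived_vanishes C D T 0 X \<Longrightarrow> short_exact C k g \<Longrightarrow> g \<in> Hom C E X \<Longrightarrow> mono_arr D (fmap T k)"
  by (auto simp: Hom_def)

lemma derived_vanishes_SucD:
  "derived_vanishes C D T (Suc n) X \<Longrightarrow> short_exact C k g \<Longrightarrow> g \<in> Hom C P X \<Longrightarrow> projective C P
    \<Longrightarrow> k \<in> Hom C K P \<Longrightarrow> derived_vanishes C D T n K"
  by (auto simp: Hom_def)

lemma is_functor_Obj: "is_functor C D T \<Longrightarrow> X \<in> Obj C \<Longrightarrow> fobj T X \<in> Obj D"
  by (simp add: is_functor_def)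

lemma is_functor_Ident: "is_functor C D T \<Longrightarrow> X \<in> Obj C \<Longrightarrow> fmap T (Ident C X) = Ident D (fobj T X)"
  by (simp add: is_functor_def)

context category
begin

lemma is_functor_Hom:
  assumes "is_functor C D T" "f \<in> Hom C X Y"
  shows "fmap T f \<in> Hom D (fobj T X) (fobj T Y)"
  using assms Hom_Obj[OF assms(2)] by (auto simp: is_functor_def)

lemma is_functor_Comp:
  assumes "is_functor C D T" "f \<in> Hom C X Y" "g \<in> Hom C Y Z"
  shows "fmap T (g \<cdot> f) = fmap T g \<cdot>\<^bsub>D\<^esub> fmap T f"
  using assms Hom_Obj[OF assms(2)] Hom_Obj[OF assms(3)] unfolding is_functor_def by blast

end

locale two_abelian = C: abelian_category C + D: abelian_category D
  for C :: "('o, 'm) abcat" (structure) and D :: "('p, 'n) abcat"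
begin

text \<open>The identity is a cokernel of a zero arrow.\<close>

lemma preserves_cokernels_Zero:
  assumes T: "preserves_cokernels C D T" and X: "X \<in> Obj C" and Y: "Y \<in> Obj C"
  shows "fmap T (Zero C X Y) = Zero D (fobj T X) (fobj T Y)"
proof -
  have F: "is_functor C D T" using T by (simp add: preserves_cokernels_def)
  have z: "Zero C X Y \<in> Hom C X Y" and i: "Ident C Y \<in> Hom C Y Y"
    using C.Zero_in_Hom X Y C.Ident_in_Hom by auto
  have "is_cokernel C (Zero C X Y) (Ident C Y)"
  proof (rule C.is_cokernelI[OF z i])
    show "epi_arr C (Ident C Y)" using C.epi_arr_of_section[OF i i] C.Comp_Ident_left[OF i] by simp
    show "Ident C Y \<cdot> Zero C X Y = Zero C X Y" using C.Comp_Ident_left[OF z] .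
    show "\<exists>u \<in> Hom C Y Z. u \<cdot> Ident C Y = h" if "h \<in> Hom C Y Z" for Z h
      using that C.Comp_Ident_right by blast
  qed
  then have "is_cokernel D (fmap T (Zero C X Y)) (fmap T (Ident C Y))"
    using T by (simp add: preserves_cokernels_def)
  from D.is_cokernelD(2)[OF this C.is_functor_Hom[OF F z]]
  show ?thesis
    using D.Comp_Ident_left[OF C.is_functor_Hom[OF F z]] is_functor_Ident[OF F Y]
      HomD(3)[OF D.Ident_in_Hom[OF is_functor_Obj[OF F Y]]] by simp
qed

lemma preserves_cokernels_epi:
  assumes T: "preserves_cokernels C D T" and p: "epi_arr C p"
  shows "epi_arr D (fmap T p)"
  using C.epi_is_cokernel[OF p] T D.is_cokernel_epi unfolding preserves_cokernels_def by blast

lemma preserves_cokernels_short_exact: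
  assumes T: "preserves_cokernels C D T" and "short_exact C k g" and "mono_arr D (fmap T k)"
  shows "short_exact D (fmap T k) (fmap T g)"
  using assms D.short_exact_of_mono unfolding preserves_cokernels_def short_exact_def by blast

end

locale right_exact = two_abelian C D
  for C :: "('o, 'm) abcat" (structure) and D :: "('p, 'n) abcat" +
  fixes T :: "('o, 'm, 'p, 'n) ftor"
  assumes T: "preserves_cokernels C D T" and enough: "enough_projectives C"
begin

abbreviation LV :: "nat \<Rightarrow> 'o \<Rightarrow> bool" where
  "LV \<equiv> derived_vanishes C D T"

lemma T_functor: "is_functor C D T"
  using T by (simp add: preserves_cokernels_def)

lemmas T_Hom = C.is_functor_Hom[OF T_functor]
lemmas T_Comp = C.is_functor_Comp[OF T_functor]
lemmas T_Obj = is_functor_Obj[OF T_functor]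

lemma projective_cover:
  assumes "X \<in> Obj C"
  obtains P p k K where "projective C P" "p \<in> Hom C P X" "epi_arr C p"
    "short_exact C k p" "k \<in> Hom C K P"
proof -
  obtain P p where P: "projective C P" "p \<in> Hom C P X" "epi_arr C p"
    using enough assms unfolding enough_projectives_def by blast
  obtain k where k: "short_exact C k p" using C.epi_short_exact[OF P(3)] .
  have "k \<in> Hom C (Dom C k) P" using C.short_exact_Hom(1)[OF k] HomD(2)[OF P(2)] by simp
  then show ?thesis using that P k by blast
qed

lemma T_split_mono:
  assumes "k \<in> Hom C X Y" "r \<in> Hom C Y X" "r \<cdot> k = Ident C X"
  shows "mono_arr D (fmap T k)"
proof (rule D.mono_arr_of_retraction[OF T_Hom[OF assms(1)] T_Hom[OF assms(2)]])
  show "fmap T r \<cdot>\<^bsub>D\<^esub> fmap T k = Ident D (fobj T X)"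
    using T_Comp[OF assms(1,2)] assms(3) is_functor_Ident[OF T_functor] C.Hom_Obj[OF assms(1)] by simp
qed

text \<open>A sequence that ends in a projective object splits, and so its kernel is again projective when the
  middle term is.\<close>

lemma derived_vanishes_projective: "projective C P \<Longrightarrow> LV n P"
proof (induction n arbitrary: P)
  case 0
  have "mono_arr D (fmap T k)" if kg: "short_exact C k g" "Cod C g = P" for k g
  proof -
    note H = C.short_exact_Hom[OF kg(1), unfolded kg(2)]
    obtain r where "r \<in> Hom C (Dom C g) (Dom C k)" "r \<cdot> k = Ident C (Dom C k)"
      using C.projective_short_exact_split[OF 0 kg(1) H(1,2)] .
    then show ?thesis using T_split_mono[OF H(1)] by blast
  qed
  then show ?case by auto
next
  case (Suc n)
  have "LV n (Dom C k)" if kg: "short_exact C k g" "Cod C g = P" "projective C (Dom C g)" for k g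
  proof -
    note H = C.short_exact_Hom[OF kg(1), unfolded kg(2)]
    obtain r where "r \<in> Hom C (Dom C g) (Dom C k)" "r \<cdot> k = Ident C (Dom C k)"
      using C.projective_short_exact_split[OF Suc.prems kg(1) H(1,2)] .
    then show ?thesis using Suc.IH C.projective_retract[OF kg(3) H(1)] by blast
  qed
  then show ?case by auto
qed

text \<open>In degree one, pull the sequence back along the retraction \<open>r\<close>: the section \<open>s\<close> embeds the given
  sequence into the pulled back one, with the same kernel. In higher degrees, a projective cover
  of the pullback has the given cover as a retract over \<open>r\<close> and \<open>s\<close>, and so the same holds for the
  kernels.\<close>

lemma derived_vanishes_retract:
  "LV n Y \<Longrightarrow> s \<in> Hom C X Y \<Longrightarrow> r \<in> Hom C Y X \<Longrightarrow> r \<cdot> s = Ident C X \<Longrightarrow> LV n X"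
proof (induction n arbitrary: X Y r s)
  case 0
  note s = \<open>s \<in> Hom C X Y\<close> and r = \<open>r \<in> Hom C Y X\<close> and rs = \<open>r \<cdot> s = Ident C X\<close>
  have "mono_arr D (fmap T k)" if kg: "short_exact C k g" "Cod C g = X" for k g
  proof -
    note H = C.short_exact_Hom[OF kg(1), unfolded kg(2)]
    obtain E a b where pb: "is_pullback C g r E a b" using C.pullback_exists[OF H(2) r] .
    note P = is_pullbackD[OF pb H(2) r]
    obtain k' where k': "k' \<in> Hom C (Dom C k) E" "short_exact C k' b" "a \<cdot> k' = k"
      using C.pullback_short_exact[OF kg(1) H(2) r pb] .
    have E: "Dom C g \<in> Obj C" using C.Hom_Obj[OF H(2)] by simp
    note sg = C.Comp_in_Hom[OF H(2) s]
    have "g \<cdot> Ident C (Dom C g) = r \<cdot> (s \<cdot> g)"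
      using C.Comp_assoc[OF H(2) s r] rs C.Comp_Ident_left[OF H(2)] C.Comp_Ident_right[OF H(2)]
      by simp
    then obtain t where t: "t \<in> Hom C (Dom C g) E" "a \<cdot> t = Ident C (Dom C g)" "b \<cdot> t = s \<cdot> g"
      using is_pullback_lift[OF pb H(2) r C.Ident_in_Hom[OF E] sg] by metis
    have "a \<cdot> (t \<cdot> k) = a \<cdot> k'"
      using C.Comp_assoc[OF H(1) t(1) P(1)] t(2) C.Comp_Ident_left[OF H(1)] k'(3) by simp
    moreover have "b \<cdot> (t \<cdot> k) = b \<cdot> k'"
      using C.Comp_assoc[OF H(1) t(1) P(2)] t(3) C.Comp_assoc[OF H(1,2) s] H(3)
        C.Comp_Zero_right[OF _ s] C.Hom_Obj[OF H(1)] C.short_exact_Hom(3)[OF k'(2)] HomD[OF k'(1)]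
        HomD[OF P(2)]
      by simp
    ultimately have "t \<cdot> k = k'"
      using is_pullback_eqI[OF pb C.Comp_in_Hom[OF H(1) t(1)] k'(1)] by simp
    moreover have "mono_arr D (fmap T k')"
      using derived_vanishes_0D[OF 0(1) k'(2) P(2)] .
    ultimately show ?thesis
      using D.mono_arr_of_Comp[OF T_Hom[OF H(1)] T_Hom[OF t(1)]] T_Comp[OF H(1) t(1)] by simp
  qed
  then show ?case by auto
next
  case (Suc n)
  note s = \<open>s \<in> Hom C X Y\<close> and r = \<open>r \<in> Hom C Y X\<close> and rs = \<open>r \<cdot> s = Ident C X\<close>
  have "LV n (Dom C k)" if kg: "short_exact C k g" "Cod C g = X" "projective C (Dom C g)" for k g
  proof -
    define P K where "P = Dom C g" and "K = Dom C k"
    have proj: "projective C P" using kg(3) P_def by simp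
    note H = C.short_exact_Hom[OF kg(1), unfolded kg(2), folded P_def K_def]
    obtain E a b where pb: "is_pullback C g r E a b" using C.pullback_exists[OF H(2) r] .
    note D = is_pullbackD[OF pb H(2) r]
    have Po: "P \<in> Obj C" and E: "E \<in> Obj C" and K: "K \<in> Obj C" using C.Hom_Obj H(1) D(1) by auto
    note sg = C.Comp_in_Hom[OF H(2) s]
    have "g \<cdot> Ident C P = r \<cdot> (s \<cdot> g)"
      using C.Comp_assoc[OF H(2) s r] rs C.Comp_Ident_left[OF H(2)] C.Comp_Ident_right[OF H(2)]
      by simp
    then obtain t where t: "t \<in> Hom C P E" "a \<cdot> t = Ident C P" "b \<cdot> t = s \<cdot> g"
      using is_pullback_lift[OF pb H(2) r C.Ident_in_Hom[OF Po] sg] by metis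
    obtain Q c where Q: "projective C Q" "c \<in> Hom C Q E" "epi_arr C c"
      using projective_cover[OF E] by metis
    note bc = C.Comp_in_Hom[OF Q(2) D(2)] and ac = C.Comp_in_Hom[OF Q(2) D(1)]
    have "epi_arr C (b \<cdot> c)"
      using C.epi_arr_Comp[OF Q(2,3) D(2)] C.is_pullback_epi[OF pb H(2) H(5) r] by simp
    then obtain l where l: "short_exact C l (b \<cdot> c)" using C.epi_short_exact by blast
    define L where "L = Dom C l"
    have lH: "l \<in> Hom C L Q" and bcl: "(b \<cdot> c) \<cdot> l = Zero C L Y"
      using C.short_exact_Hom(1,3)[OF l] HomD[OF bc] L_def by auto
    have LVL: "LV n L" using derived_vanishes_SucD[OF Suc.prems(1) l bc Q(1) lH] .
    obtain \<psi> where \<psi>: "\<psi> \<in> Hom C P Q" "c \<cdot> \<psi> = t"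
      using C.projective_lift[OF proj Q(3,2) t(1)] .
    \<comment> \<open>\<open>a c\<close> and \<open>\<psi>\<close> make \<open>P\<close> a retract of \<open>Q\<close>, compatibly with \<open>r\<close> and \<open>s\<close>; restrict to kernels\<close>
    have retr: "(a \<cdot> c) \<cdot> \<psi> = Ident C P"
      using C.Comp_assoc[OF \<psi>(1) Q(2) D(1)] \<psi>(2) t(2) by simp
    have over_s: "(b \<cdot> c) \<cdot> \<psi> = s \<cdot> g"
      using C.Comp_assoc[OF \<psi>(1) Q(2) D(2)] \<psi>(2) t(3) by simp
    have over_r: "g \<cdot> (a \<cdot> c) = r \<cdot> (b \<cdot> c)"
      using C.Comp_assoc[OF Q(2) D(1) H(2)] C.Comp_assoc[OF Q(2) D(2) r] D(3) by simp
    have "(b \<cdot> c) \<cdot> (\<psi> \<cdot> k) = Zero C K Y"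
      using C.Comp_assoc[OF H(1) \<psi>(1) bc] over_s C.Comp_assoc[OF H(1,2) s] H(3)
        C.Comp_Zero_right[OF K s] by simp
    then obtain v where v: "v \<in> Hom C K L" "l \<cdot> v = \<psi> \<cdot> k"
      using C.short_exact_factor[OF l bc C.Comp_in_Hom[OF H(1) \<psi>(1)]] L_def by metis
    have "g \<cdot> ((a \<cdot> c) \<cdot> l) = Zero C L X"
      using C.Comp_assoc[OF lH ac H(2)] over_r C.Comp_assoc[OF lH bc r] bcl
        C.Comp_Zero_right[OF _ r] C.Hom_Obj[OF lH] by simp
    then obtain u where u: "u \<in> Hom C L K" "k \<cdot> u = (a \<cdot> c) \<cdot> l"
      using C.short_exact_factor[OF kg(1) H(2) C.Comp_in_Hom[OF lH ac]] K_def by metis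
    have "k \<cdot> (u \<cdot> v) = (a \<cdot> c) \<cdot> (\<psi> \<cdot> k)"
      using C.Comp_assoc[OF v(1) u(1) H(1)] u(2) C.Comp_assoc[OF v(1) lH ac] v(2) by simp
    also have "\<dots> = k \<cdot> Ident C K"
      using C.Comp_assoc[OF H(1) \<psi>(1) ac] retr C.Comp_Ident_left[OF H(1)]
        C.Comp_Ident_right[OF H(1)] by simp
    finally have "u \<cdot> v = Ident C K"
      using C.mono_arrD[OF H(4,1) C.Comp_in_Hom[OF v(1) u(1)] C.Ident_in_Hom[OF K]] by simp
    then show ?thesis using Suc.IH[OF LVL v(1) u(1)] K_def by simp
  qed
  then show ?case by auto
qed

text \<open>The part \<open>L\<^sub>n\<^sub>+\<^sub>2 T(Z) \<rightarrow> L\<^sub>n\<^sub>+\<^sub>1 T(X) \<rightarrow> L\<^sub>n\<^sub>+\<^sub>1 T(Y)\<close> of the long exact sequence. Pull \<open>Y \<rightarrow> Z\<close> back along a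
  projective cover \<open>P \<rightarrow> Z\<close> with kernel \<open>K\<close>: the pullback is an extension of \<open>Y\<close> by \<open>K\<close>, and it has \<open>X\<close>
  as a retract because its projection to \<open>P\<close> splits. The extension property in the same degree is
  a hypothesis, since the two statements are proved by a common induction.\<close>

lemma derived_vanishes_shift_step:
  assumes ext: "\<And>a b X Y Z. short_exact C a b \<Longrightarrow> a \<in> Hom C X Y \<Longrightarrow> b \<in> Hom C Y Z
      \<Longrightarrow> LV n X \<Longrightarrow> LV n Z \<Longrightarrow> LV n Y"
    and ab: "short_exact C a b" "a \<in> Hom C X Y" "b \<in> Hom C Y Z"
    and Z: "LV (Suc n) Z" and Y: "LV n Y"
  shows "LV n X"
proof -
  obtain P p k K where P: "projective C P" "p \<in> Hom C P Z" and k: "short_exact C k p" "k \<in> Hom C K P"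
    using projective_cover C.Hom_Obj(2)[OF ab(3)] by metis
  have LVK: "LV n K" using derived_vanishes_SucD[OF Z k(1) P(2,1) k(2)] .
  obtain E u v where pb: "is_pullback C b p E u v" using C.pullback_exists[OF ab(3) P(2)] .
  note D = is_pullbackD[OF pb ab(3) P(2)]
  obtain k1 where k1: "k1 \<in> Hom C X E" "short_exact C k1 v"
    using C.pullback_short_exact[OF ab(1,3) P(2) pb] HomD[OF ab(2)] by metis
  obtain k2 where k2: "k2 \<in> Hom C K E" "short_exact C k2 u"
    using C.pullback_short_exact[OF k(1) P(2) ab(3) is_pullback_sym[OF pb]] HomD[OF k(2)] by metis
  have "LV n E" using ext[OF k2(2,1) D(1) LVK Y] .
  moreover obtain r where "r \<in> Hom C E X" "r \<cdot> k1 = Ident C X"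
    using C.projective_short_exact_split[OF P(1) k1(2,1) D(2)] .
  ultimately show ?thesis using derived_vanishes_retract k1(1) by blast
qed

text \<open>For a cover \<open>E \<rightarrow> Y\<close> with kernel \<open>K\<close>, let \<open>N\<close> be the kernel of \<open>E \<rightarrow> Z\<close>. In degree one, \<open>K \<rightarrow> E\<close> is the
  composite of \<open>K \<rightarrow> N\<close>, a kernel over \<open>X\<close>, and \<open>N \<rightarrow> E\<close>, a kernel over \<open>Z\<close>. In higher degrees the
  shift one degree below applies to \<open>0 \<rightarrow> K \<rightarrow> N \<rightarrow> X \<rightarrow> 0\<close>.\<close>

lemma derived_vanishes_extension:
  "short_exact C a b \<Longrightarrow> a \<in> Hom C X Y \<Longrightarrow> b \<in> Hom C Y Z \<Longrightarrow> LV n X \<Longrightarrow> LV n Z \<Longrightarrow> LV n Y"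
proof (induction n arbitrary: a b X Y Z)
  case 0
  note ab = \<open>short_exact C a b\<close> \<open>a \<in> Hom C X Y\<close> \<open>b \<in> Hom C Y Z\<close>
  have "mono_arr D (fmap T k)" if kg: "short_exact C k g" "Cod C g = Y" for k g
  proof -
    note H = C.short_exact_Hom[OF kg(1), unfolded kg(2)]
    obtain N n h k' where n: "n \<in> Hom C N (Dom C g)" "short_exact C n (b \<cdot> g)"
      and h: "h \<in> Hom C N X" and k': "k' \<in> Hom C (Dom C k) N" "short_exact C k' h" "n \<cdot> k' = k"
      using C.short_exact_preimage[OF ab kg(1) H(1,2)] .
    have "mono_arr D (fmap T n)"
      using derived_vanishes_0D[OF 0(5) n(2) C.Comp_in_Hom[OF H(2) ab(3)]] .
    moreover have "mono_arr D (fmap T k')"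
      using derived_vanishes_0D[OF 0(4) k'(2) h] .
    ultimately show ?thesis
      using D.mono_arr_Comp[OF T_Hom[OF k'(1)] _ T_Hom[OF n(1)]] T_Comp[OF k'(1) n(1)] k'(3)
      by simp
  qed
  then show ?case by auto
next
  case (Suc m)
  note ab = \<open>short_exact C a b\<close> \<open>a \<in> Hom C X Y\<close> \<open>b \<in> Hom C Y Z\<close>
  have "LV m (Dom C k)" if kg: "short_exact C k g" "Cod C g = Y" "projective C (Dom C g)" for k g
  proof -
    note H = C.short_exact_Hom[OF kg(1), unfolded kg(2)]
    obtain N n h k' where n: "n \<in> Hom C N (Dom C g)" "short_exact C n (b \<cdot> g)"
      and h: "h \<in> Hom C N X" and k': "k' \<in> Hom C (Dom C k) N" "short_exact C k' h"
      using C.short_exact_preimage[OF ab kg(1) H(1,2)] .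
    have N: "LV m N"
      using derived_vanishes_SucD[OF Suc.prems(5) n(2) C.Comp_in_Hom[OF H(2) ab(3)] kg(3) n(1)] .
    show ?thesis
      by (rule derived_vanishes_shift_step[OF _ k'(2,1) h Suc.prems(4) N]) (erule (4) Suc.IH)
  qed
  then show ?case by auto
qed

lemma derived_vanishes_shift:
  "short_exact C a b \<Longrightarrow> a \<in> Hom C X Y \<Longrightarrow> b \<in> Hom C Y Z \<Longrightarrow> LV (Suc n) Z \<Longrightarrow> LV n Y \<Longrightarrow> LV n X"
  using derived_vanishes_shift_step derived_vanishes_extension by blast

text \<open>One sequence with projective middle term decides the vanishing of \<open>L\<^sub>1 T(X)\<close>. The pullback \<open>E\<close> of this
  sequence and another one, \<open>0 \<rightarrow> L \<rightarrow> Y \<rightarrow> X \<rightarrow> 0\<close>, is an extension of \<open>P\<close> by \<open>L\<close> that splits, so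
  \<open>T L \<rightarrow> T E\<close> is mono; it is also an extension of \<open>Y\<close> by \<open>K\<close>, so by right exactness whatever \<open>T L \<rightarrow> T Y\<close>
  kills comes from \<open>T K\<close>, which embeds into \<open>T P\<close>.\<close>

lemma derived_vanishes_0I:
  assumes kp: "short_exact C k p" and k: "k \<in> Hom C K P" and p: "p \<in> Hom C P X"
    and P: "projective C P" and mono: "mono_arr D (fmap T k)"
  shows "LV 0 X"
proof -
  have "mono_arr D (fmap T l)" if lg: "short_exact C l g" "Cod C g = X" for l g
  proof -
    define Y L where "Y = Dom C g" and "L = Dom C l"
    note H = C.short_exact_Hom[OF lg(1), unfolded lg(2), folded Y_def L_def]
    obtain E a b where pb: "is_pullback C g p E a b" using C.pullback_exists[OF H(2) p] .
    note D = is_pullbackD[OF pb H(2) p]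
    obtain l' where l': "l' \<in> Hom C L E" "short_exact C l' b" "a \<cdot> l' = l"
      using C.pullback_short_exact[OF lg(1) H(2) p pb] L_def by metis
    obtain k' where k': "k' \<in> Hom C K E" "short_exact C k' a" "b \<cdot> k' = k"
      using C.pullback_short_exact[OF kp p H(2) is_pullback_sym[OF pb]] HomD[OF k] by metis
    obtain r where r: "r \<in> Hom C E L" "r \<cdot> l' = Ident C L"
      using C.projective_short_exact_split[OF P l'(2,1) D(2)] .
    have l'mono: "mono_arr D (fmap T l')" using T_split_mono[OF l'(1) r] .
    have L: "L \<in> Obj C" and Po: "P \<in> Obj C" using C.Hom_Obj H(1) p by auto
    have bl': "b \<cdot> l' = Zero C L P"
      using C.short_exact_Hom(3)[OF l'(2)] HomD[OF l'(1)] HomD[OF D(2)] by simp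
    note Tl = T_Hom[OF H(1)] and Tl' = T_Hom[OF l'(1)] and Tk' = T_Hom[OF k'(1)]
      and Ta = T_Hom[OF D(1)] and Tb = T_Hom[OF D(2)] and Tk = T_Hom[OF k]
    have cok: "is_cokernel D (fmap T k') (fmap T a)"
      using T k'(2) by (simp add: preserves_cokernels_def short_exact_def)
    show ?thesis
    proof (rule D.mono_arr_zeroI[OF Tl])
      fix W v assume v: "v \<in> Hom D W (fobj T L)"
        and Tlv: "fmap T l \<cdot>\<^bsub>D\<^esub> v = Zero D W (fobj T Y)"
      note l'v = D.Comp_in_Hom[OF v Tl']
      have "fmap T a \<cdot>\<^bsub>D\<^esub> (fmap T l' \<cdot>\<^bsub>D\<^esub> v) = Zero D W (Cod D (fmap T a))"
        using D.Comp_assoc[OF v Tl' Ta] T_Comp[OF l'(1) D(1)] l'(3) Tlv HomD[OF Ta] by simp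
      then obtain V q w where q: "q \<in> Hom D V W" "epi_arr D q" and w: "w \<in> Hom D V (fobj T K)"
        and eq: "fmap T k' \<cdot>\<^bsub>D\<^esub> w = (fmap T l' \<cdot>\<^bsub>D\<^esub> v) \<cdot>\<^bsub>D\<^esub> q"
        using D.cokernel_chase[OF cok Tk' l'v] by metis
      have V: "V \<in> Obj D" using D.Hom_Obj[OF q(1)] by simp
      note vq = D.Comp_in_Hom[OF q(1) v]
      have eq': "fmap T k' \<cdot>\<^bsub>D\<^esub> w = fmap T l' \<cdot>\<^bsub>D\<^esub> (v \<cdot>\<^bsub>D\<^esub> q)"
        using eq D.Comp_assoc[OF q(1) v Tl'] by simp
      have "fmap T k \<cdot>\<^bsub>D\<^esub> w = fmap T b \<cdot>\<^bsub>D\<^esub> (fmap T l' \<cdot>\<^bsub>D\<^esub> (v \<cdot>\<^bsub>D\<^esub> q))"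
        using D.Comp_assoc[OF w Tk' Tb] T_Comp[OF k'(1) D(2)] k'(3) eq' by simp
      also have "\<dots> = Zero D V (fobj T P)"
        using D.Comp_assoc[OF vq Tl' Tb] T_Comp[OF l'(1) D(2)] bl'
          preserves_cokernels_Zero[OF T L Po] D.Comp_Zero_left[OF T_Obj[OF Po] vq] by simp
      finally have "w = Zero D V (fobj T K)"
        using D.mono_arr_zeroD[OF mono Tk w] by simp
      then have "fmap T l' \<cdot>\<^bsub>D\<^esub> (v \<cdot>\<^bsub>D\<^esub> q) = Zero D V (fobj T E)"
        using eq' D.Comp_Zero_right[OF V Tk'] by simp
      then have "v \<cdot>\<^bsub>D\<^esub> q = Zero D V (fobj T L)"
        using D.mono_arr_zeroD[OF l'mono Tl' vq] by simp
      then show "v = Zero D W (fobj T L)"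
        using D.epi_arr_zeroD[OF q(2,1) v] by simp
    qed
  qed
  then show ?thesis by auto
qed

text \<open>The same pullback as in degree one: it is an extension of the projective \<open>P'\<close> of another sequence
  by \<open>K\<close>, and it has the kernel of that other sequence as a retract.\<close>

lemma derived_vanishes_SucI:
  assumes kp: "short_exact C k p" and k: "k \<in> Hom C K P" and p: "p \<in> Hom C P X"
    and P: "projective C P" and LVK: "LV n K"
  shows "LV (Suc n) X"
proof -
  have "LV n (Dom C l)" if lg: "short_exact C l g" "Cod C g = X" "projective C (Dom C g)" for l g
  proof -
    note H = C.short_exact_Hom[OF lg(1), unfolded lg(2)]
    obtain E a b where pb: "is_pullback C g p E a b" using C.pullback_exists[OF H(2) p] .
    note D = is_pullbackD[OF pb H(2) p]
    obtain l' where l': "l' \<in> Hom C (Dom C l) E" "short_exact C l' b"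
      using C.pullback_short_exact[OF lg(1) H(2) p pb] by metis
    obtain k' where k': "k' \<in> Hom C K E" "short_exact C k' a"
      using C.pullback_short_exact[OF kp p H(2) is_pullback_sym[OF pb]] HomD[OF k] by metis
    have "LV n E"
      using derived_vanishes_extension[OF k'(2,1) D(1) LVK] derived_vanishes_projective[OF lg(3)]
      by blast
    moreover obtain r where "r \<in> Hom C E (Dom C l)" "r \<cdot> l' = Ident C (Dom C l)"
      using C.projective_short_exact_split[OF P l'(2,1) D(2)] .
    ultimately show ?thesis using derived_vanishes_retract l'(1) by blast
  qed
  then show ?thesis by auto
qed

end

section \<open>Resolutions, homology and acyclic complexes\<close>

lemma zero_object_unique:
  assumes "zero_object C Z" "X \<in> Obj C"
  shows "f \<in> Hom C X Z \<Longrightarrow> g \<in> Hom C X Z \<Longrightarrow> f = g"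
    and "f \<in> Hom C Z X \<Longrightarrow> g \<in> Hom C Z X \<Longrightarrow> f = g"
  using assms unfolding zero_object_def by blast+

context abelian_category
begin

lemma zero_objectI:
  assumes X: "X \<in> Obj C" and id: "Ident C X = Zero C X X"
  shows "zero_object C X"
proof -
  have "f = Zero C Y X" if f: "f \<in> Hom C Y X" for f Y
    using Comp_Ident_left[OF f] id Comp_Zero_left[OF X f] by simp
  moreover have "f = Zero C X Y" if f: "f \<in> Hom C X Y" for f Y
    using Comp_Ident_right[OF f] id Comp_Zero_right[OF X f] by simp
  ultimately show ?thesis
    unfolding zero_object_def using X Zero_in_Hom[OF X] Zero_in_Hom[OF _ X] by blast
qed

lemma zero_object_quotient:
  assumes Z: "zero_object C Z" and p: "p \<in> Hom C Z X" "epi_arr C p"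
  shows "zero_object C X"
proof -
  have X: "X \<in> Obj C" using Hom_Obj[OF p(1)] by simp
  have "Ident C X \<cdot> p = Zero C X X \<cdot> p"
    using zero_object_unique(2)[OF Z X] Comp_in_Hom[OF p(1)] Ident_in_Hom[OF X] Zero_in_Hom[OF X X]
    by blast
  then have "Ident C X = Zero C X X"
    using epi_arrD[OF p(2,1) Ident_in_Hom[OF X] Zero_in_Hom[OF X X]] by simp
  then show ?thesis using zero_objectI[OF X] by simp
qed

lemma projective_resolution_syzygies:
  assumes R: "projective_resolution C X R"
  obtains K k p where "K 0 = X"
    "\<And>n. k n \<in> Hom C (K (Suc n)) (rterm R n)" "\<And>n. p n \<in> Hom C (rterm R n) (K n)"
    "\<And>n. short_exact C (k n) (p n)" "\<And>n. rdiff R n = k n \<cdot> p (Suc n)"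
proof -
  \<comment> \<open>\<open>?d n\<close> is the arrow out of \<open>rterm R n\<close>, which is the augmentation for \<open>n = 0\<close>\<close>
  let ?B = "\<lambda>n. case n of 0 \<Rightarrow> X | Suc m \<Rightarrow> rterm R m"
  let ?d = "\<lambda>n. case n of 0 \<Rightarrow> raug R | Suc m \<Rightarrow> rdiff R m"
  have dH: "?d n \<in> Hom C (rterm R n) (?B n)" for n
    using R by (cases n) (auto simp: projective_resolution_def)
  have dex: "exact_at C (rdiff R n) (?d n)" for n
    using R by (cases n) (auto simp: projective_resolution_def)
  have rd: "rdiff R n \<in> Hom C (rterm R (Suc n)) (rterm R n)" for n
    using R by (simp add: projective_resolution_def)
  define k where "k n = (SOME k. is_kernel C (?d n) k)" for n
  have k: "is_kernel C (?d n) (k n)" for n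
    unfolding k_def using someI_ex[OF kernel_exists[OF HomD(1)[OF dH]]] .
  note k1 = is_kernelD[OF k dH]
  have "\<exists>p. p \<in> Hom C (rterm R (Suc n)) (Dom C (k n)) \<and> epi_arr C p \<and> k n \<cdot> p = rdiff R n" for n
    using exact_at_cover[OF dex rd dH k] by metis
  then obtain q where q: "\<And>n. q n \<in> Hom C (rterm R (Suc n)) (Dom C (k n))" "\<And>n. epi_arr C (q n)"
    "\<And>n. k n \<cdot> q n = rdiff R n" by metis
  define p where "p n = (case n of 0 \<Rightarrow> raug R | Suc m \<Rightarrow> q m)" for n
  define K where "K n = (case n of 0 \<Rightarrow> X | Suc m \<Rightarrow> Dom C (k m))" for n
  have pH: "p n \<in> Hom C (rterm R n) (K n)" for n
    using dH[of 0] q(1) by (cases n) (auto simp: p_def K_def)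
  have pe: "epi_arr C (p n)" for n
    using R q(2) by (cases n) (auto simp: p_def projective_resolution_def)
  have "is_kernel C (p n) (k n)" for n
  proof (cases n)
    case 0 then show ?thesis using k[of 0] by (simp add: p_def)
  next
    case (Suc m)
    have "is_kernel C (k m \<cdot> q m) (k n)" using k[of n] Suc q(3)[of m] by simp
    then show ?thesis
      using is_kernel_of_postcomp_mono[OF _ q(1) k1(1) is_kernel_mono[OF k]] Suc by (simp add: p_def)
  qed
  then have "short_exact C (k n) (p n)" for n using short_exact_of_epi[OF pe] by blast
  moreover have "k n \<in> Hom C (K (Suc n)) (rterm R n)" for n using k1(1) by (simp add: K_def)
  ultimately show ?thesis
    using that[of K k p] pH q(3) by (simp add: K_def p_def)
qed

lemma projective_resolution_exists:
  assumes enough: "enough_projectives C" and X: "X \<in> Obj C"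
  obtains R where "projective_resolution C X R"
proof -
  have "\<exists>p k. Y \<in> Obj C \<longrightarrow> projective C (Dom C p) \<and> p \<in> Hom C (Dom C p) Y \<and> short_exact C k p" for Y
  proof (cases "Y \<in> Obj C")
    case True
    then obtain P p where P: "projective C P" "p \<in> Hom C P Y" "epi_arr C p"
      using enough unfolding enough_projectives_def by blast
    then show ?thesis using epi_short_exact[OF P(3)] HomD(2)[OF P(2)] by metis
  qed simp
  then obtain p k where pk: "\<And>Y. Y \<in> Obj C \<Longrightarrow>
      projective C (Dom C (p Y)) \<and> p Y \<in> Hom C (Dom C (p Y)) Y \<and> short_exact C (k Y) (p Y)"
    by metis
  define K where "K n = ((\<lambda>Y. Dom C (k Y)) ^^ n) X" for n
  have K_Suc: "K (Suc n) = Dom C (k (K n))" and K_0: "K 0 = X" for n by (auto simp: K_def)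
  have k: "k Y \<in> Hom C (Dom C (k Y)) (Dom C (p Y))" if "Y \<in> Obj C" for Y
    using short_exact_Hom(1) pk[OF that] by blast
  have Ko: "K n \<in> Obj C" for n
  proof (induction n)
    case 0 show ?case using X K_0 by simp
  next
    case (Suc n) show ?case using Hom_Obj(1)[OF k[OF Suc]] K_Suc by simp
  qed
  note P = pk[OF Ko]
  have kH: "k (K n) \<in> Hom C (K (Suc n)) (Dom C (p (K n)))" for n using k[OF Ko] K_Suc by simp
  have pe: "epi_arr C (p (K n))" for n using short_exact_Hom(5) P by blast
  let ?R = "\<lparr>rterm = \<lambda>n. Dom C (p (K n)), rdiff = \<lambda>n. k (K n) \<cdot> p (K (Suc n)), raug = p X\<rparr>"
  have "projective_resolution C X ?R"
    unfolding projective_resolution_def resolution.simps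
  proof (intro conjI allI)
    show "projective C (Dom C (p (K n)))" for n using P by blast
    show "k (K n) \<cdot> p (K (Suc n)) \<in> Hom C (Dom C (p (K (Suc n)))) (Dom C (p (K n)))" for n
      using Comp_in_Hom kH P by blast
    show "p X \<in> Hom C (Dom C (p (K 0))) X" "epi_arr C (p X)" using P[of 0] pe[of 0] K_0 by auto
    show "exact_at C (k (K 0) \<cdot> p (K (Suc 0))) (p X)"
      using exact_at_splice[OF _ kH[of 0] _ _ pe Ident_in_Hom[OF X]
        mono_arr_Ident[OF X], of "p X"]
        P[of 0] P[of "Suc 0"] K_0 Comp_Ident_left by auto
    show "exact_at C (k (K (Suc n)) \<cdot> p (K (Suc (Suc n)))) (k (K n) \<cdot> p (K (Suc n)))" for n
      using exact_at_splice[OF _ kH[of "Suc n"] _ _ pe kH[of n]] short_exact_Hom(4) P by blast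
  qed
  then show ?thesis using that by blast
qed

lemma zero_homology_exact:
  assumes H: "zero_object C (homology C f g)" and f: "f \<in> Hom C X Y" and g: "g \<in> Hom C Y Z"
    and gf: "g \<cdot> f = Zero C X Z"
  obtains k u where "is_kernel C g k" "u \<in> Hom C X (Dom C k)" "epi_arr C u" "k \<cdot> u = f"
proof -
  let ?Q = "\<lambda>H. \<exists>k u c. is_kernel C g k \<and> u \<in> Hom C (Dom C f) (Dom C k) \<and>
     k \<cdot> u = f \<and> is_cokernel C u c \<and> H = Cod C c"
  obtain k0 where k0: "is_kernel C g k0" using kernel_exists HomD(1)[OF g] by blast
  obtain u0 where u0: "u0 \<in> Hom C X (Dom C k0)" "k0 \<cdot> u0 = f"
    using is_kernel_factor[OF k0 g f gf] .
  obtain c0 where "is_cokernel C u0 c0" using cokernel_exists HomD(1)[OF u0(1)] by blast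
  then have "?Q (Cod C c0)" using k0 u0 HomD(2)[OF f] by blast
  then have "?Q (homology C f g)" unfolding homology_def by (rule someI)
  then obtain k u c where k: "is_kernel C g k" and u: "u \<in> Hom C X (Dom C k)" "k \<cdot> u = f"
    and c: "is_cokernel C u c" and Hc: "homology C f g = Cod C c"
    using HomD(2)[OF f] by auto
  note c1 = is_cokernelD[OF c u(1)]
  have "epi_arr C u"
  proof (rule epi_arr_zeroI[OF u(1)])
    fix V v assume v: "v \<in> Hom C (Dom C k) V" "v \<cdot> u = Zero C X V"
    have V: "V \<in> Obj C" and Q: "Cod C c \<in> Obj C" using Hom_Obj v(1) c1(1) by auto
    obtain t where t: "t \<in> Hom C (Cod C c) V" "t \<cdot> c = v"
      using is_cokernel_factor[OF c u(1) v] .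
    have "t = Zero C (Cod C c) V"
      using zero_object_unique(2)[OF H[unfolded Hc] V t(1) Zero_in_Hom[OF Q V]] .
    then show "v = Zero C (Dom C k) V" using t(2) Comp_Zero_left[OF V c1(1)] by simp
  qed
  then show ?thesis using that k u by blast
qed

text \<open>Induction along a finite projective resolution, from the zero syzygies at its far end back to \<open>X\<close>.\<close>

lemma finite_proj_dim_induct:
  assumes fin: "proj_dim C X < \<infinity>"
    and zero: "\<And>Z. zero_object C Z \<Longrightarrow> \<Phi> Z"
    and step: "\<And>a b K P Y. short_exact C a b \<Longrightarrow> a \<in> Hom C K P \<Longrightarrow> b \<in> Hom C P Y
      \<Longrightarrow> projective C P \<Longrightarrow> \<Phi> K \<Longrightarrow> \<Phi> Y"
  shows "\<Phi> X"
proof -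
  obtain n R where R: "projective_resolution C X R" and z: "\<And>k. k > n \<Longrightarrow> zero_object C (rterm R k)"
    using fin unfolding proj_dim_def Inf_less_iff by auto
  obtain K k p where K0: "K 0 = X" and k: "\<And>n. k n \<in> Hom C (K (Suc n)) (rterm R n)"
    and p: "\<And>n. p n \<in> Hom C (rterm R n) (K n)" and se: "\<And>n. short_exact C (k n) (p n)"
    using projective_resolution_syzygies[OF R] by metis
  have "\<Phi> (K m)" if "m \<le> Suc n" for m
    using that
  proof (induction rule: inc_induct)
    case base
    show ?case using zero zero_object_quotient[OF z p short_exact_Hom(5)[OF se]] by blast
  next
    case (step m)
    show ?case
      using assms(3)[OF se k p _ step.IH] R by (simp add: projective_resolution_def)
  qed
  then show ?thesis using K0 by (metis le0)
qed

end

context right_exact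
begin

lemma derived_vanishes_syzygies:
  assumes k: "\<And>n. k n \<in> Hom C (K (Suc n)) (P n)" and p: "\<And>n. p n \<in> Hom C (P n) (K n)"
    and se: "\<And>n. short_exact C (k n) (p n)" and P: "\<And>n. projective C (P n)"
    and "LV 0 (K m)"
  shows "LV m (K 0)"
proof -
  have "LV j (K (m - j))" if "j \<le> m" for j
    using that
  proof (induction j)
    case 0 show ?case using assms(5) by simp
  next
    case (Suc j)
    have "K (m - j) = K (Suc (m - Suc j))" using Suc.prems by (simp add: Suc_diff_Suc)
    then have "LV j (K (Suc (m - Suc j)))" using Suc.IH Suc.prems by simp
    then show ?case using derived_vanishes_SucI[OF se k p P] by blast
  qed
  from this[of m] show ?thesis by simp
qed

text \<open>Cut the resolution into \<open>0 \<rightarrow> K\<^sub>n\<^sub>+\<^sub>1 \<rightarrow> P\<^sub>n \<rightarrow> K\<^sub>n \<rightarrow> 0\<close>. By right exactness \<open>T P\<^sub>m\<^sub>+\<^sub>1 \<rightarrow> T K\<^sub>m\<^sub>+\<^sub>1\<close> is the cokernel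
  of the incoming differential. If the homology at \<open>T P\<^sub>m\<^sub>+\<^sub>1\<close> vanishes, then this cokernel also kills
  the kernel of the outgoing differential, and so \<open>T K\<^sub>m\<^sub>+\<^sub>1 \<rightarrow> T P\<^sub>m\<close> is mono. This says
  \<open>L\<^sub>1 T(K\<^sub>m) = 0\<close>, and \<open>K\<^sub>m\<close> is the syzygy of \<open>X\<close> that computes \<open>L\<^sub>m\<^sub>+\<^sub>1 T(X)\<close>.\<close>

lemma derived_vanishes_of_left_derived:
  assumes X: "X \<in> Obj C" and zero: "zero_object D (left_derived C D T (Suc m) X)"
  shows "LV m X"
proof -
  define R where "R = (SOME R. projective_resolution C X R)"
  have "\<exists>R. projective_resolution C X R" using C.projective_resolution_exists[OF enough X] by blast
  then have R: "projective_resolution C X R" unfolding R_def by (rule someI_ex)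
  have P: "\<And>n. projective C (rterm R n)" using R by (simp add: projective_resolution_def)
  obtain K k p where K0: "K 0 = X" and k: "\<And>n. k n \<in> Hom C (K (Suc n)) (rterm R n)"
    and p: "\<And>n. p n \<in> Hom C (rterm R n) (K n)" and se: "\<And>n. short_exact C (k n) (p n)"
    and d: "\<And>n. rdiff R n = k n \<cdot> p (Suc n)"
    using C.projective_resolution_syzygies[OF R] by metis
  have dH: "rdiff R n \<in> Hom C (rterm R (Suc n)) (rterm R n)" for n
    using d C.Comp_in_Hom[OF p k] by metis
  have pk: "p n \<cdot> k n = Zero C (K (Suc n)) (K n)" for n
    using C.short_exact_Hom(3)[OF se[of n]] HomD[OF k[of n]] HomD[OF p[of n]] by simp
  have pd: "p n \<cdot> rdiff R n = Zero C (rterm R (Suc n)) (K n)" for n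
    using C.Comp_assoc[OF p k p] d pk C.Comp_Zero_left[OF _ p] C.Hom_Obj[OF p] by simp
  have Ko: "K n \<in> Obj C" and Ro: "rterm R n \<in> Obj C" for n using C.Hom_Obj[OF p[of n]] by auto
  let ?f = "fmap T (rdiff R (Suc m))" and ?g = "fmap T (rdiff R m)"
  let ?p = "fmap T (p (Suc m))" and ?k = "fmap T (k m)"
  note f = T_Hom[OF dH[of "Suc m"]] and g = T_Hom[OF dH[of m]]
    and Tp = T_Hom[OF p[of "Suc m"]] and Tk = T_Hom[OF k[of m]]
  have g_eq: "?g = ?k \<cdot>\<^bsub>D\<^esub> ?p" using T_Comp[OF p k] d by simp
  have pf: "?p \<cdot>\<^bsub>D\<^esub> ?f = Zero D (fobj T (rterm R (Suc (Suc m)))) (fobj T (K (Suc m)))"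
    using T_Comp[OF dH p] pd preserves_cokernels_Zero[OF T Ro Ko] by simp
  have gf: "?g \<cdot>\<^bsub>D\<^esub> ?f = Zero D (fobj T (rterm R (Suc (Suc m)))) (fobj T (rterm R m))"
    using g_eq D.Comp_assoc[OF f Tp Tk] pf D.Comp_Zero_right[OF T_Obj[OF Ro] Tk] by simp
  have hz: "zero_object D (homology D ?f ?g)"
    using zero by (simp add: left_derived_def R_def[symmetric] Let_def)
  obtain h u where h: "is_kernel D ?g h" and u: "u \<in> Hom D (fobj T (rterm R (Suc (Suc m)))) (Dom D h)"
    "epi_arr D u" "h \<cdot>\<^bsub>D\<^esub> u = ?f"
    using D.zero_homology_exact[OF hz f g gf] .
  note hH = D.is_kernelD(1)[OF h g]
  have ph: "?p \<cdot>\<^bsub>D\<^esub> h = Zero D (Dom D h) (fobj T (K (Suc m)))"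
    using D.epi_arr_zeroD[OF u(2,1) D.Comp_in_Hom[OF hH Tp]] D.Comp_assoc[OF u(1) hH Tp] u(3) pf
    by simp
  have Tpe: "epi_arr D ?p" using preserves_cokernels_epi[OF T C.short_exact_Hom(5)[OF se]] .
  have "mono_arr D ?k"
  proof (rule D.mono_arr_zeroI[OF Tk])
    fix W v assume v: "v \<in> Hom D W (fobj T (K (Suc m)))"
      and kv: "?k \<cdot>\<^bsub>D\<^esub> v = Zero D W (fobj T (rterm R m))"
    obtain V w q where pb: "is_pullback D ?p v V w q" using D.pullback_exists[OF Tp v] .
    note D' = is_pullbackD[OF pb Tp v]
    have "?g \<cdot>\<^bsub>D\<^esub> w = Zero D V (fobj T (rterm R m))"
      using g_eq D.Comp_assoc[OF D'(1) Tp Tk] D'(3) D.Comp_assoc[OF D'(2) v Tk] kv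
        D.Comp_Zero_left[OF T_Obj[OF Ro] D'(2)] by simp
    then obtain t where t: "t \<in> Hom D V (Dom D h)" "h \<cdot>\<^bsub>D\<^esub> t = w"
      using D.is_kernel_factor[OF h g D'(1)] by metis
    have "v \<cdot>\<^bsub>D\<^esub> q = Zero D V (fobj T (K (Suc m)))"
      using D'(3) t(2) D.Comp_assoc[OF t(1) hH Tp] ph D.Comp_Zero_left[OF T_Obj[OF Ko] t(1)] by simp
    then show "v = Zero D W (fobj T (K (Suc m)))"
      using D.epi_arr_zeroD[OF D.is_pullback_epi[OF pb Tp Tpe v] D'(2) v] by simp
  qed
  then have "LV 0 (K m)" using derived_vanishes_0I[OF se k p P] by blast
  then show ?thesis using derived_vanishes_syzygies[of k K "rterm R" p m, OF k p se P] K0 by simp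
qed

lemma derived_vanishes_of_exact:
  assumes "\<And>f. mono_arr C f \<Longrightarrow> mono_arr D (fmap T f)"
  shows "X \<in> Obj C \<Longrightarrow> LV n X"
proof (induction n arbitrary: X)
  case 0 then show ?case using assms C.short_exact_Hom(4) by auto
next
  case (Suc n)
  have "Dom C k \<in> Obj C" if "short_exact C k g" for k g
    using C.short_exact_Hom(1)[OF that] C.Hom_Obj by blast
  then show ?case using Suc.IH by auto
qed

text \<open>Shift along the cocycle objects \<open>Z j\<close>, downwards from the degree \<open>N\<close> in which everything vanishes.\<close>

lemma acyclic_map_complex:
  assumes E: "acyclic_complex C E" and terms: "\<And>n j. LV n (cobj E j)"
    and bound: "\<And>n X. n \<ge> N \<Longrightarrow> X \<in> Obj C \<Longrightarrow> LV n X"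
  shows "acyclic_complex D (map_complex T E)"
proof -
  let ?E = "cobj E" and ?d = "cdiff E"
  have d: "?d j \<in> Hom C (?E j) (?E (j + 1))" for j
    using E by (simp add: acyclic_complex_def is_complex_def)
  have d': "?d (j - 1) \<in> Hom C (?E (j - 1)) (?E j)" for j using d[of "j - 1"] by simp
  have ex: "exact_at C (?d (j - 1)) (?d j)" for j using E by (simp add: acyclic_complex_def)
  define k where "k j = (SOME k. is_kernel C (?d j) k)" for j
  have k: "is_kernel C (?d j) (k j)" for j
    unfolding k_def using someI_ex[OF C.kernel_exists[OF HomD(1)[OF d]]] .
  define Z where "Z j = Dom C (k j)" for j
  have kH: "k j \<in> Hom C (Z j) (?E j)" for j using C.is_kernelD(1)[OF k d] Z_def by simp
  have "\<exists>p. p \<in> Hom C (?E (j - 1)) (Z j) \<and> epi_arr C p \<and> k j \<cdot> p = ?d (j - 1)" for j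
    using C.exact_at_cover[OF ex d' d k] Z_def by metis
  then obtain p where p: "\<And>j. p j \<in> Hom C (?E (j - 1)) (Z j)" "\<And>j. epi_arr C (p j)"
    "\<And>j. k j \<cdot> p j = ?d (j - 1)" by metis
  define q where "q j = p (j + 1)" for j
  have q: "q j \<in> Hom C (?E j) (Z (j + 1))" "epi_arr C (q j)" "?d j = k (j + 1) \<cdot> q j" for j
    using p[of "j + 1"] by (auto simp: q_def)
  have se: "short_exact C (k j) (q j)" for j
    using C.short_exact_of_epi[OF q(2)] C.is_kernel_of_postcomp_mono[OF _ q(1) kH C.is_kernel_mono[OF k]]
      k[of j] q(3)[of j] by simp
  have Zo: "Z j \<in> Obj C" for j using C.Hom_Obj[OF kH] by blast
  have "\<forall>j. LV n (Z j)" if "n \<le> N" for n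
    using that
  proof (induction rule: inc_induct)
    case base show ?case using bound Zo by blast
  next
    case (step n) then show ?case using derived_vanishes_shift[OF se kH q(1)] terms by blast
  qed
  then have LVZ: "LV 0 (Z j)" for j by blast
  have mono: "mono_arr D (fmap T (k j))" for j
    using derived_vanishes_0D[OF LVZ se q(1)] .
  have Tse: "short_exact D (fmap T (k j)) (fmap T (q j))" for j
    using preserves_cokernels_short_exact[OF T se mono] .
  have Td: "fmap T (?d j) = fmap T (k (j + 1)) \<cdot>\<^bsub>D\<^esub> fmap T (q j)" for j
    using T_Comp[OF q(1) kH] q(3) by simp
  have "exact_at D (fmap T (?d (j - 1))) (fmap T (?d j))" for j
  proof -
    have q': "q (j - 1) \<in> Hom C (?E (j - 1)) (Z j)" using q(1)[of "j - 1"] by simp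
    have "fmap T (?d (j - 1)) = fmap T (k j) \<cdot>\<^bsub>D\<^esub> fmap T (q (j - 1))" using Td[of "j - 1"] by simp
    then show ?thesis
      unfolding Td[of j]
      using D.exact_at_splice[OF Tse T_Hom[OF kH] T_Hom[OF q(1)] T_Hom[OF q']
          preserves_cokernels_epi[OF T q(2)] T_Hom[OF kH] mono] by simp
  qed
  moreover have "is_complex D (map_complex T E)"
    unfolding is_complex_def map_complex_def cochain.simps
  proof (intro allI conjI)
    fix j
    have dd: "?d (j + 1) \<cdot> ?d j = Zero C (?E j) (?E (j + 2))" and Eo: "\<And>j. ?E j \<in> Obj C"
      using E by (auto simp: acyclic_complex_def is_complex_def)
    show "fobj T (?E j) \<in> Obj D" using T_Obj[OF Eo] .
    show "fmap T (?d j) \<in> Hom D (fobj T (?E j)) (fobj T (?E (j + 1)))" using T_Hom[OF d] .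
    show "fmap T (?d (j + 1)) \<cdot>\<^bsub>D\<^esub> fmap T (?d j) = Zero D (fobj T (?E j)) (fobj T (?E (j + 2)))"
      unfolding T_Comp[OF d d, symmetric] dd using preserves_cokernels_Zero[OF T Eo Eo] .
  qed
  ultimately show ?thesis by (simp add: acyclic_complex_def map_complex_def)
qed

end

section \<open>Acyclic Hom complexes\<close>

context abelian_category
begin

lemma hom_acyclicD:
  assumes "hom_acyclic C P Y" "h \<in> Hom C (cobj P n) Y"
    "h \<cdot> cdiff P (n - 1) = Zero C (cobj P (n - 1)) Y"
  obtains g where "g \<in> Hom C (cobj P (n + 1)) Y" "g \<cdot> cdiff P n = h"
proof -
  have "h \<in> kernel (hom_group C (cobj P n) Y) (hom_group C (cobj P (n - 1)) Y)
       (\<lambda>g. g \<cdot> cdiff P (n - 1))"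
    using assms(2,3) by (simp add: kernel_def hom_group_def)
  then have "h \<in> (\<lambda>g. g \<cdot> cdiff P n) ` Hom C (cobj P (n + 1)) Y"
    using assms(1) by (simp add: hom_acyclic_def hom_group_def)
  then show ?thesis using that by blast
qed

lemma hom_acyclicI:
  assumes P: "is_complex C P" and Y: "Y \<in> Obj C"
    and ex: "\<And>n h. h \<in> Hom C (cobj P n) Y \<Longrightarrow> h \<cdot> cdiff P (n - 1) = Zero C (cobj P (n - 1)) Y
      \<Longrightarrow> \<exists>g \<in> Hom C (cobj P (n + 1)) Y. g \<cdot> cdiff P n = h"
  shows "hom_acyclic C P Y"
  unfolding hom_acyclic_def
proof (intro allI equalityI subsetI)
  fix n h assume "h \<in> (\<lambda>g. g \<cdot> cdiff P n) ` carrier (hom_group C (cobj P (n + 1)) Y)"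
  then obtain g where g: "g \<in> Hom C (cobj P (n + 1)) Y" "h = g \<cdot> cdiff P n"
    by (auto simp: hom_group_def)
  have d: "cdiff P n \<in> Hom C (cobj P n) (cobj P (n + 1))"
    and d': "cdiff P (n - 1) \<in> Hom C (cobj P (n - 1)) (cobj P n)"
    and dd: "cdiff P n \<cdot> cdiff P (n - 1) = Zero C (cobj P (n - 1)) (cobj P (n + 1))"
    using P[unfolded is_complex_def, rule_format, of n]
      P[unfolded is_complex_def, rule_format, of "n - 1"] by (auto simp: add.commute)
  have "h \<cdot> cdiff P (n - 1) = Zero C (cobj P (n - 1)) Y"
    using g(2) Comp_assoc[OF d' d g(1)] dd Comp_Zero_right[OF _ g(1)] Hom_Obj[OF d'] by simp
  then show "h \<in> kernel (hom_group C (cobj P n) Y) (hom_group C (cobj P (n - 1)) Y)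
      (\<lambda>g. g \<cdot> cdiff P (n - 1))"
    using Comp_in_Hom[OF d g(1)] g(2) by (simp add: kernel_def hom_group_def)
next
  fix n h assume "h \<in> kernel (hom_group C (cobj P n) Y) (hom_group C (cobj P (n - 1)) Y)
      (\<lambda>g. g \<cdot> cdiff P (n - 1))"
  then show "h \<in> (\<lambda>g. g \<cdot> cdiff P n) ` carrier (hom_group C (cobj P (n + 1)) Y)"
    using ex[of h n] by (auto simp: kernel_def hom_group_def)
qed

lemma hom_acyclic_zero_object:
  assumes P: "is_complex C P" and Z: "zero_object C Z"
  shows "hom_acyclic C P Z"
proof (rule hom_acyclicI[OF P])
  show Zo: "Z \<in> Obj C" using Z by (simp add: zero_object_def)
  fix n h assume h: "h \<in> Hom C (cobj P n) Z"
  have d: "cdiff P n \<in> Hom C (cobj P n) (cobj P (n + 1))" using P by (simp add: is_complex_def)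
  let ?z = "Zero C (cobj P (n + 1)) Z"
  have z: "?z \<in> Hom C (cobj P (n + 1)) Z" using Zero_in_Hom[OF _ Zo] Hom_Obj[OF d] by blast
  have "?z \<cdot> cdiff P n = h"
    using zero_object_unique(1)[OF Z _ Comp_in_Hom[OF d z] h] Hom_Obj[OF d] by blast
  then show "\<exists>g \<in> Hom C (cobj P (n + 1)) Z. g \<cdot> cdiff P n = h" using z by blast
qed

text \<open>The arrow \<open>h\<close> lifts to \<open>Y\<close> since the terms of \<open>P\<close> are projective. Acyclicity of \<open>Hom(P, X)\<close> corrects
  the lift to a cocycle, which is a coboundary by acyclicity of \<open>Hom(P, Y)\<close>.\<close>

lemma hom_acyclic_quotient:
  assumes P: "is_complex C P" and proj: "\<And>n. projective C (cobj P n)"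
    and ab: "short_exact C a b" and a: "a \<in> Hom C X Y" and b: "b \<in> Hom C Y Z"
    and X: "hom_acyclic C P X" and Y: "hom_acyclic C P Y"
  shows "hom_acyclic C P Z"
proof (rule hom_acyclicI[OF P])
  show "Z \<in> Obj C" using Hom_Obj[OF b] by simp
  fix n h assume h: "h \<in> Hom C (cobj P n) Z" "h \<cdot> cdiff P (n - 1) = Zero C (cobj P (n - 1)) Z"
  let ?d = "cdiff P"
  have d: "?d m \<in> Hom C (cobj P m) (cobj P (m + 1))" for m
    using P by (simp add: is_complex_def)
  have d': "?d (m - 1) \<in> Hom C (cobj P (m - 1)) (cobj P m)" for m using d[of "m - 1"] by simp
  have dd: "?d m \<cdot> ?d (m - 1) = Zero C (cobj P (m - 1)) (cobj P (m + 1))" for m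
    using P[unfolded is_complex_def, rule_format, of "m - 1"] by (auto simp: add.commute)
  have Po: "cobj P m \<in> Obj C" for m using Hom_Obj[OF d] by blast
  note ma = short_exact_Hom(4)[OF ab] and eb = short_exact_Hom(5)[OF ab]
  have ba: "b \<cdot> a = Zero C X Z" using short_exact_Hom(3)[OF ab] HomD[OF a] HomD[OF b] by simp
  obtain h2 where h2: "h2 \<in> Hom C (cobj P n) Y" "b \<cdot> h2 = h"
    using projective_lift[OF proj eb b h(1)] .
  note h2d = Comp_in_Hom[OF d' h2(1)]
  \<comment> \<open>the coboundary of the lift \<open>h2\<close> comes from a cocycle with values in \<open>X\<close>\<close>
  have "b \<cdot> (h2 \<cdot> ?d (n - 1)) = Zero C (cobj P (n - 1)) Z"
    using Comp_assoc[OF d' h2(1) b] h2(2) h(2) by simp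
  then obtain x where x: "x \<in> Hom C (cobj P (n - 1)) X" "a \<cdot> x = h2 \<cdot> ?d (n - 1)"
    using short_exact_factor[OF ab b h2d] HomD(2)[OF a] by metis
  have "a \<cdot> (x \<cdot> ?d (n - 1 - 1)) = h2 \<cdot> (?d (n - 1) \<cdot> ?d (n - 1 - 1))"
    using Comp_assoc[OF d' x(1) a] x(2) Comp_assoc[OF d'[of "n - 1"] d' h2(1)] by simp
  then have "a \<cdot> (x \<cdot> ?d (n - 1 - 1)) = Zero C (cobj P (n - 1 - 1)) Y"
    using dd[of "n - 1"] Comp_Zero_right[OF Po h2(1)] by simp
  then have "x \<cdot> ?d (n - 1 - 1) = Zero C (cobj P (n - 1 - 1)) X"
    using mono_arr_zeroD[OF ma a Comp_in_Hom[OF d' x(1)]] by simp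
  then obtain y where "y \<in> Hom C (cobj P (n - 1 + 1)) X" "y \<cdot> ?d (n - 1) = x"
    using hom_acyclicD[OF X x(1)] by metis
  then have y: "y \<in> Hom C (cobj P n) X" "y \<cdot> ?d (n - 1) = x" by auto
  note ay = Comp_in_Hom[OF y(1) a]
  obtain t where t: "t \<in> Hom C (cobj P n) Y" "Add C t (a \<cdot> y) = h2"
    using difference_exists[OF h2(1) ay] .
  have ayd: "(a \<cdot> y) \<cdot> ?d (n - 1) = h2 \<cdot> ?d (n - 1)"
    using Comp_assoc[OF d' y(1) a] y(2) x(2) by simp
  have "Add C (t \<cdot> ?d (n - 1)) (h2 \<cdot> ?d (n - 1)) = h2 \<cdot> ?d (n - 1)"
    using Comp_Add_left[OF d' t(1) ay] t(2) ayd by simp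
  then have "t \<cdot> ?d (n - 1) = Zero C (cobj P (n - 1)) Y"
    using Add_right_cancel[OF Comp_in_Hom[OF d' t(1)] Zero_in_Hom h2d] Add_Zero_left[OF h2d]
      Hom_Obj[OF h2d] by simp
  then obtain g where g: "g \<in> Hom C (cobj P (n + 1)) Y" "g \<cdot> ?d n = t"
    using hom_acyclicD[OF Y t(1)] by metis
  have "b \<cdot> (a \<cdot> y) = Zero C (cobj P n) Z"
    using Comp_assoc[OF y(1) a b] ba Comp_Zero_left[OF _ y(1)] Hom_Obj[OF b] by simp
  then have "b \<cdot> t = h"
    using Comp_Add_right[OF t(1) ay b] t(2) h2(2) Add_Zero_right[OF Comp_in_Hom[OF t(1) b]] by simp
  then have "(b \<cdot> g) \<cdot> ?d n = h" using Comp_assoc[OF d g(1) b] g(2) by simp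
  then show "\<exists>g \<in> Hom C (cobj P (n + 1)) Z. g \<cdot> ?d n = h"
    using Comp_in_Hom[OF g(1) b] by blast
qed

end

section \<open>Functors preserving cokernels\<close>

lemma comp_ftor_simps [simp]:
  "fobj (S \<circ>\<^sub>F T) X = fobj S (fobj T X)" "fmap (S \<circ>\<^sub>F T) f = fmap S (fmap T f)"
  by (simp_all add: comp_ftor_def)

lemma id_ftor_simps [simp]: "fobj id_ftor X = X" "fmap id_ftor f = f"
  by (simp_all add: id_ftor_def)

lemma comp_ftor_id: "T \<circ>\<^sub>F id_ftor = T"
  by (simp add: comp_ftor_def)

lemma pow_ftor_Suc_right:
  "fobj (pow_ftor T (Suc j)) X = fobj (pow_ftor T j) (fobj T X)"
  by (induction j) auto

lemma (in category) is_functor_comp_ftor: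
  assumes "is_functor C D T" "is_functor D E S"
  shows "is_functor C E (S \<circ>\<^sub>F T)"
  using assms unfolding is_functor_def comp_ftor_simps by metis

lemma preserves_cokernels_comp:
  assumes "category C" "preserves_cokernels C D T" "preserves_cokernels D E S"
  shows "preserves_cokernels C E (S \<circ>\<^sub>F T)"
  using assms category.is_functor_comp_ftor unfolding preserves_cokernels_def by fastforce

lemma preserves_cokernels_id: "preserves_cokernels C C id_ftor"
  by (simp add: preserves_cokernels_def is_functor_def)

lemma preserves_cokernels_pow:
  assumes "category C" "preserves_cokernels C C T"
  shows "preserves_cokernels C C (pow_ftor T j)"
  using preserves_cokernels_comp[OF assms(1) _ assms(2)] preserves_cokernels_id
  by (induction j) auto

context two_abelian
begin

text \<open>A factorization through \<open>H Q\<close> restricts along \<open>j Q\<close> to one through \<open>S Q\<close>. This is applied to \<open>F\<close>,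
  which is a natural direct summand of \<open>e l e i\<close>, and to \<open>e i\<close>, which is naturally isomorphic to
  the identity.\<close>

lemma preserves_cokernels_retract:
  assumes H: "preserves_cokernels C D H" and S: "is_functor C D S"
    and j: "natural_trans C D S H j" and \<rho>: "natural_trans C D H S \<rho>"
    and retr: "\<And>X. X \<in> Obj C \<Longrightarrow> \<rho> X \<cdot>\<^bsub>D\<^esub> j X = Ident D (fobj S X)"
  shows "preserves_cokernels C D S"
  unfolding preserves_cokernels_def
proof (intro conjI allI impI S)
  have HF: "is_functor C D H" using H by (simp add: preserves_cokernels_def)
  fix f c assume fc: "is_cokernel C f c"
  define X Y Q where "X = Dom C f" and "Y = Cod C f" and "Q = Cod C c"
  have f: "f \<in> Hom C X Y" using fc by (simp add: is_cokernel_def X_def Y_def Hom_def)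
  have c: "c \<in> Hom C Y Q" and cf: "c \<cdot> f = Zero C X Q"
    using C.is_cokernelD[OF fc f] Q_def by auto
  have X: "X \<in> Obj C" and Y: "Y \<in> Obj C" and Q: "Q \<in> Obj C" using C.Hom_Obj f c by auto
  have jH: "j Z \<in> Hom D (fobj S Z) (fobj H Z)" and \<rho>H: "\<rho> Z \<in> Hom D (fobj H Z) (fobj S Z)"
    if "Z \<in> Obj C" for Z using j \<rho> that by (auto simp: natural_trans_def)
  have jn: "j Z' \<cdot>\<^bsub>D\<^esub> fmap S g = fmap H g \<cdot>\<^bsub>D\<^esub> j Z"
    and \<rho>n: "\<rho> Z' \<cdot>\<^bsub>D\<^esub> fmap H g = fmap S g \<cdot>\<^bsub>D\<^esub> \<rho> Z" if "g \<in> Hom C Z Z'" for g Z Z'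
    using j \<rho> that C.Hom_Obj[OF that] by (auto simp: natural_trans_def)
  note Sf = C.is_functor_Hom[OF S f] and Sc = C.is_functor_Hom[OF S c]
    and Hf = C.is_functor_Hom[OF HF f] and Hc = C.is_functor_Hom[OF HF c]
  have Hcok: "is_cokernel D (fmap H f) (fmap H c)" using H fc by (simp add: preserves_cokernels_def)
  show "is_cokernel D (fmap S f) (fmap S c)"
  proof (rule D.is_cokernelI[OF Sf Sc])
    have "\<rho> Q \<cdot>\<^bsub>D\<^esub> fmap H c = fmap S c \<cdot>\<^bsub>D\<^esub> \<rho> Y" using \<rho>n[OF c] .
    moreover have "epi_arr D (\<rho> Q)"
      using D.epi_arr_of_section[OF jH \<rho>H retr] Q by blast
    ultimately have "epi_arr D (fmap S c \<cdot>\<^bsub>D\<^esub> \<rho> Y)"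
      using D.epi_arr_Comp[OF Hc D.is_cokernel_epi[OF Hcok] \<rho>H[OF Q]] by simp
    then show "epi_arr D (fmap S c)" using D.epi_arr_of_Comp[OF \<rho>H[OF Y] Sc] by simp
    note So = is_functor_Obj[OF S] and Ho = is_functor_Obj[OF HF]
    have "j Q \<cdot>\<^bsub>D\<^esub> fmap S (c \<cdot> f) = fmap H (Zero C X Q) \<cdot>\<^bsub>D\<^esub> j X"
      using jn[OF C.Comp_in_Hom[OF f c]] cf by simp
    also have "\<dots> = Zero D (fobj S X) (fobj H Q)"
      using preserves_cokernels_Zero[OF H X Q] D.Comp_Zero_left[OF Ho[OF Q] jH[OF X]] by simp
    finally have "j Q \<cdot>\<^bsub>D\<^esub> fmap S (c \<cdot> f) = Zero D (fobj S X) (fobj H Q)" .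
    moreover have "mono_arr D (j Q)"
      using D.mono_arr_of_retraction[OF jH \<rho>H retr] Q by blast
    ultimately have "fmap S (c \<cdot> f) = Zero D (fobj S X) (fobj S Q)"
      using D.mono_arr_zeroD[OF _ jH[OF Q] C.is_functor_Hom[OF S C.Comp_in_Hom[OF f c]]] by simp
    then show "fmap S c \<cdot>\<^bsub>D\<^esub> fmap S f = Zero D (fobj S X) (fobj S Q)"
      using C.is_functor_Comp[OF S f c] by simp
    fix Z h assume h: "h \<in> Hom D (fobj S Y) Z" "h \<cdot>\<^bsub>D\<^esub> fmap S f = Zero D (fobj S X) Z"
    have Z: "Z \<in> Obj D" using D.Hom_Obj[OF h(1)] by simp
    note h\<rho> = D.Comp_in_Hom[OF \<rho>H[OF Y] h(1)]
    have "(h \<cdot>\<^bsub>D\<^esub> \<rho> Y) \<cdot>\<^bsub>D\<^esub> fmap H f = (h \<cdot>\<^bsub>D\<^esub> fmap S f) \<cdot>\<^bsub>D\<^esub> \<rho> X"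
      using D.Comp_assoc[OF Hf \<rho>H[OF Y] h(1)] \<rho>n[OF f] D.Comp_assoc[OF \<rho>H[OF X] Sf h(1)] by simp
    then have "(h \<cdot>\<^bsub>D\<^esub> \<rho> Y) \<cdot>\<^bsub>D\<^esub> fmap H f = Zero D (fobj H X) Z"
      using h(2) D.Comp_Zero_left[OF Z \<rho>H[OF X]] by simp
    then obtain u where u: "u \<in> Hom D (fobj H Q) Z" "u \<cdot>\<^bsub>D\<^esub> fmap H c = h \<cdot>\<^bsub>D\<^esub> \<rho> Y"
      using D.is_cokernel_factor[OF Hcok Hf h\<rho>] HomD(3)[OF Hc] by metis
    have "(u \<cdot>\<^bsub>D\<^esub> j Q) \<cdot>\<^bsub>D\<^esub> fmap S c = (u \<cdot>\<^bsub>D\<^esub> fmap H c) \<cdot>\<^bsub>D\<^esub> j Y"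
      using D.Comp_assoc[OF Sc jH[OF Q] u(1)] jn[OF c] D.Comp_assoc[OF jH[OF Y] Hc u(1)] by simp
    also have "\<dots> = h"
      using u(2) D.Comp_assoc[OF jH[OF Y] \<rho>H[OF Y] h(1)] retr[OF Y] D.Comp_Ident_right[OF h(1)]
      by simp
    finally show "\<exists>u \<in> Hom D (fobj S Q) Z. u \<cdot>\<^bsub>D\<^esub> fmap S c = h"
      using D.Comp_in_Hom[OF jH[OF Q] u(1)] by blast
  qed
qed

lemma exact_functor_mono:
  assumes T: "exact_functor C D T" and f: "mono_arr C f"
  shows "mono_arr D (fmap T f)"
proof -
  obtain c where c: "is_cokernel C f c" using C.cokernel_exists f unfolding mono_arr_def by blast
  show ?thesis
    using T C.short_exact_of_mono[OF f c] D.short_exact_Hom(4) unfolding exact_functor_def by blast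
qed

text \<open>A cokernel of \<open>f\<close> is a cokernel of the mono part of \<open>f\<close>, hence the end of a short exact sequence; and
  epimorphisms are preserved, being ends of short exact sequences as well.\<close>

lemma exact_functor_preserves_cokernels:
  assumes T: "exact_functor C D T"
  shows "preserves_cokernels C D T"
proof -
  have F: "is_functor C D T" using T by (simp add: exact_functor_def additive_functor_def)
  have "is_cokernel D (fmap T f) (fmap T c)" if fc: "is_cokernel C f c" for f c
  proof -
    define X Y where "X = Dom C f" and "Y = Cod C f"
    have f: "f \<in> Hom C X Y" using fc by (simp add: is_cokernel_def X_def Y_def Hom_def)
    obtain I p m where p: "p \<in> Hom C X I" "epi_arr C p" and m: "m \<in> Hom C I Y" "mono_arr C m"
      and fmp: "f = m \<cdot> p"
      using C.image_factorization[OF f] .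
    have "short_exact C m c"
      using C.short_exact_of_mono[OF m(2) C.is_cokernel_of_precomp_epi[OF _ m(1) p]] fc fmp by simp
    then have Tc: "is_cokernel D (fmap T m) (fmap T c)"
      using T by (simp add: exact_functor_def short_exact_def)
    obtain k where "short_exact C k p" using C.epi_short_exact[OF p(2)] .
    then have "epi_arr D (fmap T p)" using T D.short_exact_Hom(5) unfolding exact_functor_def by blast
    then show ?thesis
      using D.is_cokernel_precomp_epi[OF Tc C.is_functor_Hom[OF F m(1)] C.is_functor_Hom[OF F p(1)]]
        C.is_functor_Comp[OF F p(1) m(1)] fmp by simp
  qed
  then show ?thesis using F by (simp add: preserves_cokernels_def)
qed

lemma faithful_functor_reflects_mono:
  assumes T: "faithful_functor C D T" and f: "f \<in> Hom C X Y" and "mono_arr D (fmap T f)"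
  shows "mono_arr C f"
proof (rule C.mono_arrI[OF f])
  have F: "is_functor C D T" using T by (simp add: faithful_functor_def)
  fix W u v assume uv: "u \<in> Hom C W X" "v \<in> Hom C W X" "f \<cdot> u = f \<cdot> v"
  have "fmap T f \<cdot>\<^bsub>D\<^esub> fmap T u = fmap T f \<cdot>\<^bsub>D\<^esub> fmap T v"
    using C.is_functor_Comp[OF F uv(1) f] C.is_functor_Comp[OF F uv(2) f] uv(3) by simp
  then have "fmap T u = fmap T v"
    using D.mono_arrD[OF assms(3)] C.is_functor_Hom[OF F] f uv by blast
  then show "u = v"
    using T uv(1,2) C.Hom_Obj[OF uv(1)] unfolding faithful_functor_def inj_on_def by blast
qed

lemma faithful_functor_reflects_epi:
  assumes T: "faithful_functor C D T" and f: "f \<in> Hom C X Y" and "epi_arr D (fmap T f)"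
  shows "epi_arr C f"
proof (rule C.epi_arrI[OF f])
  have F: "is_functor C D T" using T by (simp add: faithful_functor_def)
  fix W u v assume uv: "u \<in> Hom C Y W" "v \<in> Hom C Y W" "u \<cdot> f = v \<cdot> f"
  have "fmap T u \<cdot>\<^bsub>D\<^esub> fmap T f = fmap T v \<cdot>\<^bsub>D\<^esub> fmap T f"
    using C.is_functor_Comp[OF F f uv(1)] C.is_functor_Comp[OF F f uv(2)] uv(3) by simp
  then have "fmap T u = fmap T v"
    using D.epi_arrD[OF assms(3)] C.is_functor_Hom[OF F] f uv by blast
  then show "u = v"
    using T uv(1,2) C.Hom_Obj[OF uv(1)] unfolding faithful_functor_def inj_on_def by blast
qed

lemma preserves_cokernels_zero_object:
  assumes T: "preserves_cokernels C D T" and Z: "zero_object C Z"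
  shows "zero_object D (fobj T Z)"
proof (rule D.zero_objectI)
  have F: "is_functor C D T" using T by (simp add: preserves_cokernels_def)
  have Zo: "Z \<in> Obj C" using Z by (simp add: zero_object_def)
  show "fobj T Z \<in> Obj D" using is_functor_Obj[OF F Zo] .
  have "Ident C Z = Zero C Z Z"
    using zero_object_unique(1)[OF Z Zo] C.Ident_in_Hom[OF Zo] C.Zero_in_Hom[OF Zo Zo] by blast
  then show "Ident D (fobj T Z) = Zero D (fobj T Z) (fobj T Z)"
    using is_functor_Ident[OF F Zo] preserves_cokernels_Zero[OF T Zo Zo] by simp
qed

end

section \<open>Left adjoints\<close>

locale adjoint_abelian = two_abelian C D
  for C :: "('o, 'm) abcat" (structure) and D :: "('p, 'n) abcat" +
  fixes L :: "('o, 'm, 'p, 'n) ftor" and R :: "('p, 'n, 'o, 'm) ftor" and \<eta> \<epsilon>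
  assumes adj: "adjunction C D L R \<eta> \<epsilon>"
    and R_Zero: "X \<in> Obj D \<Longrightarrow> Y \<in> Obj D
      \<Longrightarrow> fmap R (Zero D X Y) = Zero C (fobj R X) (fobj R Y)"
begin

lemma L: "is_functor C D L" and R: "is_functor D C R"
  using adj by (auto simp: adjunction_def)

lemmas L_Hom = C.is_functor_Hom[OF L] and R_Hom = D.is_functor_Hom[OF R]
  and L_Obj = is_functor_Obj[OF L] and R_Obj = is_functor_Obj[OF R]
  and L_Comp = C.is_functor_Comp[OF L] and R_Comp = D.is_functor_Comp[OF R]

lemma unit_Hom: "X \<in> Obj C \<Longrightarrow> \<eta> X \<in> Hom C X (fobj R (fobj L X))"
  using adj by (simp add: adjunction_def natural_trans_def)

lemma counit_Hom: "Y \<in> Obj D \<Longrightarrow> \<epsilon> Y \<in> Hom D (fobj L (fobj R Y)) Y"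
  using adj by (simp add: adjunction_def natural_trans_def)

lemma unit_natural: "f \<in> Hom C X Y \<Longrightarrow> \<eta> Y \<cdot> f = fmap R (fmap L f) \<cdot> \<eta> X"
  using adj C.Hom_Obj by (simp add: adjunction_def natural_trans_def)

lemma counit_natural:
  "f \<in> Hom D X Y \<Longrightarrow> \<epsilon> Y \<cdot>\<^bsub>D\<^esub> fmap L (fmap R f) = f \<cdot>\<^bsub>D\<^esub> \<epsilon> X"
  using adj D.Hom_Obj by (simp add: adjunction_def natural_trans_def)

lemma triangle_L: "X \<in> Obj C \<Longrightarrow> \<epsilon> (fobj L X) \<cdot>\<^bsub>D\<^esub> fmap L (\<eta> X) = Ident D (fobj L X)"
  using adj by (simp add: adjunction_def)

lemma triangle_R: "Y \<in> Obj D \<Longrightarrow> fmap R (\<epsilon> Y) \<cdot> \<eta> (fobj R Y) = Ident C (fobj R Y)"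
  using adj by (simp add: adjunction_def)

lemma transpose_back:
  assumes X: "X \<in> Obj C" and g: "g \<in> Hom D (fobj L X) Z"
  shows "\<epsilon> Z \<cdot>\<^bsub>D\<^esub> fmap L (fmap R g \<cdot> \<eta> X) = g"
proof -
  have Z: "Z \<in> Obj D" using D.Hom_Obj[OF g] by simp
  note LRg = L_Hom[OF R_Hom[OF g]] and L\<eta> = L_Hom[OF unit_Hom[OF X]]
  have "\<epsilon> Z \<cdot>\<^bsub>D\<^esub> fmap L (fmap R g \<cdot> \<eta> X) = (\<epsilon> Z \<cdot>\<^bsub>D\<^esub> fmap L (fmap R g)) \<cdot>\<^bsub>D\<^esub> fmap L (\<eta> X)"
    using L_Comp[OF unit_Hom[OF X] R_Hom[OF g]] D.Comp_assoc[OF L\<eta> LRg counit_Hom[OF Z]] by simp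
  also have "\<dots> = g \<cdot>\<^bsub>D\<^esub> (\<epsilon> (fobj L X) \<cdot>\<^bsub>D\<^esub> fmap L (\<eta> X))"
    using counit_natural[OF g] D.Comp_assoc[OF L\<eta> counit_Hom[OF L_Obj[OF X]] g] by simp
  finally show ?thesis using triangle_L[OF X] D.Comp_Ident_right[OF g] by simp
qed

lemma transpose_inj:
  assumes "X \<in> Obj C" "g \<in> Hom D (fobj L X) Z" "g' \<in> Hom D (fobj L X) Z"
    "fmap R g \<cdot> \<eta> X = fmap R g' \<cdot> \<eta> X"
  shows "g = g'"
  using transpose_back assms by metis

lemma transpose_forth:
  assumes f: "f \<in> Hom C X (fobj R Z)" and Z: "Z \<in> Obj D"
  shows "fmap R (\<epsilon> Z \<cdot>\<^bsub>D\<^esub> fmap L f) \<cdot> \<eta> X = f"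
proof -
  have X: "X \<in> Obj C" using C.Hom_Obj[OF f] by simp
  note Re = R_Hom[OF counit_Hom[OF Z]]
  have "fmap R (\<epsilon> Z \<cdot>\<^bsub>D\<^esub> fmap L f) \<cdot> \<eta> X = fmap R (\<epsilon> Z) \<cdot> (\<eta> (fobj R Z) \<cdot> f)"
    using R_Comp[OF L_Hom[OF f] counit_Hom[OF Z]] unit_natural[OF f]
      C.Comp_assoc[OF unit_Hom[OF X] R_Hom[OF L_Hom[OF f]] Re] by simp
  also have "\<dots> = f"
    using C.Comp_assoc[OF f unit_Hom[OF R_Obj[OF Z]] Re] triangle_R[OF Z] C.Comp_Ident_left[OF f]
    by simp
  finally show ?thesis .
qed

text \<open>Arrows out of \<open>L Y\<close> are transposed to arrows out of \<open>Y\<close>, where the cokernel property of \<open>c\<close> applies.\<close>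

lemma left_adjoint_preserves_cokernels: "preserves_cokernels C D L"
  unfolding preserves_cokernels_def
proof (intro conjI allI impI L)
  fix f c assume fc: "is_cokernel C f c"
  define X Y Q where "X = Dom C f" and "Y = Cod C f" and "Q = Cod C c"
  have f: "f \<in> Hom C X Y" using fc by (simp add: is_cokernel_def X_def Y_def Hom_def)
  have c: "c \<in> Hom C Y Q" and cf: "c \<cdot> f = Zero C X Q"
    using C.is_cokernelD[OF fc f] Q_def by auto
  have X: "X \<in> Obj C" and Y: "Y \<in> Obj C" and Q: "Q \<in> Obj C" using C.Hom_Obj f c by auto
  note LX = L_Obj[OF X] and LQ = L_Obj[OF Q]
  note ce = C.is_cokernel_epi[OF fc]
  have tr: "fmap R (g \<cdot>\<^bsub>D\<^esub> fmap L h) \<cdot> \<eta> V = (fmap R g \<cdot> \<eta> W) \<cdot> h"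
    if h: "h \<in> Hom C V W" and g: "g \<in> Hom D (fobj L W) Z" for g h V W Z
  proof -
    have V: "V \<in> Obj C" and W: "W \<in> Obj C" using C.Hom_Obj[OF h] by auto
    show ?thesis
      using R_Comp[OF L_Hom[OF h] g] C.Comp_assoc[OF unit_Hom[OF V] R_Hom[OF L_Hom[OF h]] R_Hom[OF g]]
        unit_natural[OF h] C.Comp_assoc[OF h unit_Hom[OF W] R_Hom[OF g]] by simp
  qed
  show "is_cokernel D (fmap L f) (fmap L c)"
  proof (rule D.is_cokernelI[OF L_Hom[OF f] L_Hom[OF c]])
    show "epi_arr D (fmap L c)"
    proof (rule D.epi_arrI[OF L_Hom[OF c]])
      fix Z u v assume uv: "u \<in> Hom D (fobj L Q) Z" "v \<in> Hom D (fobj L Q) Z"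
        "u \<cdot>\<^bsub>D\<^esub> fmap L c = v \<cdot>\<^bsub>D\<^esub> fmap L c"
      have "(fmap R u \<cdot> \<eta> Q) \<cdot> c = (fmap R v \<cdot> \<eta> Q) \<cdot> c"
        using tr[OF c uv(1)] tr[OF c uv(2)] uv(3) by simp
      then have "fmap R u \<cdot> \<eta> Q = fmap R v \<cdot> \<eta> Q"
        using C.epi_arrD[OF ce c] C.Comp_in_Hom[OF unit_Hom[OF Q] R_Hom] uv(1,2) by blast
      then show "u = v" using transpose_inj[OF Q uv(1,2)] by simp
    qed
    have z: "Zero D (fobj L X) (fobj L Q) \<in> Hom D (fobj L X) (fobj L Q)"
      using D.Zero_in_Hom[OF LX LQ] .
    have "fmap R (Zero D (fobj L X) (fobj L Q)) \<cdot> \<eta> X = Zero C X (fobj R (fobj L Q))"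
      using R_Zero[OF LX LQ] C.Comp_Zero_left[OF R_Obj[OF LQ] unit_Hom[OF X]] by simp
    moreover have "fmap R (fmap L (Zero C X Q)) \<cdot> \<eta> X = Zero C X (fobj R (fobj L Q))"
      using unit_natural[OF C.Zero_in_Hom[OF X Q]] C.Comp_Zero_right[OF X unit_Hom[OF Q]] by simp
    ultimately have "fmap L (Zero C X Q) = Zero D (fobj L X) (fobj L Q)"
      using transpose_inj[OF X L_Hom[OF C.Zero_in_Hom[OF X Q]] z] by simp
    then show "fmap L c \<cdot>\<^bsub>D\<^esub> fmap L f = Zero D (fobj L X) (fobj L Q)"
      using L_Comp[OF f c] cf by simp
    fix Z h assume h: "h \<in> Hom D (fobj L Y) Z" "h \<cdot>\<^bsub>D\<^esub> fmap L f = Zero D (fobj L X) Z"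
    have Z: "Z \<in> Obj D" using D.Hom_Obj[OF h(1)] by simp
    let ?h = "fmap R h \<cdot> \<eta> Y"
    note hH = C.Comp_in_Hom[OF unit_Hom[OF Y] R_Hom[OF h(1)]]
    have "?h \<cdot> f = Zero C X (fobj R Z)"
      using tr[OF f h(1)] h(2) R_Zero[OF LX Z] C.Comp_Zero_left[OF R_Obj[OF Z] unit_Hom[OF X]]
      by simp
    then obtain u where u: "u \<in> Hom C Q (fobj R Z)" "u \<cdot> c = ?h"
      using C.is_cokernel_factor[OF fc f hH] Q_def by metis
    have "(\<epsilon> Z \<cdot>\<^bsub>D\<^esub> fmap L u) \<cdot>\<^bsub>D\<^esub> fmap L c = \<epsilon> Z \<cdot>\<^bsub>D\<^esub> fmap L ?h"
      using D.Comp_assoc[OF L_Hom[OF c] L_Hom[OF u(1)] counit_Hom[OF Z]] L_Comp[OF c u(1)] u(2)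
      by simp
    also have "\<dots> = h" using transpose_back[OF Y h(1)] .
    finally show "\<exists>u \<in> Hom D (fobj L Q) Z. u \<cdot>\<^bsub>D\<^esub> fmap L c = h"
      using D.Comp_in_Hom[OF L_Hom[OF u(1)] counit_Hom[OF Z]] by blast
  qed
qed

lemma left_adjoint_projective:
  assumes epi: "\<And>p. epi_arr D p \<Longrightarrow> epi_arr C (fmap R p)" and P: "projective C P"
  shows "projective D (fobj L P)"
  unfolding projective_def
proof (intro conjI allI impI)
  have Po: "P \<in> Obj C" using C.projective_Obj[OF P] .
  show "fobj L P \<in> Obj D" using L_Obj[OF Po] .
  fix p f assume pf: "epi_arr D p \<and> f \<in> Hom D (fobj L P) (Cod D p)"
  then have f: "f \<in> Hom D (fobj L P) (Cod D p)" and p: "p \<in> Hom D (Dom D p) (Cod D p)"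
    by (auto simp: epi_arr_def intro: D.Arr_Hom)
  have Xo: "Dom D p \<in> Obj D" using D.Hom_Obj[OF p] by simp
  obtain g where g: "g \<in> Hom C P (fobj R (Dom D p))" "fmap R p \<cdot> g = fmap R f \<cdot> \<eta> P"
    using C.projective_lift[OF P epi R_Hom[OF p] C.Comp_in_Hom[OF unit_Hom[OF Po] R_Hom[OF f]]] pf
    by blast
  let ?g = "\<epsilon> (Dom D p) \<cdot>\<^bsub>D\<^esub> fmap L g"
  have gH: "?g \<in> Hom D (fobj L P) (Dom D p)"
    using D.Comp_in_Hom[OF L_Hom[OF g(1)] counit_Hom[OF Xo]] .
  have "fmap R (p \<cdot>\<^bsub>D\<^esub> ?g) \<cdot> \<eta> P = fmap R p \<cdot> (fmap R ?g \<cdot> \<eta> P)"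
    using R_Comp[OF gH p] C.Comp_assoc[OF unit_Hom[OF Po] R_Hom[OF gH] R_Hom[OF p]] by simp
  also have "\<dots> = fmap R f \<cdot> \<eta> P" using transpose_forth[OF g(1) Xo] g(2) by simp
  finally have "p \<cdot>\<^bsub>D\<^esub> ?g = f" using transpose_inj[OF Po D.Comp_in_Hom[OF gH p] f] by simp
  then show "\<exists>g \<in> Hom D (fobj L P) (Dom D p). p \<cdot>\<^bsub>D\<^esub> g = f" using gH by blast
qed

end

section \<open>Cleft extensions\<close>

locale cleft =
  fixes B :: "('p, 'n) abcat" and A :: "('o, 'm) abcat"
    and e :: "('o, 'm, 'p, 'n) ftor" and i l :: "('p, 'n, 'o, 'm) ftor"
    and \<eta> :: "'p \<Rightarrow> 'n" and \<epsilon> :: "'o \<Rightarrow> 'm"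
    and G :: "('o, 'm, 'o, 'm) ftor" and \<kappa> :: "'o \<Rightarrow> 'm"
  assumes cleft: "cleft_extension B A e i l \<eta> \<epsilon>"
    and kernel: "kernel_functor A A (l \<circ>\<^sub>F e) \<epsilon> G \<kappa>"
begin

sublocale B: abelian_category B
  using cleft by (simp add: cleft_extension_def)

sublocale A: abelian_category A
  using cleft by (simp add: cleft_extension_def)

sublocale BB: two_abelian B B ..
sublocale AB: two_abelian A B ..

lemma e_exact: "exact_functor A B e" and e_faithful: "faithful_functor A B e"
  and i: "is_functor B A i"
  using cleft by (auto simp: cleft_extension_def)

lemmas e_cokernels = AB.exact_functor_preserves_cokernels[OF e_exact]

sublocale adj: adjoint_abelian B A l e \<eta> \<epsilon>
proof
  show "adjunction B A l e \<eta> \<epsilon>" using cleft by (simp add: cleft_extension_def)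
  show "fmap e (Zero A X Y) = Zero B (fobj e X) (fobj e Y)" if "X \<in> Obj A" "Y \<in> Obj A" for X Y
    using AB.preserves_cokernels_Zero[OF e_cokernels that] .
qed

lemmas l_cokernels = adj.left_adjoint_preserves_cokernels

abbreviation F :: "('p, 'n, 'p, 'n) ftor" where
  "F \<equiv> e \<circ>\<^sub>F G \<circ>\<^sub>F i"

text \<open>\<open>H\<close> stands for \<open>e l\<close> up to the isomorphism of \<open>e i\<close> with the identity. In this form the sequence
  \<open>0 \<rightarrow> F X \<rightarrow> H X \<rightarrow> e (i X) \<rightarrow> 0\<close> is the image under \<open>e\<close> of a sequence in \<open>A\<close>.\<close>

abbreviation H :: "('p, 'n, 'p, 'n) ftor" where
  "H \<equiv> (e \<circ>\<^sub>F l) \<circ>\<^sub>F (e \<circ>\<^sub>F i)"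

abbreviation incl :: "'p \<Rightarrow> 'n" where
  "incl X \<equiv> fmap e (\<kappa> (fobj i X))"

abbreviation proj :: "'p \<Rightarrow> 'n" where
  "proj X \<equiv> fmap e (\<epsilon> (fobj i X))"

lemmas i_Obj = is_functor_Obj[OF i] and i_Hom = B.is_functor_Hom[OF i]

text \<open>Under \<open>e\<close>, which reflects epimorphisms, the counit splits by the triangle identity.\<close>

lemma counit_epi:
  assumes Y: "Y \<in> Obj A"
  shows "epi_arr A (\<epsilon> Y)"
  using AB.faithful_functor_reflects_epi[OF e_faithful adj.counit_Hom[OF Y]]
    B.epi_arr_of_section[OF adj.unit_Hom[OF adj.R_Obj[OF Y]] adj.R_Hom[OF adj.counit_Hom[OF Y]]
      adj.triangle_R[OF Y]] by simp

lemma kernel_Hom: "Y \<in> Obj A \<Longrightarrow> \<kappa> Y \<in> Hom A (fobj G Y) (fobj l (fobj e Y))"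
  and kernel_natural: "f \<in> Hom A X Y \<Longrightarrow> \<kappa> Y \<cdot>\<^bsub>A\<^esub> fmap G f = fmap l (fmap e f) \<cdot>\<^bsub>A\<^esub> \<kappa> X"
  and G: "is_functor A A G"
  using kernel A.Hom_Obj by (simp_all add: kernel_functor_def natural_trans_def)

lemma F_functor: "is_functor B B F"
  using B.is_functor_comp_ftor[OF B.is_functor_comp_ftor[OF i G] adj.R] .

lemma H_functor: "is_functor B B H"
  using B.is_functor_comp_ftor[OF B.is_functor_comp_ftor[OF i adj.R]
      B.is_functor_comp_ftor[OF adj.L adj.R]] .

lemma F_H_short_exact:
  assumes X: "X \<in> Obj B"
  shows "short_exact B (incl X) (proj X)"
    and "incl X \<in> Hom B (fobj F X) (fobj H X)"
    and "proj X \<in> Hom B (fobj H X) (fobj e (fobj i X))"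
    and "\<eta> (fobj e (fobj i X)) \<in> Hom B (fobj e (fobj i X)) (fobj H X)"
    and "proj X \<cdot>\<^bsub>B\<^esub> \<eta> (fobj e (fobj i X)) = Ident B (fobj e (fobj i X))"
proof -
  note iX = i_Obj[OF X]
  have "short_exact A (\<kappa> (fobj i X)) (\<epsilon> (fobj i X))"
    using A.short_exact_of_epi[OF counit_epi[OF iX]] kernel iX by (simp add: kernel_functor_def)
  then show "short_exact B (incl X) (proj X)" using e_exact by (simp add: exact_functor_def)
  show "incl X \<in> Hom B (fobj F X) (fobj H X)" using adj.R_Hom[OF kernel_Hom[OF iX]] by simp
  show "proj X \<in> Hom B (fobj H X) (fobj e (fobj i X))"
    using adj.R_Hom[OF adj.counit_Hom[OF iX]] by simp
  show "\<eta> (fobj e (fobj i X)) \<in> Hom B (fobj e (fobj i X)) (fobj H X)"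
    using adj.unit_Hom[OF adj.R_Obj[OF iX]] by simp
  show "proj X \<cdot>\<^bsub>B\<^esub> \<eta> (fobj e (fobj i X)) = Ident B (fobj e (fobj i X))"
    using adj.triangle_R[OF iX] .
qed

lemma incl_natural:
  assumes f: "f \<in> Hom B X Y"
  shows "incl Y \<cdot>\<^bsub>B\<^esub> fmap F f = fmap H f \<cdot>\<^bsub>B\<^esub> incl X"
proof -
  note f' = i_Hom[OF f]
  have XY: "fobj i X \<in> Obj A" "fobj i Y \<in> Obj A" using A.Hom_Obj[OF f'] by auto
  show ?thesis
    using adj.R_Comp[OF A.is_functor_Hom[OF G f'] kernel_Hom[OF XY(2)]] kernel_natural[OF f']
      adj.R_Comp[OF kernel_Hom[OF XY(1)] adj.L_Hom[OF adj.R_Hom[OF f']]] by simp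
qed

lemma proj_natural:
  assumes f: "f \<in> Hom B X Y"
  shows "proj Y \<cdot>\<^bsub>B\<^esub> fmap H f = fmap e (fmap i f) \<cdot>\<^bsub>B\<^esub> proj X"
proof -
  note f' = i_Hom[OF f]
  have XY: "fobj i X \<in> Obj A" "fobj i Y \<in> Obj A" using A.Hom_Obj[OF f'] by auto
  show ?thesis
    using adj.R_Comp[OF adj.L_Hom[OF adj.R_Hom[OF f']] adj.counit_Hom[OF XY(2)]]
      adj.counit_natural[OF f'] adj.R_Comp[OF adj.counit_Hom[OF XY(1)] f'] by simp
qed

text \<open>The unit splits \<open>0 \<rightarrow> F X \<rightarrow> H X \<rightarrow> e (i X) \<rightarrow> 0\<close> naturally in \<open>X\<close>, so the retraction of \<open>H X\<close> onto \<open>F X\<close> that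
  kills the image of the unit is natural too.\<close>

lemma F_natural_retract:
  obtains \<rho> where "natural_trans B B H F \<rho>"
    "\<And>X. X \<in> Obj B \<Longrightarrow> \<rho> X \<cdot>\<^bsub>B\<^esub> incl X = Ident B (fobj F X)"
proof -
  let ?s = "\<lambda>X. \<eta> (fobj e (fobj i X))"
  let ?K = "\<lambda>X. fobj e (fobj i X)"
  have "\<exists>r. r \<in> Hom B (fobj H X) (fobj F X) \<and> r \<cdot>\<^bsub>B\<^esub> incl X = Ident B (fobj F X) \<and>
      r \<cdot>\<^bsub>B\<^esub> ?s X = Zero B (?K X) (fobj F X) \<and>
      Add B (incl X \<cdot>\<^bsub>B\<^esub> r) (?s X \<cdot>\<^bsub>B\<^esub> proj X) = Ident B (fobj H X)" if "X \<in> Obj B" for X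
    using B.short_exact_split[OF F_H_short_exact[OF that]] by metis
  then obtain r where r: "\<And>X. X \<in> Obj B \<Longrightarrow> r X \<in> Hom B (fobj H X) (fobj F X)"
    and rj: "\<And>X. X \<in> Obj B \<Longrightarrow> r X \<cdot>\<^bsub>B\<^esub> incl X = Ident B (fobj F X)"
    and rs: "\<And>X. X \<in> Obj B \<Longrightarrow> r X \<cdot>\<^bsub>B\<^esub> ?s X = Zero B (?K X) (fobj F X)"
    and sum: "\<And>X. X \<in> Obj B \<Longrightarrow> Add B (incl X \<cdot>\<^bsub>B\<^esub> r X) (?s X \<cdot>\<^bsub>B\<^esub> proj X) = Ident B (fobj H X)"
    by metis
  have nat: "r Y \<cdot>\<^bsub>B\<^esub> fmap H f = fmap F f \<cdot>\<^bsub>B\<^esub> r X" if f: "f \<in> Hom B X Y" for f X Y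
  proof -
    have X: "X \<in> Obj B" and Y: "Y \<in> Obj B" using B.Hom_Obj[OF f] by auto
    note jX = F_H_short_exact(2)[OF X] and jY = F_H_short_exact(2)[OF Y]
      and pX = F_H_short_exact(3)[OF X] and sX = F_H_short_exact(4)[OF X]
      and sY = F_H_short_exact(4)[OF Y]
      and Hf = B.is_functor_Hom[OF H_functor f] and Ff = B.is_functor_Hom[OF F_functor f]
      and ef = adj.R_Hom[OF i_Hom[OF f]]
    note FY = is_functor_Obj[OF F_functor Y] and KX = B.Hom_Obj(1)[OF sX]
    \<comment> \<open>\<open>H X\<close> is the direct sum of \<open>F X\<close> and \<open>e (i X)\<close>, so both sides are compared on the summands\<close>
    have on_F: "(r Y \<cdot>\<^bsub>B\<^esub> fmap H f) \<cdot>\<^bsub>B\<^esub> incl X = (fmap F f \<cdot>\<^bsub>B\<^esub> r X) \<cdot>\<^bsub>B\<^esub> incl X"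
    proof -
      have "(r Y \<cdot>\<^bsub>B\<^esub> fmap H f) \<cdot>\<^bsub>B\<^esub> incl X = (r Y \<cdot>\<^bsub>B\<^esub> incl Y) \<cdot>\<^bsub>B\<^esub> fmap F f"
        using B.Comp_assoc[OF jX Hf r[OF Y]] incl_natural[OF f] B.Comp_assoc[OF Ff jY r[OF Y]]
        by simp
      then show ?thesis
        using rj[OF Y] B.Comp_Ident_left[OF Ff] B.Comp_assoc[OF jX r[OF X] Ff] rj[OF X]
          B.Comp_Ident_right[OF Ff] by simp
    qed
    have on_ei: "(r Y \<cdot>\<^bsub>B\<^esub> fmap H f) \<cdot>\<^bsub>B\<^esub> ?s X = (fmap F f \<cdot>\<^bsub>B\<^esub> r X) \<cdot>\<^bsub>B\<^esub> ?s X"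
    proof -
      have "(r Y \<cdot>\<^bsub>B\<^esub> fmap H f) \<cdot>\<^bsub>B\<^esub> ?s X = (r Y \<cdot>\<^bsub>B\<^esub> ?s Y) \<cdot>\<^bsub>B\<^esub> fmap e (fmap i f)"
        using B.Comp_assoc[OF sX Hf r[OF Y]] adj.unit_natural[OF ef] B.Comp_assoc[OF ef sY r[OF Y]]
        by simp
      then show ?thesis
        using rs[OF Y] B.Comp_Zero_left[OF FY ef] B.Comp_assoc[OF sX r[OF X] Ff] rs[OF X]
          B.Comp_Zero_right[OF KX Ff] by simp
    qed
    have "u = v" if u: "u \<in> Hom B (fobj H X) Z" and v: "v \<in> Hom B (fobj H X) Z"
      and "u \<cdot>\<^bsub>B\<^esub> incl X = v \<cdot>\<^bsub>B\<^esub> incl X" "u \<cdot>\<^bsub>B\<^esub> ?s X = v \<cdot>\<^bsub>B\<^esub> ?s X" for u v Z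
    proof -
      have split: "w = Add B ((w \<cdot>\<^bsub>B\<^esub> incl X) \<cdot>\<^bsub>B\<^esub> r X) ((w \<cdot>\<^bsub>B\<^esub> ?s X) \<cdot>\<^bsub>B\<^esub> proj X)"
        if w: "w \<in> Hom B (fobj H X) Z" for w
        using B.Comp_Add_right[OF B.Comp_in_Hom[OF r[OF X] jX] B.Comp_in_Hom[OF pX sX] w]
          sum[OF X] B.Comp_Ident_right[OF w] B.Comp_assoc[OF r[OF X] jX w] B.Comp_assoc[OF pX sX w]
        by simp
      show ?thesis using split[OF u] split[OF v] that(3,4) by simp
    qed
    from this[OF B.Comp_in_Hom[OF Hf r[OF Y]] B.Comp_in_Hom[OF r[OF X] Ff] on_F on_ei]
    show ?thesis .
  qed
  have "natural_trans B B H F r" unfolding natural_trans_def using r nat by blast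
  then show ?thesis using that rj by blast
qed

definition \<theta> :: "'p \<Rightarrow> 'n" where
  "\<theta> = (SOME \<tau>. natural_trans B B (e \<circ>\<^sub>F i) id_ftor \<tau> \<and> (\<forall>X \<in> Obj B. iso_arr B (\<tau> X)))"

definition \<theta>_inv :: "'p \<Rightarrow> 'n" where
  "\<theta>_inv X = (SOME s. s \<in> Hom B X (fobj e (fobj i X)) \<and>
     s \<cdot>\<^bsub>B\<^esub> \<theta> X = Ident B (fobj e (fobj i X)) \<and> \<theta> X \<cdot>\<^bsub>B\<^esub> s = Ident B X)"

lemma \<theta>: "natural_trans B B (e \<circ>\<^sub>F i) id_ftor \<theta> \<and> (\<forall>X \<in> Obj B. iso_arr B (\<theta> X))"
proof -
  have "\<exists>\<tau>. natural_trans B B (e \<circ>\<^sub>F i) id_ftor \<tau> \<and> (\<forall>X \<in> Obj B. iso_arr B (\<tau> X))"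
    using cleft by (simp add: cleft_extension_def naturally_isomorphic_def)
  then show ?thesis unfolding \<theta>_def by (rule someI_ex)
qed

lemma \<theta>_Hom: "X \<in> Obj B \<Longrightarrow> \<theta> X \<in> Hom B (fobj e (fobj i X)) X"
  using \<theta> by (simp add: natural_trans_def)

lemma \<theta>_natural: "f \<in> Hom B X Y \<Longrightarrow> \<theta> Y \<cdot>\<^bsub>B\<^esub> fmap e (fmap i f) = f \<cdot>\<^bsub>B\<^esub> \<theta> X"
  using \<theta> B.Hom_Obj by (simp add: natural_trans_def)

lemma \<theta>_inv:
  assumes X: "X \<in> Obj B"
  shows "\<theta>_inv X \<in> Hom B X (fobj e (fobj i X))"
    and "\<theta>_inv X \<cdot>\<^bsub>B\<^esub> \<theta> X = Ident B (fobj e (fobj i X))"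
    and "\<theta> X \<cdot>\<^bsub>B\<^esub> \<theta>_inv X = Ident B X"
proof -
  have "iso_arr B (\<theta> X)" using \<theta> X by blast
  then have "\<exists>s. s \<in> Hom B X (fobj e (fobj i X)) \<and>
      s \<cdot>\<^bsub>B\<^esub> \<theta> X = Ident B (fobj e (fobj i X)) \<and> \<theta> X \<cdot>\<^bsub>B\<^esub> s = Ident B X"
    using HomD(2,3)[OF \<theta>_Hom[OF X]] unfolding iso_arr_def by auto
  from someI_ex[OF this] show "\<theta>_inv X \<in> Hom B X (fobj e (fobj i X))"
    "\<theta>_inv X \<cdot>\<^bsub>B\<^esub> \<theta> X = Ident B (fobj e (fobj i X))" "\<theta> X \<cdot>\<^bsub>B\<^esub> \<theta>_inv X = Ident B X"
    unfolding \<theta>_inv_def by auto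
qed

lemma \<theta>_inv_natural:
  assumes f: "f \<in> Hom B X Y"
  shows "\<theta>_inv Y \<cdot>\<^bsub>B\<^esub> f = fmap e (fmap i f) \<cdot>\<^bsub>B\<^esub> \<theta>_inv X"
proof -
  have X: "X \<in> Obj B" and Y: "Y \<in> Obj B" using B.Hom_Obj[OF f] by auto
  note ef = adj.R_Hom[OF i_Hom[OF f]] and \<sigma>X = \<theta>_inv(1)[OF X] and \<sigma>Y = \<theta>_inv(1)[OF Y]
  note comp = B.Comp_in_Hom[OF \<sigma>X ef]
  have "f = \<theta> Y \<cdot>\<^bsub>B\<^esub> (fmap e (fmap i f) \<cdot>\<^bsub>B\<^esub> \<theta>_inv X)"
    using B.Comp_assoc[OF \<sigma>X \<theta>_Hom[OF X] f] \<theta>_inv(3)[OF X] B.Comp_Ident_right[OF f]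
      \<theta>_natural[OF f] B.Comp_assoc[OF \<sigma>X ef \<theta>_Hom[OF Y]] by simp
  then have "\<theta>_inv Y \<cdot>\<^bsub>B\<^esub> f = (\<theta>_inv Y \<cdot>\<^bsub>B\<^esub> \<theta> Y) \<cdot>\<^bsub>B\<^esub> (fmap e (fmap i f) \<cdot>\<^bsub>B\<^esub> \<theta>_inv X)"
    using B.Comp_assoc[OF comp \<theta>_Hom[OF Y] \<sigma>Y] by metis
  then show ?thesis using \<theta>_inv(2)[OF Y] B.Comp_Ident_left[OF comp] by simp
qed

lemma F_cokernels: "preserves_cokernels B B F"
proof -
  have "preserves_cokernels B B (e \<circ>\<^sub>F i)"
    by (rule BB.preserves_cokernels_retract[of id_ftor "e \<circ>\<^sub>F i" \<theta> \<theta>_inv])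
      (use \<theta> \<theta>_inv \<theta>_inv_natural preserves_cokernels_id B.is_functor_comp_ftor[OF i adj.R]
        in \<open>auto simp: natural_trans_def\<close>)
  then have H: "preserves_cokernels B B H"
    using preserves_cokernels_comp[OF B.category_axioms _
        preserves_cokernels_comp[OF B.category_axioms l_cokernels e_cokernels]] by blast
  obtain \<rho> where \<rho>: "natural_trans B B H F \<rho>"
    "\<And>X. X \<in> Obj B \<Longrightarrow> \<rho> X \<cdot>\<^bsub>B\<^esub> incl X = Ident B (fobj F X)"
    using F_natural_retract by blast
  have "natural_trans B B F H incl"
    unfolding natural_trans_def using F_H_short_exact(2) incl_natural by blast
  then show ?thesis using BB.preserves_cokernels_retract[OF H F_functor _ \<rho>] by blast
qed

text \<open>As \<open>e\<close> reflects monomorphisms and \<open>e i\<close> is isomorphic to the identity, it is enough that \<open>H f\<close> is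
  mono; and \<open>H X\<close> is an extension of \<open>e (i X)\<close> by \<open>F X\<close>.\<close>

lemma l_mono:
  assumes f: "f \<in> Hom B X Y" and mono: "mono_arr B f" and monoF: "mono_arr B (fmap F f)"
  shows "mono_arr A (fmap l f)"
proof -
  have X: "X \<in> Obj B" and Y: "Y \<in> Obj B" using B.Hom_Obj[OF f] by auto
  note jX = F_H_short_exact(2)[OF X] and jY = F_H_short_exact(2)[OF Y]
    and pX = F_H_short_exact(3)[OF X] and pY = F_H_short_exact(3)[OF Y]
    and Hf = B.is_functor_Hom[OF H_functor f] and Ff = B.is_functor_Hom[OF F_functor f]
    and eif = adj.R_Hom[OF i_Hom[OF f]]
  have "mono_arr B (f \<cdot>\<^bsub>B\<^esub> \<theta> X)"
    using B.mono_arr_Comp[OF \<theta>_Hom[OF X] _ f mono]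
      B.mono_arr_of_retraction[OF \<theta>_Hom[OF X] \<theta>_inv(1,2)[OF X]] by blast
  then have "mono_arr B (\<theta> Y \<cdot>\<^bsub>B\<^esub> fmap e (fmap i f))" using \<theta>_natural[OF f] by simp
  then have mono_ei: "mono_arr B (fmap e (fmap i f))"
    using B.mono_arr_of_Comp[OF eif \<theta>_Hom[OF Y]] by simp
  have monoH: "mono_arr B (fmap H f)"
  proof (rule B.mono_arr_zeroI[OF Hf])
    fix W u assume u: "u \<in> Hom B W (fobj H X)" "fmap H f \<cdot>\<^bsub>B\<^esub> u = Zero B W (fobj H Y)"
    have W: "W \<in> Obj B" using B.Hom_Obj[OF u(1)] by simp
    have "fmap e (fmap i f) \<cdot>\<^bsub>B\<^esub> (proj X \<cdot>\<^bsub>B\<^esub> u) = proj Y \<cdot>\<^bsub>B\<^esub> (fmap H f \<cdot>\<^bsub>B\<^esub> u)"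
      using B.Comp_assoc[OF u(1) pX eif] proj_natural[OF f] B.Comp_assoc[OF u(1) Hf pY] by simp
    then have "fmap e (fmap i f) \<cdot>\<^bsub>B\<^esub> (proj X \<cdot>\<^bsub>B\<^esub> u) = Zero B W (fobj e (fobj i Y))"
      using u(2) B.Comp_Zero_right[OF W pY] by simp
    then have "proj X \<cdot>\<^bsub>B\<^esub> u = Zero B W (fobj e (fobj i X))"
      using B.mono_arr_zeroD[OF mono_ei eif B.Comp_in_Hom[OF u(1) pX]] by simp
    then obtain w where w: "w \<in> Hom B W (fobj F X)" "incl X \<cdot>\<^bsub>B\<^esub> w = u"
      using B.short_exact_factor[OF F_H_short_exact(1)[OF X] pX u(1)] HomD(2)[OF jX] by metis
    have "incl Y \<cdot>\<^bsub>B\<^esub> (fmap F f \<cdot>\<^bsub>B\<^esub> w) = fmap H f \<cdot>\<^bsub>B\<^esub> (incl X \<cdot>\<^bsub>B\<^esub> w)"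
      using B.Comp_assoc[OF w(1) Ff jY] incl_natural[OF f] B.Comp_assoc[OF w(1) jX Hf] by simp
    then have "incl Y \<cdot>\<^bsub>B\<^esub> (fmap F f \<cdot>\<^bsub>B\<^esub> w) = Zero B W (fobj H Y)" using w(2) u(2) by simp
    then have "fmap F f \<cdot>\<^bsub>B\<^esub> w = Zero B W (fobj F Y)"
      using B.mono_arr_zeroD[OF B.short_exact_Hom(4)[OF F_H_short_exact(1)[OF Y]] jY
          B.Comp_in_Hom[OF w(1) Ff]] by simp
    then have "w = Zero B W (fobj F X)" using B.mono_arr_zeroD[OF monoF Ff w(1)] by simp
    then show "u = Zero B W (fobj H X)" using w(2) B.Comp_Zero_right[OF W jX] by simp
  qed
  let ?el = "\<lambda>g. fmap e (fmap l g)"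
  have el: "?el g \<in> Hom B (fobj e (fobj l Z)) (fobj e (fobj l Z'))" if "g \<in> Hom B Z Z'" for g Z Z'
    using adj.R_Hom[OF adj.L_Hom[OF that]] .
  have el_Comp: "?el (h \<cdot>\<^bsub>B\<^esub> g) = ?el h \<cdot>\<^bsub>B\<^esub> ?el g"
    if "g \<in> Hom B Z Z'" "h \<in> Hom B Z' Z''" for g h Z Z' Z''
    using adj.L_Comp[OF that] adj.R_Comp[OF adj.L_Hom[OF that(1)] adj.L_Hom[OF that(2)]] by simp
  have el_split: "mono_arr B (?el g)"
    if g: "g \<in> Hom B Z Z'" "g' \<in> Hom B Z' Z" "g' \<cdot>\<^bsub>B\<^esub> g = Ident B Z" for g g' Z Z'
  proof (rule B.mono_arr_of_retraction[OF el[OF g(1)] el[OF g(2)]])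
    show "?el g' \<cdot>\<^bsub>B\<^esub> ?el g = Ident B (fobj e (fobj l Z))"
      using el_Comp[OF g(1,2)] g(3) B.Hom_Obj[OF g(1)]
        is_functor_Ident[OF adj.L] is_functor_Ident[OF adj.R] adj.L_Obj by simp
  qed
  have "mono_arr B (?el (\<theta>_inv Y \<cdot>\<^bsub>B\<^esub> f))"
    using \<theta>_inv_natural[OF f] el_Comp[OF \<theta>_inv(1)[OF X] eif]
      B.mono_arr_Comp[OF el[OF \<theta>_inv(1)[OF X]] el_split[OF \<theta>_inv(1)[OF X] \<theta>_Hom[OF X] \<theta>_inv(3)[OF X]] el[OF eif]] monoH
    by simp
  then have "mono_arr B (?el f)"
    using el_Comp[OF f \<theta>_inv(1)[OF Y]] B.mono_arr_of_Comp[OF el[OF f] el[OF \<theta>_inv(1)[OF Y]]] by simp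
  then show ?thesis
    using AB.faithful_functor_reflects_mono[OF e_faithful adj.L_Hom[OF f]] by simp
qed

lemma l_projective: "projective B P \<Longrightarrow> projective A (fobj l P)"
  using adj.left_adjoint_projective AB.preserves_cokernels_epi[OF e_cokernels] by blast

end

section \<open>Perfect endofunctors of cleft extensions\<close>

locale perfect_cleft = cleft B A e i l \<eta> \<epsilon> G \<kappa>
  for B :: "('p, 'n) abcat" and A :: "('o, 'm) abcat"
    and e :: "('o, 'm, 'p, 'n) ftor" and i l :: "('p, 'n, 'o, 'm) ftor"
    and \<eta> \<epsilon> and G :: "('o, 'm, 'o, 'm) ftor" and \<kappa> +
  assumes enoughB: "enough_projectives B" and enoughA: "enough_projectives A"
    and perfect: "perfect_functor B (e \<circ>\<^sub>F G \<circ>\<^sub>F i)"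
begin

abbreviation Fp :: "nat \<Rightarrow> ('p, 'n, 'p, 'n) ftor" where
  "Fp j \<equiv> pow_ftor F j"

lemma Fp_cokernels: "preserves_cokernels B B (Fp j)"
  using preserves_cokernels_pow[OF B.category_axioms F_cokernels] .

lemma Fp_right_exact: "right_exact B B (Fp j)"
  by unfold_locales (rule Fp_cokernels enoughB)+

text \<open>Perfectness speaks of \<open>j > 0\<close>; for \<open>j = 0\<close> the functor is the identity, and hence exact.\<close>

lemma derived_Fp_vanishes:
  assumes P: "projective B P"
  shows "derived_vanishes B B (Fp j) n (fobj F P)"
proof -
  interpret Fj: right_exact B B "Fp j" by (rule Fp_right_exact)
  have FP: "fobj F P \<in> Obj B" using is_functor_Obj[OF F_functor B.projective_Obj[OF P]] .
  show ?thesis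
  proof (cases "j = 0")
    case True then show ?thesis using Fj.derived_vanishes_of_exact[OF _ FP] by simp
  next
    case False
    then have "zero_object B (left_derived B B (Fp j) (Suc n) (fobj F P))"
      using perfect P unfolding perfect_functor_def by blast
    then show ?thesis using Fj.derived_vanishes_of_left_derived[OF FP] by blast
  qed
qed

lemma derived_Fp_bound:
  assumes "j > 0"
  obtains N where "\<And>n X. n \<ge> N \<Longrightarrow> X \<in> Obj B \<Longrightarrow> derived_vanishes B B (Fp j) n X"
proof -
  interpret Fj: right_exact B B "Fp j" by (rule Fp_right_exact)
  obtain N where N: "\<forall>m>0. \<forall>k>0. m + k \<ge> N + 1 \<longrightarrow>
      (\<forall>X \<in> Obj B. zero_object B (left_derived B B (Fp k) m X))"
    using perfect unfolding perfect_functor_def by (elim conjE exE) (rule that)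
  have "derived_vanishes B B (Fp j) n X" if n: "n \<ge> N" and X: "X \<in> Obj B" for n X
  proof -
    have "Suc n + j \<ge> N + 1" using n by simp
    then have "zero_object B (left_derived B B (Fp j) (Suc n) X)" using N assms X by blast
    then show ?thesis using Fj.derived_vanishes_of_left_derived[OF X] by blast
  qed
  then show ?thesis using that by blast
qed

lemma finite_proj_dim_F: "projective B P \<Longrightarrow> proj_dim B (fobj F P) < \<infinity>"
  using perfect by (simp add: perfect_functor_def)

lemma Fp_acyclic:
  assumes "acyclic_complex B E" "j > 0" "\<And>n k. derived_vanishes B B (Fp j) n (cobj E k)"
  shows "acyclic_complex B (map_complex (Fp j) E)"
proof -
  interpret Fj: right_exact B B "Fp j" by (rule Fp_right_exact)
  show ?thesis using Fj.acyclic_map_complex[OF assms(1,3)] derived_Fp_bound[OF assms(2)] by metis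
qed

text \<open>Terms of \<open>P\<close> are projective, hence \<open>F\<close>-acyclic, and \<open>F P'\<close> has finite projective dimension.\<close>

lemma perfect_compatible_C1: "compatible_C1 B F"
  unfolding compatible_C1_def
proof (intro allI impI)
  fix P P' assume "complete_projective_resolution B P \<and> projective B P'"
  then have P: "acyclic_complex B P" "\<And>n. projective B (cobj P n)"
    "\<And>Q. projective B Q \<Longrightarrow> hom_acyclic B P Q" and P': "projective B P'"
    by (auto simp: complete_projective_resolution_def)
  interpret F1: right_exact B B "Fp 1" by (rule Fp_right_exact)
  have Pc: "is_complex B P" using P(1) by (simp add: acyclic_complex_def)
  have "acyclic_complex B (map_complex (Fp 1) P)"
    using Fp_acyclic[OF P(1) zero_less_one F1.derived_vanishes_projective[OF P(2)]] .
  then have "acyclic_complex B (map_complex F P)" by (simp add: comp_ftor_id)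
  moreover have "hom_acyclic B P (fobj F P')"
  proof (rule B.finite_proj_dim_induct[OF finite_proj_dim_F[OF P']])
    show "hom_acyclic B P Z" if "zero_object B Z" for Z using B.hom_acyclic_zero_object[OF Pc that] .
    show "hom_acyclic B P Y" if "short_exact B a b" "a \<in> Hom B K Q" "b \<in> Hom B Q Y"
      "projective B Q" "hom_acyclic B P K" for a b K Q Y
      using B.hom_acyclic_quotient[OF Pc P(2) that(1-3,5) P(3)[OF that(4)]] .
  qed
  ultimately show "acyclic_complex B (map_complex F P) \<and> hom_acyclic B P (fobj F P')" by simp
qed

text \<open>\<open>e Q\<close> is a retract of \<open>e l P\<close> for a projective cover \<open>P\<close> of \<open>e Q\<close>, and \<open>e l P\<close> is isomorphic to \<open>H P\<close>, an
  extension of \<open>e (i P)\<close>, a copy of \<open>P\<close>, by \<open>F P\<close>.\<close>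

lemma derived_Fp_e_projective:
  assumes Q: "projective A Q"
  shows "derived_vanishes B B (Fp j) n (fobj e Q)"
proof -
  interpret Fj: right_exact B B "Fp j" by (rule Fp_right_exact)
  have Qo: "Q \<in> Obj A" using A.projective_Obj[OF Q] .
  obtain P p where P: "projective B P" and p: "p \<in> Hom B P (fobj e Q)" "epi_arr B p"
    using Fj.projective_cover[OF adj.R_Obj[OF Qo]] by metis
  have Po: "P \<in> Obj B" using B.projective_Obj[OF P] .
  have "derived_vanishes B B (Fp j) n (fobj e (fobj i P))"
    using Fj.derived_vanishes_retract[OF Fj.derived_vanishes_projective[OF P] \<theta>_Hom[OF Po] \<theta>_inv(1,2)[OF Po]] .
  then have H: "derived_vanishes B B (Fp j) n (fobj H P)"
    using Fj.derived_vanishes_extension[OF F_H_short_exact(1,2,3)[OF Po] derived_Fp_vanishes[OF P]]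
    by blast
  \<comment> \<open>\<open>Q\<close> is a retract of \<open>l P\<close> through the epimorphism \<open>l P \<rightarrow> l (e Q) \<rightarrow> Q\<close>\<close>
  note lp = adj.L_Hom[OF p(1)] and cQ = adj.counit_Hom[OF Qo]
  let ?q = "\<epsilon> Q \<cdot>\<^bsub>A\<^esub> fmap l p"
  have q: "?q \<in> Hom A (fobj l P) Q" using A.Comp_in_Hom[OF lp cQ] .
  have "epi_arr A ?q"
    using A.epi_arr_Comp[OF lp adj.preserves_cokernels_epi[OF l_cokernels p(2)] cQ counit_epi[OF Qo]] .
  then obtain s where s: "s \<in> Hom A Q (fobj l P)" "?q \<cdot>\<^bsub>A\<^esub> s = Ident A Q"
    using A.projective_section[OF Q _ q] by metis
  have "fmap e ?q \<cdot>\<^bsub>B\<^esub> fmap e s = Ident B (fobj e Q)"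
    using adj.R_Comp[OF s(1) q] s(2) is_functor_Ident[OF adj.R Qo] by simp
  moreover have "derived_vanishes B B (Fp j) n (fobj e (fobj l P))"
  proof (rule Fj.derived_vanishes_retract[OF H])
    show "fmap e (fmap l (\<theta>_inv P)) \<in> Hom B (fobj e (fobj l P)) (fobj H P)"
      using adj.R_Hom[OF adj.L_Hom[OF \<theta>_inv(1)[OF Po]]] by simp
    show "fmap e (fmap l (\<theta> P)) \<in> Hom B (fobj H P) (fobj e (fobj l P))"
      using adj.R_Hom[OF adj.L_Hom[OF \<theta>_Hom[OF Po]]] by simp
    show "fmap e (fmap l (\<theta> P)) \<cdot>\<^bsub>B\<^esub> fmap e (fmap l (\<theta>_inv P)) = Ident B (fobj e (fobj l P))"
      using adj.R_Comp[OF adj.L_Hom[OF \<theta>_inv(1)[OF Po]] adj.L_Hom[OF \<theta>_Hom[OF Po]]]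
        adj.L_Comp[OF \<theta>_inv(1)[OF Po] \<theta>_Hom[OF Po]] \<theta>_inv(3)[OF Po] is_functor_Ident[OF adj.L Po]
        is_functor_Ident[OF adj.R adj.L_Obj[OF Po]] by simp
  qed
  ultimately show ?thesis
    using Fj.derived_vanishes_retract[OF _ adj.R_Hom[OF s(1)] adj.R_Hom[OF q]] by blast
qed

text \<open>Induction along a finite projective resolution of \<open>F P\<close>, nested in the induction on \<open>j\<close>. The statement
  proved along the resolution carries the vanishing of the derived functors of \<open>F\<^sup>j\<close> and \<open>F\<^sup>j\<^sup>+\<^sup>1\<close> on
  the syzygies, since this is what keeps the short exact sequences exact under \<open>l F\<^sup>j\<close>.\<close>

lemma hom_acyclic_l_Fp:
  assumes Q: "complete_projective_resolution A Q"
  shows "projective B P \<Longrightarrow> hom_acyclic A Q (fobj l (fobj (Fp j) P))"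
proof (induction j arbitrary: P)
  case 0
  then show ?case
    using Q l_projective by (simp add: complete_projective_resolution_def)
next
  case (Suc j)
  have Qc: "is_complex A Q" and Qp: "\<And>n. projective A (cobj Q n)"
    using Q by (auto simp: complete_projective_resolution_def acyclic_complex_def)
  interpret Fj: right_exact B B "Fp j" by (rule Fp_right_exact)
  let ?van = "\<lambda>Y. \<forall>n. derived_vanishes B B (Fp j) n Y \<and> derived_vanishes B B (Fp (Suc j)) n Y"
  let ?T = "l \<circ>\<^sub>F Fp j"
  have T: "preserves_cokernels B A ?T"
    using preserves_cokernels_comp[OF B.category_axioms Fp_cokernels l_cokernels] .
  have "?van (fobj F P) \<longrightarrow> hom_acyclic A Q (fobj ?T (fobj F P))"
  proof (rule B.finite_proj_dim_induct[OF finite_proj_dim_F[OF Suc.prems]])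
    show "?van Z \<longrightarrow> hom_acyclic A Q (fobj ?T Z)" if "zero_object B Z" for Z
      using A.hom_acyclic_zero_object[OF Qc adj.preserves_cokernels_zero_object[OF T that]] by blast
    show "?van Y \<longrightarrow> hom_acyclic A Q (fobj ?T Y)"
      if ab: "short_exact B a b" "a \<in> Hom B K R" "b \<in> Hom B R Y" and R: "projective B R"
        and K: "?van K \<longrightarrow> hom_acyclic A Q (fobj ?T K)" for a b K R Y
    proof
      assume Y: "?van Y"
      have "?van K" using Y derived_vanishes_SucD[OF _ ab(1,3) R ab(2)] by blast
      then have K': "hom_acyclic A Q (fobj ?T K)" using K by blast
      have "mono_arr B (fmap (Fp j) a)" "mono_arr B (fmap F (fmap (Fp j) a))"
        using derived_vanishes_0D[OF _ ab(1,3)] Y by (blast, fastforce)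
      then have "mono_arr A (fmap ?T a)"
        using l_mono[OF Fj.T_Hom[OF ab(2)]] by simp
      then have se: "short_exact A (fmap ?T a) (fmap ?T b)"
        using adj.preserves_cokernels_short_exact[OF T ab(1)] by blast
      have TF: "is_functor B A ?T" using T by (simp add: preserves_cokernels_def)
      show "hom_acyclic A Q (fobj ?T Y)"
        using A.hom_acyclic_quotient[OF Qc Qp se B.is_functor_Hom[OF TF ab(2)]
            B.is_functor_Hom[OF TF ab(3)] K'] Suc.IH[OF R] by simp
    qed
  qed
  then show ?case
    using derived_Fp_vanishes[OF Suc.prems] by (simp only: pow_ftor_Suc_right comp_ftor_simps) blast
qed

lemma perfect_nilpotent_compatible_C2_ii:
  assumes nil: "nilpotent_functor B F"
  shows "compatible_C2_ii B A e l F"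
  unfolding compatible_C2_ii_def
proof (intro conjI nil allI impI)
  show "zero_object B (left_derived B B (Fp j) m (fobj F P))"
    if "m > 0" "j > 0" "projective B P" for m j P
    using perfect that unfolding perfect_functor_def by blast
  fix Q P and j :: nat
  assume j: "j > 0" and QP: "complete_projective_resolution A Q \<and> projective B P"
  then have Q: "acyclic_complex A Q" "\<And>n. projective A (cobj Q n)"
    by (auto simp: complete_projective_resolution_def)
  interpret E: right_exact A B e by unfold_locales (rule e_cokernels enoughA)+
  have "derived_vanishes A B e n X" if "X \<in> Obj A" for n X
    using E.derived_vanishes_of_exact[OF AB.exact_functor_mono[OF e_exact] that] .
  then have eQ: "acyclic_complex B (map_complex e Q)"
    using E.acyclic_map_complex[OF Q(1)] A.projective_Obj[OF Q(2)] by blast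
  have "map_complex (Fp j \<circ>\<^sub>F e) Q = map_complex (Fp j) (map_complex e Q)"
    by (simp add: map_complex_def)
  moreover have "acyclic_complex B (map_complex (Fp j) (map_complex e Q))"
    using Fp_acyclic[OF eQ j] derived_Fp_e_projective[OF Q(2)] by (simp add: map_complex_def)
  ultimately show "acyclic_complex B (map_complex (Fp j \<circ>\<^sub>F e) Q)" by simp
  show "hom_acyclic A Q (fobj (l \<circ>\<^sub>F Fp j) P)"
    using hom_acyclic_l_Fp QP by simp
qed

end

theorem proposition3p6:
  fixes B :: "('p, 'n) abcat" and A :: "('o, 'm) abcat"
    and e :: "('o, 'm, 'p, 'n) ftor" and i l :: "('p, 'n, 'o, 'm) ftor"
    and \<eta> :: "'p \<Rightarrow> 'n" and \<epsilon> :: "'o \<Rightarrow> 'm"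
    and G :: "('o, 'm, 'o, 'm) ftor" and \<kappa> :: "'o \<Rightarrow> 'm"
    and F :: "('p, 'n, 'p, 'n) ftor"
  assumes "cleft_extension B A e i l \<eta> \<epsilon>"
    and "enough_projectives B" and "enough_projectives A"
    and "kernel_functor A A (l \<circ>\<^sub>F e) \<epsilon> G \<kappa>"
    and "F = e \<circ>\<^sub>F G \<circ>\<^sub>F i"
    and "perfect_functor B F" and "nilpotent_functor B F"
  shows "compatible_cleft B A e i l F"
proof -
  interpret perfect_cleft B A e i l \<eta> \<epsilon> G \<kappa>
    by unfold_locales (use assms in simp_all)
  show ?thesis
    unfolding compatible_cleft_def
    using perfect_compatible_C1 perfect_nilpotent_compatible_C2_ii assms(5,7) by simp
qed

end
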